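(* Let $0<p\le q<\infty$ and $\omega,\nu\in\mathcal{D}$. Let $\varphi$ be an analytic self-map of $\mathbb{D}$, $u\in A^q_\nu$, and $n\in\mathbb{N}\cup\{0\}$. Let $D^n_{\varphi,u}$ be the operator $D^n_{\varphi,u}f=u\cdot(f^{(n)}\circ\varphi)$. Then there exists $\gamma=\gamma(p,\omega)>0$, depending only on $p$ and $\omega$, such that the following statements hold: (i) $D^n_{\varphi,u}:A^p_\omega\to A^q_\nu$ is bounded if and only if $$\sup_{a\in\mathbb{D}}\int_{\mathbb{D}}|u(z)|^q\,\frac{(1-|a|)^{\gamma q}}{|1-\overline{a}\varphi(z)|^{(\gamma+n)q}}\,\frac{\nu(z)}{\omega(S(a))^{\frac{q}{p}}}\,dA(z)<\infty;$$ (ii) $D^n_{\varphi,u}:A^p_\omega\to A^q_\nu$ is compact if and only if $$\lim_{|a|\to1}\int_{\mathbb{D}}|u(z)|^q\,\frac{(1-|a|)^{\gamma q}}{|1-\overline{a}\varphi(z)|^{(\gamma+n)q}}\,\frac{\nu(z)}{\omega(S(a))^{\frac{q}{p}}}\,dA(z)=0.$$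
   Context: $\mathbb{D}=\{z\in\mathbb{C}:|z|<1\}$; $\mathcal{H}(\mathbb{D})$ is the space of analytic functions on $\mathbb{D}$; $dA(z)=\frac{dx\,dy}{\pi}$ is normalized area measure. An analytic self-map of $\mathbb{D}$ is an analytic function $\varphi:\mathbb{D}\to\mathbb{D}$. A weight is an integrable function $\omega:\mathbb{D}\to[0,\infty)$; it is radial if $\omega(z)=\omega(|z|)$ for all $z\in\mathbb{D}$. For a radial weight, $\widehat{\omega}(z)=\int_{|z|}^1\omega(s)\,ds$ for $z\in\mathbb{D}$; radial weights are taken to be nontrivial (not almost everywhere zero). The class $\mathcal{D}$ of doubling weights consists of the radial weights $\omega$ satisfying both: (1) there is a constant $C=C(\omega)\ge 1$ with $\widehat{\omega}(r)\le C\,\widehat{\omega}\left(\frac{1+r}{2}\right)$ for all $0\le r<1$; (2) there are constants $K=K(\omega)>1$ and $C=C(\omega)>1$ with $\widehat{\omega}(r)\ge C\,\widehat{\omega}\left(1-\frac{1-r}{K}\right)$ for all $0\le r<1$. For $0<p<\infty$ and a weight $\omega$, the weighted Bergman space $A^p_\omega$ consists of $f\in\mathcal{H}(\mathbb{D})$ with $\|f\|^p_{A^p_\omega}=\int_{\mathbb{D}}|f|^p\omega\,dA<\infty$. For measurable $E\subset\mathbb{D}$, $\omega(E)=\int_E\omega\,dA$. The Carleson square is $S(z)=\{\zeta\in\mathbb{D}:|z|<|\zeta|,\ |\arg\zeta-\arg z|<(1-|z|)/2\}$ for $z\in\mathbb{D}\setminus\{0\}$ (arguments compared modulo $2\pi$),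 and $S(0)=\mathbb{D}$. *)

theory Defs
  imports "HOL-Complex_Analysis.Complex_Analysis"
begin

abbreviation unit_disc :: "complex set" where
  "unit_disc \<equiv> ball 0 1"

text \<open>Normalized area measure, as a measure whose space is the unit disc.\<close>

definition dA :: "complex measure" where
  "dA = scale_measure (ennreal (1 / pi)) (lebesgue_on unit_disc)"

text \<open>Weights and analytic functions on the disc are total functions on the complex plane;
  only their values on the disc matter.\<close>

definition weight :: "(complex \<Rightarrow> real) \<Rightarrow> bool" where
  "weight \<omega> \<longleftrightarrow> (\<forall>z\<in>unit_disc. 0 \<le> \<omega> z) \<and> integrable dA \<omega>"

definition radial_weight :: "(complex \<Rightarrow> real) \<Rightarrow> bool" where
  "radial_weight \<omega> \<longleftrightarrow> weight \<omega> \<and> (\<forall>z\<in>unit_disc. \<omega> z = \<omega> (of_real (norm z)))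
     \<and> \<not> (AE z in dA. \<omega> z = 0)"

text \<open>The tail integral is extended-valued: integrability with respect to area does not exclude
  that it is infinite at the origin.\<close>

definition weight_tail :: "(complex \<Rightarrow> real) \<Rightarrow> complex \<Rightarrow> ennreal" where
  "weight_tail \<omega> z = (\<integral>\<^sup>+s\<in>{norm z<..<1}. ennreal (\<omega> (of_real s)) \<partial>lebesgue)"

definition doubling_weights :: "(complex \<Rightarrow> real) set" where
  "doubling_weights = {\<omega>. radial_weight \<omega>
     \<and> (\<exists>C\<ge>1. \<forall>r\<in>{0..<1::real}.
           weight_tail \<omega> (of_real r) \<le> ennreal C * weight_tail \<omega> (of_real ((1 + r) / 2)))
     \<and> (\<exists>K>1. \<exists>C>1. \<forall>r\<in>{0..<1::real}.
           weight_tail \<omega> (of_real r) \<ge> ennreal C * weight_tail \<omega> (of_real (1 - (1 - r) / K)))}"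

definition bergman_space :: "real \<Rightarrow> (complex \<Rightarrow> real) \<Rightarrow> (complex \<Rightarrow> complex) set" where
  "bergman_space p \<omega> = {f. f holomorphic_on unit_disc
     \<and> integrable dA (\<lambda>z. norm (f z) powr p * \<omega> z)}"

definition bergman_norm :: "real \<Rightarrow> (complex \<Rightarrow> real) \<Rightarrow> (complex \<Rightarrow> complex) \<Rightarrow> real" where
  "bergman_norm p \<omega> f = (LINT z|dA. norm (f z) powr p * \<omega> z) powr (1 / p)"

definition weight_measure :: "(complex \<Rightarrow> real) \<Rightarrow> complex set \<Rightarrow> real" where
  "weight_measure \<omega> E = (LINT z:E|dA. \<omega> z)"

text \<open>The integer \<open>k\<close> expresses that arguments are compared modulo \<open>2 * pi\<close>.\<close>

definition carleson_square :: "complex \<Rightarrow> complex set" where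
  "carleson_square z = (if z = 0 then unit_disc else
     {\<zeta>\<in>unit_disc. norm z < norm \<zeta>
        \<and> (\<exists>k::int. \<bar>Arg \<zeta> - Arg z + 2 * pi * of_int k\<bar> < (1 - norm z) / 2)})"

definition bounded_operator ::
  "real \<Rightarrow> (complex \<Rightarrow> real) \<Rightarrow> real \<Rightarrow> (complex \<Rightarrow> real) \<Rightarrow>
   ((complex \<Rightarrow> complex) \<Rightarrow> complex \<Rightarrow> complex) \<Rightarrow> bool" where
  "bounded_operator p \<omega> q \<nu> T \<longleftrightarrow>
     (\<forall>f\<in>bergman_space p \<omega>. T f \<in> bergman_space q \<nu>) \<and>
     (\<exists>C. \<forall>f\<in>bergman_space p \<omega>. bergman_norm q \<nu> (T f) \<le> C * bergman_norm p \<omega> f)"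

text \<open>Compactness: bounded sequences have images with convergent subsequences. For exponents below
  one the norms are only quasinorms, but the notion is the same.\<close>

definition compact_operator ::
  "real \<Rightarrow> (complex \<Rightarrow> real) \<Rightarrow> real \<Rightarrow> (complex \<Rightarrow> real) \<Rightarrow>
   ((complex \<Rightarrow> complex) \<Rightarrow> complex \<Rightarrow> complex) \<Rightarrow> bool" where
  "compact_operator p \<omega> q \<nu> T \<longleftrightarrow>
     (\<forall>f\<in>bergman_space p \<omega>. T f \<in> bergman_space q \<nu>) \<and>
     (\<forall>F :: nat \<Rightarrow> complex \<Rightarrow> complex. \<forall>M.
        (\<forall>k. F k \<in> bergman_space p \<omega> \<and> bergman_norm p \<omega> (F k) \<le> M) \<longrightarrow>
        (\<exists>g\<in>bergman_space q \<nu>. \<exists>r :: nat \<Rightarrow> nat. strict_mono r \<and>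
           (\<lambda>k. bergman_norm q \<nu> (\<lambda>z. T (F (r k)) z - g z)) \<longlonglongrightarrow> 0))"

definition D_op ::
  "nat \<Rightarrow> (complex \<Rightarrow> complex) \<Rightarrow> (complex \<Rightarrow> complex) \<Rightarrow> (complex \<Rightarrow> complex) \<Rightarrow> complex \<Rightarrow> complex"
  where "D_op n \<phi> u f = (\<lambda>z. u z * (deriv ^^ n) f (\<phi> z))"

definition analytic_self_map :: "(complex \<Rightarrow> complex) \<Rightarrow> bool" where
  "analytic_self_map \<phi> \<longleftrightarrow> \<phi> holomorphic_on unit_disc \<and> \<phi> \<in> unit_disc \<rightarrow> unit_disc"

end

theory Submission
  imports Defs
begin

text \<open>
  The operator sees \<open>u\<close> and \<open>\<phi>\<close> only through the measure \<open>\<mu>\<close> on the disc that is the image of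
  \<open>|u|^q \<nu> dA\<close> under \<open>\<phi>\<close>: the norm of the image of \<open>f\<close> in the target space is the norm of the
  \<open>n\<close>-th derivative of \<open>f\<close> in \<open>L^q(\<mu>)\<close>. So the theorem is about a Carleson embedding, and the
  integral in it tests that embedding on the functions \<open>f_a(z) = ((1 - |a|) / (1 - cnj a z))^\<gamma>\<close>.

  The geometry of the weight enters through its tail \<open>W(r)\<close>, the mass of \<open>r < |z| < 1\<close>. Polar
  coordinates turn the two doubling conditions into conditions on \<open>W\<close>
  (\<open>doubling_measure_weighted_area\<close>), and covering or packing arguments with rotations show that the
  mass of a Carleson square \<open>S(a)\<close> is comparable to \<open>(1 - |a|) W(|a|)\<close>
  (\<open>carleson_mass_lower\<close>, \<open>carleson_mass_upper\<close>).

  For necessity one needs \<open>\<integral> |f_a|^p \<omega> dA \<le> C \<omega>(S(a))\<close>. The mass of the set where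
  \<open>|1 - cnj a z|\<close> is about \<open>2^k (1 - |a|)\<close> grows at most geometrically in \<open>k\<close>, with a rate that
  depends on the doubling constant only. Hence the first term dominates as soon as \<open>2^(\<gamma> p)\<close> beats
  this rate (\<open>kernel_integral\<close>), and that is the one requirement on \<open>\<gamma>\<close>. A natural number is
  chosen for \<open>\<gamma>\<close>, so the derivatives of \<open>f_a\<close> involve no branch of a power.

  For sufficiency, values of \<open>f\<close> must be controlled by averages against \<open>\<omega>\<close>, although \<open>\<omega>\<close> may
  vanish on large parts of the disc. The circular means of \<open>|f|^p\<close> increase with the radius
  (\<open>radial_mean_comparison\<close>), and by the second doubling condition each annulus
  \<open>1 - K^(-k) < |z| \<le> 1 - K^(-k-1)\<close> carries a fixed proportion of the tail. So \<open>\<omega>\<close> can be replaced by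
  \<open>W(|z|) / (1 - |z|)\<close> at the cost of a constant (\<open>smooth_weight_norm_le\<close>). That weight is almost
  constant on discs of radius \<open>(1 - |w|) / 4\<close> about \<open>w\<close>. The sub-mean value property and Cauchy's
  estimate then bound \<open>|f^(n)(w)|^p\<close> by an average over such a disc. Raising this to the power
  \<open>q / p \<ge> 1\<close>, bounding all but one factor by the norm of \<open>f\<close>, and exchanging integrals gives the
  embedding (\<open>carleson_embedding\<close>).

  The embedding is local: the part of \<open>\<mu>\<close> near the unit circle is controlled by the testing integrals
  with \<open>a\<close> near the unit circle. If these tend to \<open>0\<close>, then a bounded sequence, which has a locally
  uniformly convergent subsequence by Montel's theorem, has convergent images. Conversely the
  functions \<open>f_a / \<omega>(S(a))^(1/p)\<close> are bounded in the source space and their derivatives tend to \<open>0\<close>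
  pointwise as \<open>|a| \<rightarrow> 1\<close>, so a compact operator sends them to \<open>0\<close> in norm.
\<close>

section \<open>Normalized area measure on the disc\<close>

lemma unit_disc_borel [measurable]: "unit_disc \<in> sets borel"
  by simp

lemma nn_integral_lborel_translate:
  fixes h :: "'a::euclidean_space \<Rightarrow> ennreal"
  assumes [measurable]: "h \<in> borel_measurable borel"
  shows "(\<integral>\<^sup>+x. h (t + x) \<partial>lborel) = (\<integral>\<^sup>+x. h x \<partial>lborel)"
proof -
  have "(\<integral>\<^sup>+x. h x \<partial>lborel) = (\<integral>\<^sup>+x. h x \<partial>distr lborel borel ((+) t))"
    by (simp add: lborel_distr_plus)
  also have "\<dots> = (\<integral>\<^sup>+x. h (t + x) \<partial>lborel)"
    by (subst nn_integral_distr) auto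
  finally show ?thesis by simp
qed

text \<open>
  The usual uniqueness argument for translation invariant measures: integrate
  \<open>1_B(x) h(x + c y)\<close> over both variables, where \<open>B\<close> is the unit disc. Translating in \<open>y\<close> gives the
  measure of \<open>B\<close> times the integral of \<open>h(c y)\<close>; translating in \<open>x\<close> gives the measure of \<open>B\<close>
  times the integral of \<open>h\<close>, because \<open>B\<close> is itself invariant under rotation.
\<close>

lemma nn_integral_lborel_rotate:
  fixes c :: complex and h :: "complex \<Rightarrow> ennreal"
  assumes c: "norm c = 1" and [measurable]: "h \<in> borel_measurable borel"
  shows "(\<integral>\<^sup>+z. h (c * z) \<partial>lborel) = (\<integral>\<^sup>+z. h z \<partial>lborel)"
proof -
  define A :: "complex \<Rightarrow> ennreal" where "A = indicator (ball 0 1)"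
  have [measurable]: "A \<in> borel_measurable borel"
    unfolding A_def by (intro borel_measurable_indicator) simp
  define V where "V = (\<integral>\<^sup>+x. A x \<partial>lborel)"
  have V: "V = emeasure lborel (ball (0::complex) 1)" unfolding V_def A_def by simp
  have V0: "V \<noteq> 0" "V \<noteq> \<infinity>"
    using emeasure_lborel_ball_finite[of "0::complex" 1] unfolding V
    by (auto simp: emeasure_ball eval_unit_ball_vol)
  have cc: "c * cnj c = 1" using c by (simp add: complex_norm_square[symmetric])
  have A_inner: "(\<integral>\<^sup>+y. A (x - c * y) \<partial>lborel) = V" for x
  proof -
    have "A (x - c * y) = A (- (cnj c * x) + y)" for y
    proof -
      have "x - c * y = - c * (- (cnj c * x) + y)"
        using cc by (simp add: algebra_simps)
      then have "norm (x - c * y) = norm (- (cnj c * x) + y)"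
        by (metis c mult_1 norm_minus_cancel norm_mult)
      then show ?thesis by (simp add: A_def indicator_def)
    qed
    then show ?thesis unfolding V_def
      using nn_integral_lborel_translate[of A "- (cnj c * x)"] by simp
  qed
  have "V * (\<integral>\<^sup>+y. h (c * y) \<partial>lborel) = (\<integral>\<^sup>+x. A x * (\<integral>\<^sup>+y. h (c * y) \<partial>lborel) \<partial>lborel)"
    unfolding V_def by (rule nn_integral_multc[symmetric]) simp
  also have "\<dots> = (\<integral>\<^sup>+x. A x * (\<integral>\<^sup>+y. h (x + c * y) \<partial>lborel) \<partial>lborel)"
  proof -
    have "(\<integral>\<^sup>+y. h (c * y) \<partial>lborel) = (\<integral>\<^sup>+y. h (x + c * y) \<partial>lborel)" for x
    proof -
      have "c * (cnj c * x + y) = x + c * y" for y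
        using cc by (simp add: distrib_left flip: mult.assoc)
      then show ?thesis
        using nn_integral_lborel_translate[of "\<lambda>y. h (c * y)" "cnj c * x"] by simp
    qed
    then show ?thesis by simp
  qed
  also have "\<dots> = (\<integral>\<^sup>+x. (\<integral>\<^sup>+y. A x * h (x + c * y) \<partial>lborel) \<partial>lborel)"
    by (simp add: nn_integral_cmult)
  also have "\<dots> = (\<integral>\<^sup>+y. (\<integral>\<^sup>+x. A x * h (x + c * y) \<partial>lborel) \<partial>lborel)"
    by (rule lborel_pair.Fubini') measurable
  also have "\<dots> = (\<integral>\<^sup>+y. (\<integral>\<^sup>+x. A (x - c * y) * h x \<partial>lborel) \<partial>lborel)"
  proof -
    have "(\<integral>\<^sup>+x. A x * h (x + c * y) \<partial>lborel) = (\<integral>\<^sup>+x. A (x - c * y) * h x \<partial>lborel)" for y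
      using nn_integral_lborel_translate[of "\<lambda>x. A x * h (x + c * y)" "- (c * y)"] by simp
    then show ?thesis by simp
  qed
  also have "\<dots> = (\<integral>\<^sup>+x. (\<integral>\<^sup>+y. A (x - c * y) * h x \<partial>lborel) \<partial>lborel)"
    by (rule lborel_pair.Fubini') measurable
  also have "\<dots> = (\<integral>\<^sup>+x. V * h x \<partial>lborel)"
    by (simp add: nn_integral_multc A_inner)
  also have "\<dots> = V * (\<integral>\<^sup>+x. h x \<partial>lborel)" by (simp add: nn_integral_cmult)
  finally show ?thesis using V0
    by (metis ennreal_mult_cancel_left infinity_ennreal_def)
qed

lemma space_dA [simp]: "space dA = unit_disc"
  unfolding dA_def by (simp add: space_scale_measure space_restrict_space)

lemma sets_dA [measurable_cong]: "sets dA = sets (lebesgue_on unit_disc)"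
  unfolding dA_def by simp

lemma measurable_dA_of_borel:
  assumes "f \<in> borel \<rightarrow>\<^sub>M N" shows "f \<in> dA \<rightarrow>\<^sub>M N"
proof -
  have "f \<in> lebesgue \<rightarrow>\<^sub>M N" using assms by (intro measurable_completion) simp
  then have "f \<in> lebesgue_on unit_disc \<rightarrow>\<^sub>M N" by (rule measurable_restrict_space1)
  then show ?thesis by (simp cong: measurable_cong_sets add: sets_dA measurable_cong_sets[OF sets_dA refl])
qed

lemma nn_integral_dA:
  assumes "h \<in> borel_measurable borel"
  shows "(\<integral>\<^sup>+z. h z \<partial>dA) = ennreal (1 / pi) * (\<integral>\<^sup>+z. h z * indicator unit_disc z \<partial>lborel)"
proof -
  have "h \<in> borel_measurable (lebesgue_on unit_disc)"
    using measurable_dA_of_borel[OF assms] by (simp add: measurable_cong_sets[OF sets_dA refl])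
  then show ?thesis unfolding dA_def
    by (simp add: nn_integral_scale_measure nn_integral_restrict_space nn_integral_completion)
qed

lemma nn_integral_dA_rotate:
  assumes c: "norm c = 1" and [measurable]: "h \<in> borel_measurable borel"
  shows "(\<integral>\<^sup>+z. h (c * z) \<partial>dA) = (\<integral>\<^sup>+z. h z \<partial>dA)"
proof -
  have "(\<integral>\<^sup>+z. h (c * z) * indicator unit_disc z \<partial>lborel)
      = (\<integral>\<^sup>+z. h (c * z) * indicator unit_disc (c * z) \<partial>lborel)"
    using c by (intro nn_integral_cong) (auto simp: indicator_def norm_mult)
  also have "\<dots> = (\<integral>\<^sup>+z. h z * indicator unit_disc z \<partial>lborel)"
    by (rule nn_integral_lborel_rotate[OF c]) measurable
  finally show ?thesis by (simp add: nn_integral_dA)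
qed

lemma emeasure_dA:
  assumes [measurable]: "A \<in> sets borel"
  shows "emeasure dA (A \<inter> unit_disc) = ennreal (1 / pi) * emeasure lborel (A \<inter> unit_disc)"
proof -
  have "A \<inter> unit_disc \<in> sets dA"
    unfolding sets_dA using assms by (simp add: sets_restrict_space_iff)
  then have "emeasure dA (A \<inter> unit_disc) = (\<integral>\<^sup>+z. indicator (A \<inter> unit_disc) z \<partial>dA)" by simp
  also have "\<dots> = ennreal (1 / pi) * (\<integral>\<^sup>+z. indicator (A \<inter> unit_disc) z * indicator unit_disc z \<partial>lborel)"
    by (rule nn_integral_dA) measurable
  also have "(\<integral>\<^sup>+z. indicator (A \<inter> unit_disc) z * indicator unit_disc z \<partial>lborel) = emeasure lborel (A \<inter> unit_disc)"
  proof -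
    have "(\<lambda>z. indicator (A \<inter> unit_disc) z * indicator unit_disc z :: ennreal) = indicator (A \<inter> unit_disc)"
      by (auto simp: indicator_def)
    then show ?thesis by (simp add: nn_integral_indicator)
  qed
  finally show ?thesis .
qed

text \<open>
  Polar coordinates in the only form needed: both sides give \<open>1 - x^2\<close> to
  \<open>{x<..}\<close> when \<open>0 \<le> x < 1\<close>.
\<close>

lemma distr_norm_dA:
  "distr dA borel norm = density lborel (\<lambda>s. ennreal (2 * s * indicator {0<..<1} s))"
proof (rule measure_eqI_lessThan)
  have nm: "norm \<in> dA \<rightarrow>\<^sub>M borel" by (rule measurable_dA_of_borel) measurable
  have disc: "emeasure lborel (unit_disc) = ennreal pi"
    using emeasure_ball[of 1 "0::complex"] by (simp add: eval_unit_ball_vol)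
  have ann: "emeasure (distr dA borel norm) {x<..} = ennreal (if x < 0 then 1 else if x < 1 then 1 - x^2 else 0)" for x :: real
  proof -
    have eq: "emeasure (distr dA borel norm) {x<..} = emeasure dA ({z. x < norm z} \<inter> unit_disc)"
      by (subst emeasure_distr[OF nm]) (auto intro!: arg_cong[where f="emeasure dA"])
    also have "\<dots> = ennreal (1 / pi) * emeasure lborel ({z::complex. x < norm z} \<inter> unit_disc)"
      by (rule emeasure_dA) measurable
    also have "emeasure lborel ({z::complex. x < norm z} \<inter> unit_disc)
        = ennreal (if x < 0 then pi else if x < 1 then pi - pi * x^2 else 0)"
    proof (cases "x < 0")
      case True
      then have "{z::complex. x < norm z} \<inter> unit_disc = unit_disc"
        by (auto intro: less_le_trans)
      with True disc show ?thesis by simp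
    next
      case False
      show ?thesis
      proof (cases "x < 1")
        case True
        have "{z::complex. x < norm z} \<inter> unit_disc = unit_disc - cball 0 x"
          by auto
        also have "emeasure lborel \<dots> = emeasure lborel unit_disc - emeasure lborel (cball (0::complex) x)"
          using True using emeasure_lborel_cball_finite[of "0::complex" x] by (intro emeasure_Diff) auto
        also have "\<dots> = ennreal (pi - pi * x^2)"
          using False by (simp add: disc emeasure_cball eval_unit_ball_vol ennreal_minus)
        finally show ?thesis using True False by simp
      next
        case F2: False
        then have "{z::complex. x < norm z} \<inter> unit_disc = {}" by auto
        with False F2 show ?thesis by simp
      qed
    qed
    finally show ?thesis
      by (auto simp: ennreal_mult[symmetric] field_simps power_le_one_iff abs_square_le_1)
  qed
  show "emeasure (distr dA borel norm) {x<..} < \<infinity>" for x :: real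
    by (simp add: ann)
  show "emeasure (distr dA borel norm) {x<..} = emeasure (density lborel (\<lambda>s. ennreal (2 * s * indicator {0<..<1} s))) {x<..}" for x :: real
  proof -
    define y where "y = max 0 (min x 1)"
    have "emeasure (density lborel (\<lambda>s. ennreal (2 * s * indicator {0<..<1} s))) {x<..}
       = (\<integral>\<^sup>+s. ennreal (2 * s * indicator {0<..<1} s) * indicator {x<..} s \<partial>lborel)"
      by (subst emeasure_density) auto
    also have "\<dots> = (\<integral>\<^sup>+s. ennreal (2 * s) * indicator {y..1} s \<partial>lborel)"
    proof (rule nn_integral_cong_AE)
      have "AE s in lborel. s \<noteq> y" "AE s in lborel. s \<noteq> (1::real)"
        by (rule AE_lborel_singleton)+
      then show "AE s in lborel. ennreal (2 * s * indicator {0<..<1} s) * indicator {x<..} s = ennreal (2 * s) * indicator {y..1} s"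
        by eventually_elim (auto simp: indicator_def y_def)
    qed
    also have "\<dots> = ennreal (1^2 - y^2)"
      by (rule nn_integral_FTC_Icc) (auto intro!: derivative_eq_intros simp: y_def)
    also have "\<dots> = emeasure (distr dA borel norm) {x<..}"
      unfolding ann by (auto simp: y_def)
    finally show ?thesis by simp
  qed
qed auto

section \<open>Radial weights in polar coordinates\<close>

text \<open>
  Area measure determines one-dimensional measurability of the radii. Approximate the
  planar set from inside by closed sets and from outside by open ones. The radii of the former, and
  the radii whose whole circle lies in the latter, squeeze \<open>E\<close> between two Borel sets; the
  circles over their difference form a null set, so by \<open>distr_norm_dA\<close> the difference is null.
\<close>

lemma radial_set_lebesgue:
  fixes E :: "real set"
  assumes E: "E \<subseteq> {0<..<1}" and P: "{z\<in>unit_disc. norm z \<in> E} \<in> sets lebesgue"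
  shows "E \<in> sets lebesgue"
proof -
  define P where "P = {z\<in>unit_disc. norm z \<in> E}"
  have "\<exists>T. closed T \<and> T \<subseteq> P \<and> P - T \<in> lmeasurable \<and> emeasure lebesgue (P - T) < ennreal (inverse (Suc n))" for n
    by (rule sets_lebesgue_inner_closed[OF assms(2)[folded P_def], of "inverse (Suc n)"]) auto
  then obtain T where T: "closed (T n)" "T n \<subseteq> P" "P - T n \<in> lmeasurable"
      "emeasure lebesgue (P - T n) < ennreal (inverse (Suc n))" for n by metis
  have "\<exists>U. open U \<and> P \<subseteq> U \<and> U - P \<in> lmeasurable \<and> emeasure lebesgue (U - P) < ennreal (inverse (Suc n))" for n
    by (rule sets_lebesgue_outer_open[OF assms(2)[folded P_def], of "inverse (Suc n)"]) auto
  then obtain U where U: "open (U n)" "P \<subseteq> U n" "U n - P \<in> lmeasurable"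
      "emeasure lebesgue (U n - P) < ennreal (inverse (Suc n))" for n by metis
  (* Radii met by T n, and radii whose whole circle lies in U n. *)
  define L where "L n = norm ` T n" for n
  define V where "V n = {0<..<1} - norm ` (cball 0 1 - U n)" for n
  have compT: "compact (T n)" for n
    using T(1,2)[of n] by (auto simp: compact_eq_bounded_closed P_def intro!: bounded_subset[OF bounded_ball[of 0 1]])
  have L: "compact (L n)" for n unfolding L_def
    by (intro compact_continuous_image compT continuous_intros)
  have L': "L n \<in> sets borel" for n using L by (simp add: borel_compact)
  have LE: "L n \<subseteq> E" for n using T(2)[of n] by (auto simp: L_def P_def)
  have "compact (norm ` (cball 0 1 - U n))" for n
    using U(1)[of n] by (intro compact_continuous_image compact_diff continuous_intros) auto
  then have V: "V n \<in> sets borel" for n unfolding V_def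
    by (intro sets.Diff) (auto simp: borel_compact)
  have EV: "E \<subseteq> V n" for n
  proof
    fix s assume s: "s \<in> E"
    have "z \<in> U n" if "norm z = s" for z
      using that s E U(2)[of n] by (force simp: P_def)
    then show "s \<in> V n" using s E by (auto simp: V_def)
  qed
  define D where "D = (\<Inter>n. V n) - (\<Union>n. L n)"
  have D [measurable]: "D \<in> sets borel" unfolding D_def using V L' by auto
  define N where "N = {z. norm z \<in> D} \<inter> unit_disc"
  have Nb: "N \<in> sets borel" unfolding N_def by measurable
  have sub: "N \<subseteq> (U n - P) \<union> (P - T n)" for n
  proof
    fix z assume z: "z \<in> N"
    then have "norm z \<in> V n" "norm z \<notin> L n" "z \<in> unit_disc" by (auto simp: N_def D_def)
    then show "z \<in> (U n - P) \<union> (P - T n)"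
      by (auto simp: V_def L_def)
  qed
  have "emeasure lebesgue N \<le> ennreal (2 * inverse (Suc n))" for n
  proof -
    have "emeasure lebesgue N \<le> emeasure lebesgue ((U n - P) \<union> (P - T n))"
      using sub T(3) U(3) by (intro emeasure_mono) (auto simp: fmeasurableD)
    also have "\<dots> \<le> emeasure lebesgue (U n - P) + emeasure lebesgue (P - T n)"
      using T(3) U(3) by (intro emeasure_subadditive) (auto simp: fmeasurableD)
    also have "\<dots> \<le> ennreal (inverse (Suc n)) + ennreal (inverse (Suc n))"
      using T(4) U(4) by (intro add_mono) (auto simp: less_imp_le)
    also have "\<dots> = ennreal (2 * inverse (Suc n))" by (subst ennreal_plus[symmetric]) auto
    finally show ?thesis .
  qed
  moreover have "(\<lambda>n. ennreal (2 * inverse (Suc n))) \<longlonglongrightarrow> ennreal (2 * 0)"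
    by (intro tendsto_ennrealI tendsto_mult tendsto_const LIMSEQ_inverse_real_of_nat)
  ultimately have "emeasure lebesgue N \<le> ennreal (2 * 0)"
    by (intro LIMSEQ_le_const) auto
  then have "emeasure lborel N = 0"
    using Nb by simp
  then have "emeasure dA N = 0"
    using emeasure_dA[of "{z. norm z \<in> D}"] unfolding N_def by simp
  then have "emeasure (distr dA borel norm) D = 0"
    unfolding N_def using measurable_dA_of_borel[of norm borel]
    by (subst emeasure_distr) (auto simp: vimage_def)
  then have "AE s in density lborel (\<lambda>s. ennreal (2 * s * indicator {0<..<1} s)). s \<notin> D"
    unfolding distr_norm_dA by (intro AE_not_in) (auto simp: null_sets_def)
  then have "AE s in lborel. 0 < ennreal (2 * s * indicator {0<..<1} s) \<longrightarrow> s \<notin> D"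
    using AE_density[of "\<lambda>s. ennreal (2 * s * indicator {0<..<1} s)" lborel "\<lambda>s. s \<notin> D"] by simp
  then have "AE s in lborel. s \<notin> D"
  proof eventually_elim
    case (elim s)
    have "s \<in> {0<..<1}" if "s \<in> D" using that by (auto simp: D_def V_def)
    then show ?case using elim by (cases "s \<in> D") simp_all
  qed
  then have "D \<in> null_sets lborel" using AE_iff_null_sets[of D lborel] by simp
  then have "E - (\<Union>n. L n) \<in> sets lebesgue"
  proof -
    have "E - (\<Union>n. L n) \<subseteq> D" unfolding D_def using EV by blast
    then show ?thesis
      using completion.complete2 null_sets_completionI[OF \<open>D \<in> null_sets lborel\<close>] by blast
  qed
  moreover have "(\<Union>n. L n) \<in> sets lebesgue" using L' by auto
  ultimately have "(E - (\<Union>n. L n)) \<union> (\<Union>n. L n) \<in> sets lebesgue" by (rule sets.Un)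
  moreover have "(E - (\<Union>n. L n)) \<union> (\<Union>n. L n) = E" using LE by auto
  ultimately show ?thesis by simp
qed

lemma radial_profile_measurable:
  fixes \<omega> :: "complex \<Rightarrow> real"
  assumes m: "\<omega> \<in> borel_measurable dA"
    and rad: "\<And>z. z \<in> unit_disc \<Longrightarrow> \<omega> z = \<omega> (of_real (norm z))"
  shows "(\<lambda>s. \<omega> (of_real s)) \<in> borel_measurable (lebesgue_on {0<..<1})"
proof (rule measurableI)
  fix S :: "real set" assume S: "S \<in> sets borel"
  define E where "E = {s\<in>{0<..<1}. \<omega> (of_real s) \<in> S}"
  have "{z\<in>unit_disc. norm z \<in> E} = (\<omega> -` S \<inter> space dA) - {0}"
  proof (intro set_eqI)
    fix z show "z \<in> {z\<in>unit_disc. norm z \<in> E} \<longleftrightarrow> z \<in> (\<omega> -` S \<inter> space dA) - {0}"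
      using rad[of z] by (auto simp: E_def)
  qed
  moreover have "(\<omega> -` S \<inter> space dA) \<in> sets dA" using m S by (rule measurable_sets)
  then have "(\<omega> -` S \<inter> space dA) \<in> sets lebesgue"
    unfolding sets_dA by (simp add: sets_restrict_space_iff)
  then have "(\<omega> -` S \<inter> space dA) - {0} \<in> sets lebesgue" by (rule sets.Diff) simp
  ultimately have "{z\<in>unit_disc. norm z \<in> E} \<in> sets lebesgue" by (simp only:)
  then have "E \<in> sets lebesgue" by (intro radial_set_lebesgue) (auto simp: E_def)
  moreover have "(\<lambda>s. \<omega> (of_real s)) -` S \<inter> space (lebesgue_on {0<..<1}) = E"
    by (auto simp: E_def space_restrict_space)
  ultimately show "(\<lambda>s. \<omega> (of_real s)) -` S \<inter> space (lebesgue_on {0<..<1}) \<in> sets (lebesgue_on {0<..<1})"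
    by (auto simp: sets_restrict_space_iff E_def)
qed simp

text \<open>
  A weight is only Lebesgue measurable, while images under \<open>norm\<close> and rotations are best handled
  for Borel functions. A radial weight agrees almost everywhere with a Borel function of \<open>norm z\<close>.
\<close>

lemma radial_borel_version:
  fixes \<omega> :: "complex \<Rightarrow> real"
  assumes m: "\<omega> \<in> borel_measurable dA"
    and rad: "\<And>z. z \<in> unit_disc \<Longrightarrow> \<omega> z = \<omega> (of_real (norm z))"
  obtains g where "g \<in> borel_measurable borel"
    "AE s in lborel. s \<in> {0<..<1} \<longrightarrow> \<omega> (of_real s) = g s"
    "AE z in dA. \<omega> z = g (norm z)"
proof -
  have "(\<lambda>s. \<omega> (of_real s) * indicator {0<..<1} s) \<in> borel_measurable lebesgue"
  proof -
    have "(\<lambda>s. \<omega> (of_real s)) \<in> borel_measurable (lebesgue_on {0<..<1})"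
      by (rule radial_profile_measurable) fact+
    then show ?thesis by (simp add: borel_measurable_restrict_space_iff mult.commute)
  qed
  then obtain g where g0: "g \<in> borel_measurable lborel"
    and "AE s in lborel. \<omega> (of_real s) * indicator {0<..<1} s = g s"
    using completion_ex_borel_measurable_real by blast
  then have g: "AE s in lborel. s \<in> {0<..<1} \<longrightarrow> \<omega> (of_real s) = g s"
    by (auto elim!: eventually_mono)
  have nm: "norm \<in> dA \<rightarrow>\<^sub>M borel" by (rule measurable_dA_of_borel) measurable
  have "AE s in density lborel (\<lambda>s. ennreal (2 * s * indicator {0<..<1} s)). s \<in> {0<..<1} \<and> \<omega> (of_real s) = g s"
    using g by (subst AE_density) (auto elim!: eventually_mono simp: indicator_def split: if_splits)
  then have "AE s in distr dA borel norm. s \<in> {0<..<1} \<and> \<omega> (of_real s) = g s"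
    unfolding distr_norm_dA .
  then have "AE z in dA. norm z \<in> {0<..<1} \<and> \<omega> (of_real (norm z)) = g (norm z)"
    by (rule AE_distrD[OF nm])
  then have "AE z in dA. \<omega> z = g (norm z)"
  proof eventually_elim
    case (elim z) then show ?case using rad[of z] by auto
  qed
  with g g0 that show ?thesis by simp
qed

lemma nn_integral_radial_annulus:
  fixes \<omega> :: "complex \<Rightarrow> real"
  assumes m: "\<omega> \<in> borel_measurable dA"
    and rad: "\<And>z. z \<in> unit_disc \<Longrightarrow> \<omega> z = \<omega> (of_real (norm z))" and r: "0 \<le> r"
  shows "(\<integral>\<^sup>+z. ennreal (\<omega> z) * indicator {z. r < norm z} z \<partial>dA)
       = (\<integral>\<^sup>+s\<in>{r<..<1}. ennreal (2 * s) * ennreal (\<omega> (of_real s)) \<partial>lebesgue)"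
proof -
  obtain g where [measurable]: "g \<in> borel_measurable borel"
    and g: "AE s in lborel. s \<in> {0<..<1} \<longrightarrow> \<omega> (of_real s) = g s"
    and gA: "AE z in dA. \<omega> z = g (norm z)"
    by (rule radial_borel_version[OF assms(1,2)])
  have nm [measurable]: "norm \<in> dA \<rightarrow>\<^sub>M borel" by (rule measurable_dA_of_borel) measurable
  have "(\<integral>\<^sup>+z. ennreal (\<omega> z) * indicator {z. r < norm z} z \<partial>dA)
      = (\<integral>\<^sup>+z. ennreal (g (norm z)) * indicator {r<..} (norm z) \<partial>dA)"
    using gA by (intro nn_integral_cong_AE) (auto elim!: eventually_mono simp: indicator_def)
  also have "\<dots> = (\<integral>\<^sup>+s. ennreal (g s) * indicator {r<..} s \<partial>distr dA borel norm)"
    by (subst nn_integral_distr) auto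
  also have "\<dots> = (\<integral>\<^sup>+s. ennreal (2 * s * indicator {0<..<1} s) * (ennreal (g s) * indicator {r<..} s) \<partial>lborel)"
    unfolding distr_norm_dA by (subst nn_integral_density) auto
  also have "\<dots> = (\<integral>\<^sup>+s. ennreal (2 * s) * ennreal (\<omega> (of_real s)) * indicator {r<..<1} s \<partial>lborel)"
    using g r by (intro nn_integral_cong_AE) (auto elim!: eventually_mono simp: indicator_def)
  finally show ?thesis by (simp add: nn_integral_completion)
qed

definition weighted_area :: "(complex \<Rightarrow> real) \<Rightarrow> complex measure" where
  "weighted_area \<omega> = density dA (\<lambda>z. ennreal (\<omega> z))"

definition tail :: "complex measure \<Rightarrow> real \<Rightarrow> real" where
  "tail M r = measure M {z\<in>unit_disc. r < norm z}"

text \<open>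
  Rotation invariance is all that is needed for comparing means. It is required for Borel functions
  only, although the measure is complete: images of Lebesgue null sets never have to be discussed.
  Area measure, the weighted measures and a point mass at the origin are treated alike.
\<close>

locale radial_measure =
  fixes M :: "complex measure"
  assumes space_M [simp]: "space M = unit_disc"
    and sets_M: "sets M = sets (lebesgue_on unit_disc)"
    and finite_M: "emeasure M unit_disc \<noteq> \<infinity>"
    and rotate: "\<And>c h. norm c = 1 \<Longrightarrow> h \<in> borel_measurable borel \<Longrightarrow>
      (\<integral>\<^sup>+z. h (c * z) \<partial>M) = (\<integral>\<^sup>+z. h z \<partial>M)"

locale doubling_measure = radial_measure +
  assumes tail_0: "0 < tail M 0"
    and tail_doubling: "\<exists>C\<ge>1. \<forall>r\<in>{0..<1}. tail M r \<le> C * tail M ((1 + r) / 2)"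
    and tail_reverse: "\<exists>K>1. \<forall>r\<in>{0..<1}. 2 * tail M (1 - (1 - r) / K) \<le> tail M r"

lemma radial_measure_dA: "radial_measure dA"
proof
  show "emeasure dA unit_disc \<noteq> \<infinity>"
    using emeasure_dA[of UNIV] emeasure_lborel_ball_finite[of "0::complex" 1]
    by (simp add: ennreal_mult_eq_top_iff less_top)
qed (simp_all add: sets_dA nn_integral_dA_rotate)

lemma radial_measure_weighted_area:
  assumes "radial_weight \<omega>"
  shows "radial_measure (weighted_area \<omega>)"
proof
  have int: "integrable dA \<omega>" and nn: "\<And>z. z \<in> unit_disc \<Longrightarrow> 0 \<le> \<omega> z"
    and rad: "\<And>z. z \<in> unit_disc \<Longrightarrow> \<omega> z = \<omega> (of_real (norm z))"
    using assms unfolding radial_weight_def weight_def by blast+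
  then have m: "\<omega> \<in> borel_measurable dA" by (intro borel_measurable_integrable)
  obtain g where [measurable]: "g \<in> borel_measurable borel"
    and gA: "AE z in dA. \<omega> z = g (norm z)"
    by (rule radial_borel_version[OF m rad])
  show "space (weighted_area \<omega>) = unit_disc" "sets (weighted_area \<omega>) = sets (lebesgue_on unit_disc)"
    by (simp_all add: weighted_area_def sets_dA)
  have "emeasure (weighted_area \<omega>) unit_disc = (\<integral>\<^sup>+z. ennreal (\<omega> z) * indicator unit_disc z \<partial>dA)"
    unfolding weighted_area_def using m by (intro emeasure_density) (auto simp: sets_dA)
  also have "\<dots> = (\<integral>\<^sup>+z. ennreal (norm (\<omega> z)) \<partial>dA)"
    using nn by (intro nn_integral_cong) (auto simp: indicator_def)
  also have "\<dots> < \<infinity>" using int by (simp add: integrable_iff_bounded)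
  finally show "emeasure (weighted_area \<omega>) unit_disc \<noteq> \<infinity>" by simp
  show "(\<integral>\<^sup>+z. h (c * z) \<partial>weighted_area \<omega>) = (\<integral>\<^sup>+z. h z \<partial>weighted_area \<omega>)"
    if c: "norm c = 1" and h [measurable]: "h \<in> borel_measurable borel" for c h
  proof -
    have 1: "(\<integral>\<^sup>+z. k z \<partial>weighted_area \<omega>) = (\<integral>\<^sup>+z. ennreal (g (norm z)) * k z \<partial>dA)"
      if k: "k \<in> borel_measurable borel" for k
    proof -
      have "(\<integral>\<^sup>+z. k z \<partial>weighted_area \<omega>) = (\<integral>\<^sup>+z. ennreal (\<omega> z) * k z \<partial>dA)"
        unfolding weighted_area_def using m measurable_dA_of_borel[OF k] by (intro nn_integral_density) auto
      also have "\<dots> = (\<integral>\<^sup>+z. ennreal (g (norm z)) * k z \<partial>dA)"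
        using gA by (intro nn_integral_cong_AE) (auto elim!: eventually_mono)
      finally show ?thesis .
    qed
    have "(\<integral>\<^sup>+z. h (c * z) \<partial>weighted_area \<omega>) = (\<integral>\<^sup>+z. ennreal (g (norm (c * z))) * h (c * z) \<partial>dA)"
      using c by (subst 1) (auto simp: norm_mult)
    also have "\<dots> = (\<integral>\<^sup>+z. ennreal (g (norm z)) * h z \<partial>dA)"
      by (rule nn_integral_dA_rotate[OF c]) measurable
    also have "\<dots> = (\<integral>\<^sup>+z. h z \<partial>weighted_area \<omega>)" by (subst 1) auto
    finally show ?thesis .
  qed
qed

section \<open>Tails of doubling weights\<close>

text \<open>
  The tail integral of the definition and the mass of the corresponding annulus differ by the
  factor \<open>2 s\<close>, which lies between \<open>1\<close> and \<open>2\<close> for \<open>s \<ge> 1/2\<close>; radii below \<open>1/2\<close> are reached by one use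
  of the first doubling condition, which also shows that the tail integral is finite at the origin.
  Passing between the two costs constants that could destroy \<open>C > 1\<close> in the second condition, so that
  condition is iterated until its constant exceeds \<open>4 C\<close>.
\<close>

lemma doubling_measure_weighted_area:
  assumes "\<omega> \<in> doubling_weights"
  shows "doubling_measure (weighted_area \<omega>)"
proof -
  have rw: "radial_weight \<omega>" using assms unfolding doubling_weights_def by blast
  interpret radial_measure "weighted_area \<omega>" by (rule radial_measure_weighted_area[OF rw])
  have int: "integrable dA \<omega>" and nn: "\<And>z. z \<in> unit_disc \<Longrightarrow> 0 \<le> \<omega> z"
    and rad: "\<And>z. z \<in> unit_disc \<Longrightarrow> \<omega> z = \<omega> (of_real (norm z))"
    and nontriv: "\<not> (AE z in dA. \<omega> z = 0)"
    using rw unfolding radial_weight_def weight_def by blast+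
  then have m: "\<omega> \<in> borel_measurable dA" by (intro borel_measurable_integrable)
  define H where "H r = weight_tail \<omega> (of_real r)" for r :: real
  define T where "T = tail (weighted_area \<omega>)"
  obtain C where C: "C \<ge> 1" "\<And>r. 0 \<le> r \<Longrightarrow> r < 1 \<Longrightarrow> H r \<le> ennreal C * H ((1 + r) / 2)"
    using assms unfolding doubling_weights_def H_def by auto
  obtain K c where K: "K > 1" "c > 1" "\<And>r. 0 \<le> r \<Longrightarrow> r < 1 \<Longrightarrow> H r \<ge> ennreal c * H (1 - (1 - r) / K)"
    using assms unfolding doubling_weights_def H_def by auto
  have Hint: "H r = (\<integral>\<^sup>+s\<in>{r<..<1}. ennreal (\<omega> (of_real s)) \<partial>lebesgue)" if "0 \<le> r" for r
    using that by (simp add: H_def weight_tail_def)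
  have sets_ann: "{z \<in> unit_disc. r < norm z} \<in> sets dA" for r
  proof -
    have "{z \<in> unit_disc. r < norm z} = {z. r < norm z} \<inter> unit_disc" by auto
    also have "\<dots> \<in> sets borel" by measurable
    finally show ?thesis unfolding sets_dA by (auto simp: sets_restrict_space_iff)
  qed
  have fin: "finite_measure (weighted_area \<omega>)" using finite_M by (intro finite_measureI) simp
  have Tint: "ennreal (T r) = (\<integral>\<^sup>+s\<in>{r<..<1}. ennreal (2 * s) * ennreal (\<omega> (of_real s)) \<partial>lebesgue)"
    if "0 \<le> r" for r
  proof -
    have "ennreal (T r) = emeasure (weighted_area \<omega>) {z \<in> unit_disc. r < norm z}"
      unfolding T_def tail_def by (rule finite_measure.emeasure_eq_measure[OF fin, symmetric])
    also have "\<dots> = (\<integral>\<^sup>+z. ennreal (\<omega> z) * indicator {z \<in> unit_disc. r < norm z} z \<partial>dA)"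
      unfolding weighted_area_def using m sets_ann by (intro emeasure_density) auto
    also have "\<dots> = (\<integral>\<^sup>+z. ennreal (\<omega> z) * indicator {z. r < norm z} z \<partial>dA)"
      by (intro nn_integral_cong) (auto simp: indicator_def)
    also have "\<dots> = (\<integral>\<^sup>+s\<in>{r<..<1}. ennreal (2 * s) * ennreal (\<omega> (of_real s)) \<partial>lebesgue)"
      by (rule nn_integral_radial_annulus[OF m rad that])
    finally show ?thesis .
  qed
  have T_anti: "T r' \<le> T r" if "r \<le> r'" for r r'
    unfolding T_def tail_def using that
    by (intro finite_measure.finite_measure_mono[OF fin] sets_ann[unfolded sets_dA, folded sets_M]) auto
  have T_le_H: "ennreal (T r) \<le> 2 * H r" if "0 \<le> r" for r
  proof -
    have "ennreal (T r) \<le> (\<integral>\<^sup>+s. 2 * (ennreal (\<omega> (of_real s)) * indicator {r<..<1} s) \<partial>lebesgue)"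
      unfolding Tint[OF that]
    proof (rule nn_integral_mono)
      fix s show "ennreal (2 * s) * ennreal (\<omega> (of_real s)) * indicator {r<..<1} s
          \<le> 2 * (ennreal (\<omega> (of_real s)) * indicator {r<..<1} s)"
        using that ennreal_leI[of "2 * s" 2] by (auto simp: indicator_def intro!: mult_right_mono)
    qed
    also have "\<dots> = 2 * (\<integral>\<^sup>+s. ennreal (\<omega> (of_real s)) * indicator {r<..<1} s \<partial>lebesgue)"
    proof (rule nn_integral_cmult)
      have "(\<lambda>s. ennreal (\<omega> (of_real s))) \<in> borel_measurable (lebesgue_on {0<..<1})"
        using radial_profile_measurable[OF m rad] by measurable
      then have "(\<lambda>s. ennreal (\<omega> (of_real s)) * indicator {0<..<1} s) \<in> borel_measurable lebesgue"
        by (simp add: borel_measurable_restrict_space_iff_ennreal)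
      then have "(\<lambda>s. ennreal (\<omega> (of_real s)) * indicator {0<..<1} s * indicator {r<..<1} s) \<in> borel_measurable lebesgue"
        by (rule borel_measurable_times_ennreal) (simp add: borel_measurable_indicator)
      also have "(\<lambda>s. ennreal (\<omega> (of_real s)) * indicator {0<..<1} s * indicator {r<..<1} s)
         = (\<lambda>s. ennreal (\<omega> (of_real s)) * indicator {r<..<1} s)"
        using that by (auto simp: indicator_def)
      finally show "(\<lambda>s. ennreal (\<omega> (of_real s)) * indicator {r<..<1} s) \<in> borel_measurable lebesgue" .
    qed
    finally show ?thesis by (simp add: Hint[OF that])
  qed
  have H_le_T': "H r \<le> ennreal (T r)" if "1 / 2 \<le> r" for r
  proof -
    have "0 \<le> r" using that by simp
    show ?thesis unfolding Tint[OF \<open>0 \<le> r\<close>] Hint[OF \<open>0 \<le> r\<close>]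
    proof (rule nn_integral_mono)
      fix s show "ennreal (\<omega> (of_real s)) * indicator {r<..<1} s
           \<le> ennreal (2 * s) * ennreal (\<omega> (of_real s)) * indicator {r<..<1} s"
        using that ennreal_leI[of 1 "2 * s"] mult_right_mono[of 1 "ennreal (2 * s)" "ennreal (\<omega> (of_real s))"]
        by (auto simp: indicator_def)
    qed
  qed
  have H_anti: "H r' \<le> H r" if "0 \<le> r" "r \<le> r'" for r r'
    using that by (simp add: Hint, intro nn_integral_mono) (auto simp: indicator_def)
  have H_le_T: "H r \<le> ennreal C * ennreal (T r)" if "0 \<le> r" "r < 1" for r
  proof (cases "1 / 2 \<le> r")
    case True
    then have "H r \<le> ennreal (T r)" by (rule H_le_T')
    also have "\<dots> \<le> ennreal C * ennreal (T r)"
      using C(1) mult_right_mono[of 1 "ennreal C" "ennreal (T r)"] by simp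
    finally show ?thesis .
  next
    case False
    have "H r \<le> H 0" using that by (intro H_anti) auto
    also have "\<dots> \<le> ennreal C * H (1/2)" using C(2)[of 0] by simp
    also have "\<dots> \<le> ennreal C * ennreal (T (1/2))" by (intro mult_left_mono H_le_T') auto
    also have "\<dots> \<le> ennreal C * ennreal (T r)" using False by (intro mult_left_mono ennreal_leI T_anti) auto
    finally show ?thesis .
  qed
  have T_nonneg: "T r \<ge> 0" for r unfolding T_def tail_def by simp
  show ?thesis
  proof
    have "T 0 \<noteq> 0"
    proof
      assume "T 0 = 0"
      then have "emeasure (weighted_area \<omega>) {z \<in> unit_disc. 0 < norm z} = 0"
        unfolding T_def tail_def by (simp add: finite_measure.emeasure_eq_measure[OF fin])
      then have "(\<integral>\<^sup>+z. ennreal (\<omega> z) * indicator {z \<in> unit_disc. 0 < norm z} z \<partial>dA) = 0"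
        unfolding weighted_area_def using m sets_ann[of 0] by (simp only: emeasure_density[OF measurable_compose[OF m measurable_ennreal]])
      then have "AE z in dA. ennreal (\<omega> z) * indicator {z \<in> unit_disc. 0 < norm z} z = 0"
      proof (subst (asm) nn_integral_0_iff_AE)
        show "(\<lambda>z. ennreal (\<omega> z) * indicator {z \<in> unit_disc. 0 < norm z} z) \<in> borel_measurable dA"
          using m borel_measurable_indicator[OF sets_ann[of 0]] by measurable
      qed
      moreover have "AE z in dA. z \<noteq> 0"
      proof (rule AE_I'[of "{0}"])
        have "{0} \<in> sets dA" unfolding sets_dA by (simp add: sets_restrict_space_iff)
        moreover have "emeasure dA {0} = 0" using emeasure_dA[of "{0}"] by simp
        ultimately show "{0} \<in> null_sets dA" by (auto simp: null_sets_def)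
      qed auto
      moreover have "AE z in dA. z \<in> unit_disc" by (metis AE_space space_dA)
      ultimately have "AE z in dA. \<omega> z = 0"
      proof eventually_elim
        case (elim z) then show ?case using nn[of z] by (auto simp: indicator_def ennreal_eq_0_iff)
      qed
      with nontriv show False ..
    qed
    then show "0 < tail (weighted_area \<omega>) 0" using T_nonneg[of 0] by (simp add: T_def less_eq_real_def)
    have "T r \<le> (2 * C\<^sup>2) * T ((1 + r) / 2)" if "0 \<le> r" "r < 1" for r
    proof -
      have "ennreal (T r) \<le> 2 * H r" using that by (intro T_le_H) auto
      also have "\<dots> \<le> 2 * (ennreal C * H ((1 + r) / 2))" using that by (intro mult_left_mono C) auto
      also have "\<dots> \<le> 2 * (ennreal C * (ennreal C * ennreal (T ((1 + r) / 2))))"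
        using that by (intro mult_left_mono H_le_T) auto
      also have "\<dots> = ennreal ((2 * C\<^sup>2) * T ((1 + r) / 2))"
        using C(1) T_nonneg by (simp add: ennreal_mult power2_eq_square mult.assoc)
      finally show ?thesis using C(1) T_nonneg by (subst (asm) ennreal_le_iff) auto
    qed
    moreover have "2 * C\<^sup>2 \<ge> 1" using one_le_power[OF C(1), of 2] by linarith
    ultimately show "\<exists>C\<ge>1. \<forall>r\<in>{0..<1}. tail (weighted_area \<omega>) r \<le> C * tail (weighted_area \<omega>) ((1 + r) / 2)"
      unfolding T_def by (intro exI[of _ "2 * C\<^sup>2"]) auto
    have iter: "ennreal (c ^ n) * H (1 - (1 - r) / K ^ n) \<le> H r" if "0 \<le> r" "r < 1" for r n
    proof (induction n)
      case (Suc n)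
      define r' where "r' = 1 - (1 - r) / K ^ n"
      have Kn: "K ^ n \<ge> 1" using K(1) by (intro one_le_power) simp
      have r': "0 \<le> r'" "r' < 1" using that Kn unfolding r'_def by (auto simp: field_simps)
      have "1 - (1 - r) / K ^ Suc n = 1 - (1 - r') / K"
        using K(1) by (simp add: r'_def field_simps)
      then have "ennreal (c ^ Suc n) * H (1 - (1 - r) / K ^ Suc n)
          = ennreal (c ^ n) * (ennreal c * H (1 - (1 - r') / K))"
        using K(2) by (simp add: ennreal_mult mult_ac)
      also have "\<dots> \<le> ennreal (c ^ n) * H r'" using r' by (intro mult_left_mono K) auto
      also have "\<dots> \<le> H r" using Suc by (simp add: r'_def)
      finally show ?case .
    qed simp
    (* One factor 2 from the tail comparison, one to spare for the conclusion, and C from the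
       comparison in the other direction. *)
    obtain m where m: "c ^ m > 4 * C" using real_arch_pow[OF K(2)] by blast
    have "m \<noteq> 0"
    proof
      assume "m = 0" with m C(1) show False by simp
    qed
    then have Km: "K ^ m > 1" using K(1) by (intro one_less_power) auto
    have "2 * T (1 - (1 - r) / K ^ m) \<le> T r" if "0 \<le> r" "r < 1" for r
    proof -
      have r': "0 \<le> 1 - (1 - r) / K ^ m" using that Km by (simp add: field_simps)
      have "ennreal (4 * C * T (1 - (1 - r) / K ^ m)) \<le> ennreal (c ^ m * T (1 - (1 - r) / K ^ m))"
        using m T_nonneg by (intro ennreal_leI mult_right_mono) auto
      also have "\<dots> = ennreal (c ^ m) * ennreal (T (1 - (1 - r) / K ^ m))"
        using K(2) by (intro ennreal_mult) (auto simp: T_nonneg)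
      also have "\<dots> \<le> ennreal (c ^ m) * (2 * H (1 - (1 - r) / K ^ m))"
        by (intro mult_left_mono T_le_H r') auto
      also have "\<dots> = 2 * (ennreal (c ^ m) * H (1 - (1 - r) / K ^ m))" by (simp add: mult_ac)
      also have "\<dots> \<le> 2 * H r" by (intro mult_left_mono iter that) auto
      also have "\<dots> \<le> 2 * (ennreal C * ennreal (T r))" by (intro mult_left_mono H_le_T that) auto
      also have "\<dots> = ennreal (2 * C * T r)" using C(1) T_nonneg by (simp add: ennreal_mult mult.assoc)
      finally have "4 * C * T (1 - (1 - r) / K ^ m) \<le> 2 * C * T r"
        using C(1) T_nonneg by (subst (asm) ennreal_le_iff) auto
      then have "2 * C * (2 * T (1 - (1 - r) / K ^ m)) \<le> 2 * C * T r" by simp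
      then show ?thesis using C(1) by (subst (asm) mult_le_cancel_left_pos) auto
    qed
    with Km show "\<exists>K>1. \<forall>r\<in>{0..<1}. 2 * tail (weighted_area \<omega>) (1 - (1 - r) / K) \<le> tail (weighted_area \<omega>) r"
      unfolding T_def by (intro exI[of _ "K ^ m"]) auto
  qed
qed

section \<open>Means of powers of holomorphic functions\<close>

lemma local_power_branch:
  fixes f :: "complex \<Rightarrow> complex" and p :: real
  assumes f: "f holomorphic_on S" and S: "open S" "z \<in> S" and nz: "f z \<noteq> 0"
  obtains \<rho> g where "\<rho> > 0" "ball z \<rho> \<subseteq> S" "g holomorphic_on ball z \<rho>"
    "\<And>w. w \<in> ball z \<rho> \<Longrightarrow> norm (g w) = norm (f w) powr p"
proof -
  have "isCont f z"
    using f S by (meson continuous_on_eq_continuous_at holomorphic_on_imp_continuous_on)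
  then obtain e where e: "e > 0" "\<And>w. dist z w < e \<Longrightarrow> f w \<noteq> 0"
    using continuous_at_avoid[of z f 0] nz by auto
  obtain d where d: "d > 0" "ball z d \<subseteq> S" using S by (auto simp: open_contains_ball)
  define \<rho> where "\<rho> = min d e"
  have sub: "ball z \<rho> \<subseteq> S" and nz': "\<And>w. w \<in> ball z \<rho> \<Longrightarrow> f w \<noteq> 0"
    using d e by (auto simp: \<rho>_def)
  have "\<rho> > 0" using d e by (simp add: \<rho>_def)
  have "f holomorphic_on ball z \<rho>" using f sub by (rule holomorphic_on_subset)
  then obtain L where L: "L holomorphic_on ball z \<rho>" "\<And>w. w \<in> ball z \<rho> \<Longrightarrow> f w = exp (L w)"
    using holomorphic_logarithm_exists[of "ball z \<rho>" f z] nz' \<open>\<rho> > 0\<close>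
    by (metis centre_in_ball convex_ball open_ball)
  show ?thesis
  proof
    show "(\<lambda>w. exp (of_real p * L w)) holomorphic_on ball z \<rho>"
      using L(1) by (intro holomorphic_intros)
    show "norm (exp (of_real p * L w)) = norm (f w) powr p" if "w \<in> ball z \<rho>" for w
      using L(2)[OF that] by (simp add: powr_def)
  qed fact+
qed

text \<open>
  At an interior maximum \<open>y\<close> choose unimodular factors that make the branches \<open>g_j\<close> of the
  nonvanishing \<open>F_j^p\<close> nonnegative at \<open>y\<close>. Their sum \<open>G\<close> is holomorphic, has modulus at most the sum
  of the \<open>|F_j|^p\<close>, and equals it at \<open>y\<close>; so \<open>G\<close> is constant near \<open>y\<close>, and the maximum is attained on
  a whole neighbourhood. A maximum point of largest modulus therefore lies on the boundary. This
  replaces subharmonicity of \<open>|f|^p\<close> for \<open>p < 1\<close>.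
\<close>

lemma sum_norm_powr_maximum_principle:
  fixes F :: "'i \<Rightarrow> complex \<Rightarrow> complex" and p R B :: real
  assumes J: "finite J" and p: "0 < p" and R: "0 < R"
    and hol: "\<And>j. j \<in> J \<Longrightarrow> F j holomorphic_on ball 0 R"
    and cont: "\<And>j. j \<in> J \<Longrightarrow> continuous_on (cball 0 R) (F j)"
    and bound: "\<And>w. norm w = R \<Longrightarrow> (\<Sum>j\<in>J. norm (F j w) powr p) \<le> B"
    and z: "norm z \<le> R"
  shows "(\<Sum>j\<in>J. norm (F j z) powr p) \<le> B"
proof -
  define v where "v w = (\<Sum>j\<in>J. norm (F j w) powr p)" for w
  have contv: "continuous_on (cball 0 R) v"
    unfolding v_def using p by (intro continuous_intros cont continuous_on_powr') auto
  obtain x where x: "x \<in> cball 0 R" "\<And>y. y \<in> cball 0 R \<Longrightarrow> v y \<le> v x"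
    using continuous_attains_sup[OF _ _ contv] R by auto
  define S where "S = {y \<in> cball 0 R. v y = v x}"
  have "closed S" unfolding S_def
    by (rule continuous_closed_preimage_constant[OF contv]) simp
  moreover have "bounded S" unfolding S_def by (rule bounded_subset[of "cball 0 R"]) auto
  ultimately have compS: "compact S" by (simp add: compact_eq_bounded_closed)
  have "x \<in> S" using x by (simp add: S_def)
  then obtain y where y: "y \<in> S" "\<And>w. w \<in> S \<Longrightarrow> norm w \<le> norm y"
    using continuous_attains_sup[OF compS, of norm] by (auto intro: continuous_intros)
  have vy: "v y = v x" and yR: "norm y \<le> R" using y by (auto simp: S_def)
  have "norm y = R"
  proof (rule ccontr)
    assume "norm y \<noteq> R"
    then have yR': "norm y < R" using yR by simp
    define J' where "J' = {j \<in> J. F j y \<noteq> 0}"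
    have finJ': "finite J'" and J'J: "J' \<subseteq> J" using J by (auto simp: J'_def)
    have "\<exists>\<rho> g. \<rho> > 0 \<and> ball y \<rho> \<subseteq> ball 0 R \<and> g holomorphic_on ball y \<rho> \<and>
        (\<forall>w\<in>ball y \<rho>. norm (g w) = norm (F j w) powr p)" if "j \<in> J'" for j
    proof -
      have "F j holomorphic_on ball 0 R" "F j y \<noteq> 0" using that hol by (auto simp: J'_def)
      then obtain \<rho> g where "\<rho> > 0" "ball y \<rho> \<subseteq> ball 0 R" "g holomorphic_on ball y \<rho>"
        "\<And>w. w \<in> ball y \<rho> \<Longrightarrow> norm (g w) = norm (F j w) powr p"
        using local_power_branch[of "F j" "ball 0 R" y p] yR' by auto
      then show ?thesis by blast
    qed
    then obtain \<rho> g where g: "\<And>j. j \<in> J' \<Longrightarrow> \<rho> j > 0" "\<And>j. j \<in> J' \<Longrightarrow> g j holomorphic_on ball y (\<rho> j)"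
      "\<And>j w. j \<in> J' \<Longrightarrow> w \<in> ball y (\<rho> j) \<Longrightarrow> norm (g j w) = norm (F j w) powr p"
      by metis
    define r where "r = Min (insert (R - norm y) (\<rho> ` J'))"
    have r: "r > 0" "r \<le> R - norm y" "\<And>j. j \<in> J' \<Longrightarrow> r \<le> \<rho> j"
      unfolding r_def using finJ' g(1) yR' by auto
    have sub: "ball y r \<subseteq> cball 0 R"
    proof
      fix w assume "w \<in> ball y r"
      then have "dist y w < r" by simp
      then have "norm w \<le> norm y + r" using norm_triangle_sub[of w y] by (simp add: dist_norm norm_minus_commute)
      then show "w \<in> cball 0 R" using r(2) by simp
    qed
    define G where "G w = (\<Sum>j\<in>J'. cnj (sgn (g j y)) * g j w)" for w
    have holG: "G holomorphic_on ball y r"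
    proof -
      have "g j holomorphic_on ball y r" if "j \<in> J'" for j
        using g(2)[OF that] by (rule holomorphic_on_subset) (use r(3)[OF that] in auto)
      then show ?thesis unfolding G_def by (intro holomorphic_intros) auto
    qed
    have norm_g: "norm (g j w) = norm (F j w) powr p" if "j \<in> J'" "w \<in> ball y r" for j w
      using g(3)[OF that(1), of w] that(2) r(3)[OF that(1)] by auto
    have Gle: "norm (G w) \<le> v w" if "w \<in> ball y r" for w
    proof -
      have "norm (G w) \<le> (\<Sum>j\<in>J'. norm (cnj (sgn (g j y)) * g j w))" unfolding G_def by (rule norm_sum)
      also have "\<dots> \<le> (\<Sum>j\<in>J'. norm (F j w) powr p)"
      proof (rule sum_mono)
        fix j assume j: "j \<in> J'"
        have "norm (cnj (sgn (g j y))) \<le> 1" by (simp add: norm_sgn)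
        then have "norm (cnj (sgn (g j y)) * g j w) \<le> 1 * norm (g j w)"
          unfolding norm_mult by (intro mult_right_mono) auto
        then show "norm (cnj (sgn (g j y)) * g j w) \<le> norm (F j w) powr p"
          using norm_g[OF j that] by simp
      qed
      also have "\<dots> \<le> v w" unfolding v_def using J J'J by (intro sum_mono2) auto
      finally show ?thesis .
    qed
    have Gy: "G y = of_real (v y)"
    proof -
      have "G y = (\<Sum>j\<in>J'. of_real (norm (F j y) powr p))" unfolding G_def
      proof (rule sum.cong)
        fix j assume j: "j \<in> J'"
        have "cnj (sgn (g j y)) * g j y = of_real (norm (g j y))"
          by (cases "g j y = 0") (simp_all add: sgn_div_norm scaleR_conv_of_real complex_norm_square[symmetric] power2_eq_square
              mult.commute[of "cnj _"] mult.assoc field_simps)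
        then show "cnj (sgn (g j y)) * g j y = of_real (norm (F j y) powr p)"
          using norm_g[OF j, of y] r(1) by simp
      qed simp
      also have "\<dots> = (\<Sum>j\<in>J. of_real (norm (F j y) powr p))"
        using J p by (intro sum.mono_neutral_left) (auto simp: J'_def)
      finally show ?thesis by (simp add: v_def)
    qed
    have vnn: "v w \<ge> 0" for w unfolding v_def by (intro sum_nonneg) auto
    have "G constant_on ball y r"
    proof (rule maximum_modulus_principle[OF holG])
      show "norm (G w) \<le> norm (G y)" if "w \<in> ball y r" for w
        using Gle[OF that] x(2)[of w] sub that vnn[of y] unfolding Gy vy by force
    qed (use r in auto)
    then have Gconst: "G w = G y" if "w \<in> ball y r" for w
      using that r(1) by (metis centre_in_ball constant_on_def)
    define w where "w = y + of_real (r / 2) * (if y = 0 then 1 else sgn y)"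
    have "w \<in> ball y r" using r(1) by (auto simp: w_def dist_norm norm_mult norm_sgn)
    have "norm w = norm y + r / 2"
    proof (cases "y = 0")
      case False
      have "w = of_real (norm y + r / 2) * sgn y"
        using False by (simp add: w_def sgn_div_norm scaleR_conv_of_real field_simps)
      then show ?thesis using r(1) False
        by (simp only: norm_mult norm_of_real norm_sgn) simp
    qed (use r(1) in \<open>simp add: w_def\<close>)
    moreover have "w \<in> S"
    proof -
      have "v w \<ge> v x"
        using Gle[OF \<open>w \<in> ball y r\<close>] Gconst[OF \<open>w \<in> ball y r\<close>] Gy vy vnn[of y] by simp
      then have "v w = v x" using x(2)[of w] sub \<open>w \<in> ball y r\<close> by force
      then show ?thesis using sub \<open>w \<in> ball y r\<close> by (auto simp: S_def)
    qed
    ultimately show False using y(2)[of w] r(1) by simp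
  qed
  then have "v x \<le> B" using bound[of y] vy by (simp add: v_def)
  moreover have "v z \<le> v x" using x(2)[of z] z by simp
  ultimately show ?thesis by (simp add: v_def)
qed

text \<open>
  The mean of \<open>|f|^p\<close> over the vertices of the regular \<open>N\<close>-gon about the origin that has \<open>z\<close> as a
  vertex. Finite sums of this kind replace integrals over circles.
\<close>

definition circle_avg :: "real \<Rightarrow> (complex \<Rightarrow> complex) \<Rightarrow> nat \<Rightarrow> complex \<Rightarrow> real" where
  "circle_avg p f N z = (\<Sum>j<N. norm (f (z * cis (2 * pi * real j / real N))) powr p) / real N"

lemma sum_periodic_shift:
  fixes F :: "nat \<Rightarrow> 'a::ab_group_add"
  assumes "\<And>j. F (j + N) = F j"
  shows "(\<Sum>j<N. F (j + k)) = (\<Sum>j<N. F j)"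
proof (induction k)
  case (Suc k)
  have "(\<Sum>j<N. F (j + Suc k)) = (\<Sum>j<N. F (Suc j + k))" by simp
  also have "\<dots> = (\<Sum>j<Suc N. F (j + k)) - F k"
    by (subst sum.lessThan_Suc_shift) simp
  also have "\<dots> = (\<Sum>j<N. F (j + k))"
    using assms[of k] by (simp add: add.commute)
  finally show ?case using Suc by simp
qed simp

text \<open>
  For large \<open>N\<close> the average over the vertices of a regular \<open>N\<close>-gon hardly depends on the position
  of the polygon: a rotation by a vertex angle permutes the terms, and the remaining rotation by less
  than \<open>2 pi / N\<close> is harmless by uniform continuity.
\<close>

lemma circle_avg_almost_constant:
  assumes cont: "continuous_on (cball 0 R) f" and p: "0 < p" and \<epsilon>: "0 < \<epsilon>"
  obtains N0 where "\<And>(N::nat) (w::complex) (w'::complex). N0 \<le> N \<Longrightarrow> 0 < N \<Longrightarrow> norm w \<le> R \<Longrightarrow> norm w' = norm w \<Longrightarrow>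
     circle_avg p f N w' \<le> circle_avg p f N w + \<epsilon>"
proof -
  define h where "h z = norm (f z) powr p" for z
  have "continuous_on (cball 0 R) h" unfolding h_def
    using p by (intro continuous_intros cont continuous_on_powr') auto
  then have "uniformly_continuous_on (cball 0 R) h" by (rule compact_uniformly_continuous) simp
  then obtain d where d: "d > 0" "\<And>x y. x \<in> cball 0 R \<Longrightarrow> y \<in> cball 0 R \<Longrightarrow> dist x y < d \<Longrightarrow> dist (h x) (h y) < \<epsilon>"
    using \<epsilon> unfolding uniformly_continuous_on_def by metis
  obtain N0 :: nat where N0: "2 * pi * \<bar>R\<bar> / d < N0" using reals_Archimedean2 by blast
  show ?thesis
  proof
    fix N :: nat and w w' :: complex assume N: "N0 \<le> N" "0 < N" and w: "norm w \<le> R" "norm w' = norm w"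
    have small: "2 * pi / N * norm w < d"
    proof -
      have "2 * pi * \<bar>R\<bar> / d < N" using N0 N(1) by linarith
      then have "2 * pi * \<bar>R\<bar> < N * d" using d(1) by (simp add: field_simps)
      moreover have "2 * pi * norm w \<le> 2 * pi * \<bar>R\<bar>" using w(1) by (intro mult_left_mono) auto
      ultimately have "2 * pi * norm w < N * d" by linarith
      then show ?thesis using N(2) by (simp add: field_simps)
    qed
    obtain \<theta> where \<theta>: "0 \<le> \<theta>" "w' = w * cis \<theta>"
    proof (cases "w = 0")
      case True then show ?thesis using w that[of 0] by simp
    next
      case False
      have nw: "norm (w' / w) = 1" using w False by (simp add: norm_divide)
      define t where "t = (if 0 \<le> Arg (w' / w) then Arg (w' / w) else Arg (w' / w) + 2 * pi)"
      have "w' / w \<noteq> 0" using nw by auto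
      then have "cis (Arg (w' / w)) = w' / w" using nw by (simp add: cis_Arg sgn_div_norm)
      then have "cis t = w' / w" unfolding t_def by (simp add: cis_mult[symmetric])
      moreover have "0 \<le> t" unfolding t_def using Arg_bounded[of "w' / w"] by auto
      ultimately show ?thesis using that[of t] False by simp
    qed
    (* Split the angle into k full steps of the polygon and a remainder \<alpha>. *)
    define k where "k = nat \<lfloor>\<theta> * N / (2 * pi)\<rfloor>"
    define \<alpha> where "\<alpha> = \<theta> - 2 * pi * k / N"
    have kf: "real k \<le> \<theta> * N / (2 * pi)" "\<theta> * N / (2 * pi) < real k + 1"
      using \<theta>(1) N(2) unfolding k_def by (auto simp: of_nat_nat)
    have \<alpha>: "0 \<le> \<alpha>" "\<alpha> < 2 * pi / N"
    proof -
      have "2 * pi * k \<le> \<theta> * N" "\<theta> * N < 2 * pi * (k + 1)"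
        using kf by (simp_all add: field_simps)
      then have "2 * pi * k / N \<le> \<theta>" "\<theta> < 2 * pi * (k + 1) / N"
        using N(2) by (simp_all add: pos_divide_le_eq pos_less_divide_eq)
      moreover have "2 * pi * (k + 1) / N = 2 * pi * k / N + 2 * pi / N"
        by (simp add: add_divide_distrib distrib_left)
      ultimately show "0 \<le> \<alpha>" "\<alpha> < 2 * pi / N" by (simp_all add: \<alpha>_def)
    qed
    define F where "F j = h (w * cis (2 * pi * real j / N))" for j :: nat
    have per: "F (j + N) = F j" for j
    proof -
      have "2 * pi * real (j + N) / N = 2 * pi * real j / N + 2 * pi"
        using N(2) by (simp add: field_simps)
      then have "cis (2 * pi * real (j + N) / N) = cis (2 * pi * real j / N)"
        by (simp add: cis_mult[symmetric])
      then show ?thesis by (simp add: F_def)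
    qed
    have "h (w' * cis (2 * pi * real j / N)) \<le> F (j + k) + \<epsilon>" for j
    proof -
      have e: "w' * cis (2 * pi * real j / N) = w * cis (2 * pi * real (j + k) / N) * cis \<alpha>"
        unfolding \<theta>(2) \<alpha>_def by (simp add: cis_mult mult.assoc add_divide_distrib algebra_simps)
      have "norm (cis \<alpha> - 1) \<le> \<bar>\<alpha>\<bar>"
        using dist_exp_i_1[of \<alpha>] abs_sin_x_le_abs_x[of "\<alpha> / 2"] by (simp add: cis_conv_exp)
      then have "norm w * norm (cis \<alpha> - 1) \<le> norm w * (2 * pi / N)"
        using \<alpha> by (intro mult_left_mono) auto
      moreover have "w' * cis (2 * pi * real j / N) - w * cis (2 * pi * real (j + k) / N)
          = w * cis (2 * pi * real (j + k) / N) * (cis \<alpha> - 1)"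
        unfolding e by (simp add: right_diff_distrib)
      ultimately have "dist (w' * cis (2 * pi * real j / N)) (w * cis (2 * pi * real (j + k) / N)) < d"
        using small by (simp add: dist_norm norm_mult mult.commute)
      then have "dist (h (w' * cis (2 * pi * real j / N))) (h (w * cis (2 * pi * real (j + k) / N))) < \<epsilon>"
        using w by (intro d(2)) (auto simp: norm_mult)
      then show ?thesis by (simp add: F_def dist_real_def)
    qed
    then have "(\<Sum>j<N. h (w' * cis (2 * pi * real j / N))) \<le> (\<Sum>j<N. F (j + k) + \<epsilon>)"
      by (intro sum_mono) auto
    also have "\<dots> = (\<Sum>j<N. F j) + N * \<epsilon>"
      using sum_periodic_shift[of F N k, OF per] by (simp add: sum.distrib)
    finally show "circle_avg p f N w' \<le> circle_avg p f N w + \<epsilon>"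
      unfolding circle_avg_def h_def[symmetric] F_def[symmetric] using N(2) by (simp add: field_simps)
  qed
qed

text \<open>
  Finite averages satisfy the maximum principle exactly, so on the circle through \<open>w\<close> some point has
  an average as large as the one at \<open>z\<close>; by \<open>circle_avg_almost_constant\<close> all points of that circle do,
  up to \<open>\<epsilon>\<close>.
\<close>

lemma circle_avg_almost_mono:
  assumes f: "f holomorphic_on ball 0 R'" and R: "R < R'" and p: "0 < p" and \<epsilon>: "0 < \<epsilon>"
  obtains N0 where "\<And>(N::nat) (z::complex) (w::complex). N0 \<le> N \<Longrightarrow> 0 < N \<Longrightarrow> norm z \<le> norm w \<Longrightarrow> norm w \<le> R \<Longrightarrow>
     circle_avg p f N z \<le> circle_avg p f N w + \<epsilon>"
proof -
  have contf: "continuous_on (cball 0 R) f"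
    using f R by (intro holomorphic_on_imp_continuous_on) (auto elim: holomorphic_on_subset)
  obtain N0 where N0: "\<And>(N::nat) (w::complex) (w'::complex). N0 \<le> N \<Longrightarrow> 0 < N \<Longrightarrow> norm w \<le> R \<Longrightarrow> norm w' = norm w \<Longrightarrow>
     circle_avg p f N w' \<le> circle_avg p f N w + \<epsilon>"
    using circle_avg_almost_constant[OF contf p \<epsilon>] by blast
  show ?thesis
  proof
    fix N :: nat and z w :: complex assume N: "N0 \<le> N" "0 < N" and w: "norm z \<le> norm w" "norm w \<le> R"
    show "circle_avg p f N z \<le> circle_avg p f N w + \<epsilon>"
    proof (cases "w = 0")
      case True with w \<epsilon> show ?thesis by simp
    next
      case False
      define F where "F j x = f (x * cis (2 * pi * real j / real N))" for j x
      have img: "(\<lambda>x. x * cis (2 * pi * real j / real N)) ` cball 0 (norm w) \<subseteq> ball 0 R'" for j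
        using w R by (auto simp: norm_mult)
      have hol: "F j holomorphic_on cball 0 (norm w)" for j
      proof -
        have "(\<lambda>x. x * cis (2 * pi * real j / real N)) holomorphic_on cball 0 (norm w)"
          by (intro holomorphic_intros)
        from holomorphic_on_compose_gen[OF this f img] show ?thesis by (simp add: o_def F_def[abs_def])
      qed
      have "(\<Sum>j<N. norm (F j z) powr p) \<le> N * (circle_avg p f N w + \<epsilon>)"
      proof (rule sum_norm_powr_maximum_principle[OF _ p, of _ "norm w"])
        show "F j holomorphic_on ball 0 (norm w)" for j
          by (rule holomorphic_on_subset[OF hol]) auto
        show "continuous_on (cball 0 (norm w)) (F j)" for j
          using hol by (rule holomorphic_on_imp_continuous_on)
        fix w' :: complex assume "norm w' = norm w"
        then have "circle_avg p f N w' \<le> circle_avg p f N w + \<epsilon>" using N w by (intro N0)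
        then show "(\<Sum>j<N. norm (F j w') powr p) \<le> N * (circle_avg p f N w + \<epsilon>)"
          using N(2) unfolding circle_avg_def[of _ _ _ w'] F_def by (simp add: pos_divide_le_eq mult.commute)
      qed (use False w in auto)
      then show ?thesis using N(2) unfolding circle_avg_def[of _ _ _ z] F_def by (simp add: field_simps)
    qed
  qed
qed

lemma measurable_lebesgue_on_disc_of_borel:
  assumes "f \<in> borel \<rightarrow>\<^sub>M N" shows "f \<in> lebesgue_on unit_disc \<rightarrow>\<^sub>M N"
  using measurable_dA_of_borel[OF assms] measurable_cong_sets[OF sets_dA refl] by blast

lemma continuous_on_indicator_borel:
  fixes g :: "complex \<Rightarrow> real"
  assumes "continuous_on A g" "A \<in> sets borel"
  shows "(\<lambda>z. ennreal (g z) * indicator A z) \<in> borel_measurable borel"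
proof -
  have "(\<lambda>z. ennreal (indicator A z *\<^sub>R g z)) \<in> borel_measurable borel"
    using borel_measurable_continuous_on_indicator[OF assms(2,1)] by measurable
  also have "(\<lambda>z. ennreal (indicator A z *\<^sub>R g z)) = (\<lambda>z. ennreal (g z) * indicator A z)"
    by (auto simp: indicator_def)
  finally show ?thesis .
qed

lemma continuous_on_norm_powr:
  assumes "continuous_on A f" "0 < p"
  shows "continuous_on A (\<lambda>z. norm (f z) powr p)"
  using assms by (intro continuous_intros continuous_on_powr') auto

context radial_measure
begin

lemma measurable_M_of_borel: "f \<in> borel \<rightarrow>\<^sub>M N \<Longrightarrow> f \<in> M \<rightarrow>\<^sub>M N"
  using measurable_lebesgue_on_disc_of_borel measurable_cong_sets[OF sets_M refl] by blast

lemma measurable_M_of_borel_on: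
  fixes h :: "complex \<Rightarrow> ennreal"
  assumes "(\<lambda>z. h z * indicator unit_disc z) \<in> borel_measurable borel"
  shows "h \<in> borel_measurable M"
proof -
  have "(\<lambda>z. h z * indicator unit_disc z) \<in> borel_measurable M"
    using assms by (rule measurable_M_of_borel)
  then show ?thesis by (subst (asm) measurable_cong[where g = h]) auto
qed

lemma rotate_on:
  assumes c: "norm c = 1" and h: "(\<lambda>z. h z * indicator unit_disc z) \<in> borel_measurable borel"
  shows "(\<integral>\<^sup>+z. h (c * z) \<partial>M) = (\<integral>\<^sup>+z. h z \<partial>M)"
proof -
  have "(\<integral>\<^sup>+z. h (c * z) \<partial>M) = (\<integral>\<^sup>+z. h (c * z) * indicator unit_disc (c * z) \<partial>M)"
    using c by (intro nn_integral_cong) (auto simp: norm_mult)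
  also have "\<dots> = (\<integral>\<^sup>+z. h z * indicator unit_disc z \<partial>M)"
    by (rule rotate[OF c h])
  also have "\<dots> = (\<integral>\<^sup>+z. h z \<partial>M)" by (intro nn_integral_cong) auto
  finally show ?thesis .
qed

lemma finite_measure_M: "finite_measure M"
  using finite_M by (intro finite_measureI) simp

lemma sets_M_borel [intro]: "A \<in> sets borel \<Longrightarrow> A \<subseteq> unit_disc \<Longrightarrow> A \<in> sets M"
  unfolding sets_M by (simp add: sets_restrict_space_iff)

lemma radial_in_sets_M [intro]:
  assumes "S \<in> sets borel" shows "{z \<in> unit_disc. norm z \<in> S} \<in> sets M"
proof (rule sets_M_borel)
  have "{z \<in> unit_disc. norm z \<in> S} = norm -` S \<inter> unit_disc" by auto
  also have "\<dots> \<in> sets borel" using measurable_sets[of norm borel borel S] assms by simp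
  finally show "{z \<in> unit_disc. norm z \<in> S} \<in> sets borel" .
qed auto

lemma holomorphic_measurable_M:
  assumes "f holomorphic_on unit_disc" shows "f \<in> borel_measurable M"
proof -
  have "(\<lambda>z. indicator unit_disc z *\<^sub>R f z) \<in> borel_measurable M"
    using assms by (intro measurable_M_of_borel borel_measurable_continuous_on_indicator holomorphic_on_imp_continuous_on) auto
  then show ?thesis by (subst (asm) measurable_cong[where g = f]) auto
qed

text \<open>
  Each of the \<open>N\<close> terms has the same integral by rotation invariance.
\<close>

lemma nn_integral_circle_avg:
  assumes f: "f holomorphic_on unit_disc" and p: "0 < p" and S: "S \<in> sets borel" and N: "0 < N"
  shows "(\<integral>\<^sup>+z. ennreal (circle_avg p f N z) * indicator S (norm z) \<partial>M)
       = (\<integral>\<^sup>+z. ennreal (norm (f z) powr p) * indicator S (norm z) \<partial>M)"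
proof -
  define \<Phi> where "\<Phi> z = ennreal (norm (f z) powr p / N) * indicator S (norm z)" for z
  have contf: "continuous_on unit_disc f" using f by (rule holomorphic_on_imp_continuous_on)
  have "(\<lambda>z. ennreal (norm (f z) powr p / N) * indicator unit_disc z) \<in> borel_measurable borel"
    using N p by (intro continuous_on_indicator_borel continuous_on_divide continuous_on_norm_powr contf) auto
  then have "(\<lambda>z. (ennreal (norm (f z) powr p / N) * indicator unit_disc z) * indicator S (norm z)) \<in> borel_measurable borel"
    by (rule borel_measurable_times_ennreal) (use S in measurable)
  then have \<Phi>_borel: "(\<lambda>z. \<Phi> z * indicator unit_disc z) \<in> borel_measurable borel"
    unfolding \<Phi>_def by (simp add: mult_ac)
  have \<Phi>_M: "\<Phi> \<in> borel_measurable M" using \<Phi>_borel by (rule measurable_M_of_borel_on)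
  define c where "c j = cis (2 * pi * real j / N)" for j
  have c: "norm (c j) = 1" for j by (simp add: c_def)
  have meas: "(\<lambda>z. \<Phi> (c j * z)) \<in> borel_measurable M" for j
  proof (rule measurable_M_of_borel_on)
    have "(\<lambda>z. \<Phi> (c j * z) * indicator unit_disc (c j * z)) \<in> borel_measurable borel"
      by (rule measurable_compose[OF _ \<Phi>_borel]) measurable
    also have "(\<lambda>z. \<Phi> (c j * z) * indicator unit_disc (c j * z)) = (\<lambda>z. \<Phi> (c j * z) * indicator unit_disc z)"
      using c[of j] by (auto simp: indicator_def norm_mult)
    finally show "(\<lambda>z. \<Phi> (c j * z) * indicator unit_disc z) \<in> borel_measurable borel" .
  qed
  have "(\<integral>\<^sup>+z. ennreal (circle_avg p f N z) * indicator S (norm z) \<partial>M) = (\<integral>\<^sup>+z. (\<Sum>j<N. \<Phi> (c j * z)) \<partial>M)"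
  proof (rule nn_integral_cong)
    fix z
    have "circle_avg p f N z = (\<Sum>j<N. norm (f (c j * z)) powr p / N)"
      by (simp add: circle_avg_def c_def sum_divide_distrib mult.commute)
    then have "ennreal (circle_avg p f N z) = (\<Sum>j<N. ennreal (norm (f (c j * z)) powr p / N))"
      by (simp add: sum_ennreal)
    then show "ennreal (circle_avg p f N z) * indicator S (norm z) = (\<Sum>j<N. \<Phi> (c j * z))"
      by (cases "norm z \<in> S") (simp_all add: \<Phi>_def norm_mult c)
  qed
  also have "\<dots> = (\<Sum>j<N. \<integral>\<^sup>+z. \<Phi> (c j * z) \<partial>M)"
    by (rule nn_integral_sum) (rule meas)
  also have "\<dots> = of_nat N * (\<integral>\<^sup>+z. \<Phi> z \<partial>M)"
    by (simp add: rotate_on[OF c \<Phi>_borel])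
  also have "\<dots> = (\<integral>\<^sup>+z. of_nat N * \<Phi> z \<partial>M)"
    by (rule nn_integral_cmult[symmetric]) (rule \<Phi>_M)
  also have "\<dots> = (\<integral>\<^sup>+z. ennreal (norm (f z) powr p) * indicator S (norm z) \<partial>M)"
  proof (rule nn_integral_cong)
    fix z
    have "of_nat N * ennreal (norm (f z) powr p / N) = ennreal (norm (f z) powr p)"
      using N by (simp add: ennreal_of_nat_eq_real_of_nat ennreal_mult[symmetric])
    then show "of_nat N * \<Phi> z = ennreal (norm (f z) powr p) * indicator S (norm z)"
      by (simp add: \<Phi>_def mult.assoc[symmetric])
  qed
  finally show ?thesis .
qed

end

text \<open>
  This is monotonicity of the circular means of \<open>|f|^p\<close>, stated for two rotation invariant
  measures of which one lives inside the other: the mean over the inner set is at most the mean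
  over the outer one. Replacing \<open>|f|^p\<close> by its averages over regular polygons changes neither side and
  makes the pointwise comparison \<open>circle_avg_almost_mono\<close> available.
\<close>

lemma radial_mean_comparison:
  assumes M1: "radial_measure M1" and M2: "radial_measure M2"
    and f: "f holomorphic_on unit_disc" and p: "0 < p"
    and S1 [measurable]: "S1 \<in> sets borel" and S2 [measurable]: "S2 \<in> sets borel" and R: "R < 1"
    and le: "\<And>s t. s \<in> S1 \<Longrightarrow> t \<in> S2 \<Longrightarrow> s \<le> t" and S2R: "\<And>t. t \<in> S2 \<Longrightarrow> t \<le> R"
  shows "emeasure M2 {z \<in> unit_disc. norm z \<in> S2} * (\<integral>\<^sup>+z. ennreal (norm (f z) powr p) * indicator S1 (norm z) \<partial>M1)
     \<le> emeasure M1 {z \<in> unit_disc. norm z \<in> S1} * (\<integral>\<^sup>+z. ennreal (norm (f z) powr p) * indicator S2 (norm z) \<partial>M2)"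
proof -
  interpret M1: radial_measure M1 by fact
  interpret M2: radial_measure M2 by fact
  define m1 where "m1 = emeasure M1 {z \<in> unit_disc. norm z \<in> S1}"
  define m2 where "m2 = emeasure M2 {z \<in> unit_disc. norm z \<in> S2}"
  define I1 where "I1 = (\<integral>\<^sup>+z. ennreal (norm (f z) powr p) * indicator S1 (norm z) \<partial>M1)"
  define I2 where "I2 = (\<integral>\<^sup>+z. ennreal (norm (f z) powr p) * indicator S2 (norm z) \<partial>M2)"
  have m1: "m1 = (\<integral>\<^sup>+z. indicator S1 (norm z) \<partial>M1)"
    unfolding m1_def nn_integral_indicator[OF M1.radial_in_sets_M[OF S1], symmetric]
    by (intro nn_integral_cong) (auto simp: indicator_def)
  have m2: "m2 = (\<integral>\<^sup>+z. indicator S2 (norm z) \<partial>M2)"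
    unfolding m2_def nn_integral_indicator[OF M2.radial_in_sets_M[OF S2], symmetric]
    by (intro nn_integral_cong) (auto simp: indicator_def)
  have ind1: "(\<lambda>z. indicator S1 (norm z) :: ennreal) \<in> borel_measurable M1"
    by (rule M1.measurable_M_of_borel) measurable
  have ind2: "(\<lambda>z. indicator S2 (norm z) :: ennreal) \<in> borel_measurable M2"
    by (rule M2.measurable_M_of_borel) measurable
  have fin: "m1 < top" "m2 < top"
    unfolding m1_def m2_def
    using finite_measure.emeasure_finite[OF M1.finite_measure_M] finite_measure.emeasure_finite[OF M2.finite_measure_M]
    by (auto simp: less_top[symmetric])
  have f_M2: "(\<lambda>z. ennreal (norm (f z) powr p)) \<in> borel_measurable M2"
    using M2.holomorphic_measurable_M[OF f] by measurable
  have key: "m2 * I1 \<le> m1 * I2 + ennreal e * (m1 * m2)" if e: "e > 0" for e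
  proof -
    obtain N0 where N0: "\<And>(N::nat) (z::complex) (w::complex). N0 \<le> N \<Longrightarrow> 0 < N \<Longrightarrow> norm z \<le> norm w \<Longrightarrow> norm w \<le> R \<Longrightarrow>
       circle_avg p f N z \<le> circle_avg p f N w + e"
      using circle_avg_almost_mono[OF f R p e] by blast
    define N where "N = Suc N0"
    have nn: "circle_avg p f N w \<ge> 0" for w unfolding circle_avg_def by (intro divide_nonneg_nonneg sum_nonneg) auto
    have pt: "I1 \<le> (ennreal (circle_avg p f N w) + ennreal e) * m1" if w: "norm w \<in> S2" for w :: complex
    proof -
      have "I1 = (\<integral>\<^sup>+z. ennreal (circle_avg p f N z) * indicator S1 (norm z) \<partial>M1)"
        unfolding I1_def by (rule M1.nn_integral_circle_avg[OF f p S1, symmetric]) (simp add: N_def)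
      also have "\<dots> \<le> (\<integral>\<^sup>+z. (ennreal (circle_avg p f N w) + ennreal e) * indicator S1 (norm z) \<partial>M1)"
      proof (rule nn_integral_mono)
        fix z show "ennreal (circle_avg p f N z) * indicator S1 (norm z)
            \<le> (ennreal (circle_avg p f N w) + ennreal e) * indicator S1 (norm z)"
        proof (cases "norm z \<in> S1")
          case True
          then have "circle_avg p f N z \<le> circle_avg p f N w + e"
            using le S2R w by (intro N0) (auto simp: N_def)
          then show ?thesis using True nn e by (simp add: ennreal_plus[symmetric] del: ennreal_plus)
        qed simp
      qed
      also have "\<dots> = (ennreal (circle_avg p f N w) + ennreal e) * m1"
        unfolding m1 by (rule nn_integral_cmult) (rule ind1)
      finally show ?thesis .
    qed
    have avg_meas: "(\<lambda>w. ennreal (circle_avg p f N w) * indicator S2 (norm w)) \<in> borel_measurable M2"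
    proof -
      have "continuous_on unit_disc (circle_avg p f N)"
        unfolding circle_avg_def using p
        by (intro continuous_intros continuous_on_powr' continuous_on_compose2[OF holomorphic_on_imp_continuous_on[OF f]])
           (auto simp: norm_mult N_def)
      then have "(\<lambda>w. ennreal (circle_avg p f N w)) \<in> borel_measurable M2"
        by (intro M2.measurable_M_of_borel_on continuous_on_indicator_borel) auto
      then show ?thesis using ind2 by measurable
    qed
    have "m2 * I1 = (\<integral>\<^sup>+w. I1 * indicator S2 (norm w) \<partial>M2)"
      unfolding m2 using ind2 by (simp add: nn_integral_cmult mult.commute)
    also have "\<dots> \<le> (\<integral>\<^sup>+w. m1 * (ennreal (circle_avg p f N w) * indicator S2 (norm w) + ennreal e * indicator S2 (norm w)) \<partial>M2)"
    proof (rule nn_integral_mono)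
      fix w show "I1 * indicator S2 (norm w) \<le> m1 * (ennreal (circle_avg p f N w) * indicator S2 (norm w) + ennreal e * indicator S2 (norm w))"
        using pt[of w] by (cases "norm w \<in> S2") (auto simp: mult.commute)
    qed
    also have "\<dots> = m1 * (\<integral>\<^sup>+w. (ennreal (circle_avg p f N w) * indicator S2 (norm w) + ennreal e * indicator S2 (norm w)) \<partial>M2)"
      using avg_meas ind2 by (intro nn_integral_cmult) auto
    also have "(\<integral>\<^sup>+w. (ennreal (circle_avg p f N w) * indicator S2 (norm w) + ennreal e * indicator S2 (norm w)) \<partial>M2)
       = (\<integral>\<^sup>+w. ennreal (circle_avg p f N w) * indicator S2 (norm w) \<partial>M2) + (\<integral>\<^sup>+w. ennreal e * indicator S2 (norm w) \<partial>M2)"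
      using avg_meas ind2 by (intro nn_integral_add) auto
    also have "(\<integral>\<^sup>+w. ennreal (circle_avg p f N w) * indicator S2 (norm w) \<partial>M2) = I2"
      unfolding I2_def by (rule M2.nn_integral_circle_avg[OF f p S2]) (simp add: N_def)
    also have "(\<integral>\<^sup>+w. ennreal e * indicator S2 (norm w) \<partial>M2) = ennreal e * m2"
      unfolding m2 using ind2 by (rule nn_integral_cmult)
    finally show ?thesis by (simp add: distrib_left mult_ac)
  qed
  have "m2 * I1 \<le> m1 * I2"
  proof (rule ennreal_le_epsilon)
    fix e :: real assume e: "0 < e"
    obtain c where c: "m1 * m2 = ennreal c" "0 \<le> c"
      using fin by (metis ennreal_cases ennreal_mult_less_top less_irrefl)
    have "m2 * I1 \<le> m1 * I2 + ennreal (e / (c + 1)) * ennreal c"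
      using key[of "e / (c + 1)"] e c by simp
    also have "ennreal (e / (c + 1)) * ennreal c = ennreal (e / (c + 1) * c)"
      using e c by (intro ennreal_mult[symmetric]) auto
    also have "\<dots> \<le> ennreal e"
      using e c by (intro ennreal_leI) (simp add: field_simps)
    finally show "m2 * I1 \<le> m1 * I2 + ennreal e" by (simp add: add_left_mono)
  qed
  then show ?thesis by (simp add: m1_def m2_def I1_def I2_def)
qed

section \<open>Sub-mean values and tail estimates\<close>

text \<open>
  The unit mass at the origin, with the Lebesgue measurable sets of the disc as its sets so that it is
  rotation invariant in the sense of \<open>radial_measure\<close>. As inner measure in \<open>radial_mean_comparison\<close> it
  yields the sub-mean value property.
\<close>

definition origin_mass :: "complex measure" where
  "origin_mass = distr (count_space (UNIV :: unit set)) (lebesgue_on unit_disc) (\<lambda>_. 0)"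

lemma nn_integral_origin_mass:
  assumes "h \<in> borel_measurable (lebesgue_on unit_disc)"
  shows "(\<integral>\<^sup>+z. h z \<partial>origin_mass) = h 0"
  unfolding origin_mass_def using assms
  by (subst nn_integral_distr) (auto simp: nn_integral_count_space_finite space_restrict_space UNIV_unit)

lemma radial_measure_origin_mass: "radial_measure origin_mass"
proof
  show "space origin_mass = unit_disc" "sets origin_mass = sets (lebesgue_on unit_disc)"
    by (simp_all add: origin_mass_def space_restrict_space)
  show "emeasure origin_mass unit_disc \<noteq> \<infinity>"
    unfolding origin_mass_def
    by (subst emeasure_distr) (auto simp: space_restrict_space)
  show "(\<integral>\<^sup>+z. h (c * z) \<partial>origin_mass) = (\<integral>\<^sup>+z. h z \<partial>origin_mass)"
    if h: "h \<in> borel_measurable borel" for c h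
  proof -
    have "(\<lambda>z. h (c * z)) \<in> borel_measurable borel" using h by measurable
    then show ?thesis
      using h by (simp add: nn_integral_origin_mass measurable_lebesgue_on_disc_of_borel)
  qed
qed

interpretation area: radial_measure dA by (rule radial_measure_dA)

lemma emeasure_dA_annulus:
  assumes S: "S \<in> sets borel" and sub: "S \<subseteq> {a..}" and a: "0 \<le> a" "a \<le> 1"
  shows "emeasure dA {z \<in> unit_disc. norm z \<in> S} \<le> ennreal (1 - a\<^sup>2)"
proof -
  have "norm \<in> dA \<rightarrow>\<^sub>M borel" by (rule measurable_dA_of_borel) measurable
  then have "emeasure dA {z \<in> unit_disc. norm z \<in> S} = emeasure (distr dA borel norm) S"
    using S by (subst emeasure_distr) (auto intro!: arg_cong[where f = "emeasure dA"])
  also have "\<dots> = (\<integral>\<^sup>+s. ennreal (2 * s * indicator {0<..<1} s) * indicator S s \<partial>lborel)"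
    unfolding distr_norm_dA using S by (intro emeasure_density) auto
  also have "\<dots> \<le> (\<integral>\<^sup>+s. ennreal (2 * s) * indicator {a..1} s \<partial>lborel)"
    using sub by (intro nn_integral_mono) (auto simp: indicator_def)
  also have "\<dots> = ennreal (1\<^sup>2 - a\<^sup>2)"
    using a by (intro nn_integral_FTC_Icc) (auto intro!: derivative_eq_intros)
  finally show ?thesis by simp
qed

lemma emeasure_dA_disc:
  assumes "0 \<le> r" "r < 1"
  shows "emeasure dA (cball 0 r) = ennreal (r\<^sup>2)"
proof -
  have "emeasure dA (cball 0 r \<inter> unit_disc) = ennreal (1 / pi) * emeasure lborel (cball (0::complex) r \<inter> unit_disc)"
    by (rule emeasure_dA) simp
  moreover have "cball (0::complex) r \<inter> unit_disc = cball 0 r" using assms by auto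
  ultimately show ?thesis
    using assms emeasure_cball[of r "0::complex"]
    by (simp add: eval_unit_ball_vol ennreal_mult[symmetric])
qed

lemma nn_integral_lborel_affine_complex:
  fixes h :: "complex \<Rightarrow> ennreal" and c :: real
  assumes [measurable]: "h \<in> borel_measurable borel" and c: "0 < c"
  shows "(\<integral>\<^sup>+z. h z \<partial>lborel) = ennreal (c\<^sup>2) * (\<integral>\<^sup>+z. h (w + of_real c * z) \<partial>lborel)"
proof -
  have "(\<integral>\<^sup>+z. h z \<partial>lborel) = (\<integral>\<^sup>+z. h z \<partial>density (distr lborel borel (\<lambda>x. w + c *\<^sub>R x)) (\<lambda>_. ennreal (\<bar>c\<bar>^DIM(complex))))"
    using lborel_affine[of c w] c by simp
  also have "\<dots> = (\<integral>\<^sup>+z. ennreal (c\<^sup>2) * h z \<partial>distr lborel borel (\<lambda>x. w + c *\<^sub>R x))"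
    using c by (subst nn_integral_density) auto
  also have "\<dots> = (\<integral>\<^sup>+z. ennreal (c\<^sup>2) * h (w + c *\<^sub>R z) \<partial>lborel)"
    by (subst nn_integral_distr) auto
  also have "\<dots> = ennreal (c\<^sup>2) * (\<integral>\<^sup>+z. h (w + of_real c * z) \<partial>lborel)"
    by (subst nn_integral_cmult) (auto simp: scaleR_conv_of_real)
  finally show ?thesis .
qed

text \<open>
  \<open>radial_mean_comparison\<close> applied to \<open>f(w + 2 \<rho> z)\<close>, with the unit mass at the origin inside area
  measure on the disc of radius \<open>1/2\<close>.
\<close>

lemma norm_powr_submean:
  assumes f: "f holomorphic_on unit_disc" and p: "0 < p" and \<rho>: "0 < \<rho>" and sub: "ball w (2 * \<rho>) \<subseteq> unit_disc"
  shows "ennreal (norm (f w) powr p * \<rho>\<^sup>2) \<le> (\<integral>\<^sup>+z. ennreal (norm (f z) powr p) * indicator (cball w \<rho>) z \<partial>dA)"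
proof -
  define F where "F \<zeta> = f (w + of_real (2 * \<rho>) * \<zeta>)" for \<zeta>
  have inball: "w + of_real (2 * \<rho>) * \<zeta> \<in> ball w (2 * \<rho>)" if "\<zeta> \<in> unit_disc" for \<zeta>
    using that \<rho> by (auto simp: dist_norm norm_mult)
  have F: "F holomorphic_on unit_disc"
  proof -
    have "(\<lambda>\<zeta>. w + of_real (2 * \<rho>) * \<zeta>) holomorphic_on unit_disc" by (intro holomorphic_intros)
    moreover have "(\<lambda>\<zeta>. w + of_real (2 * \<rho>) * \<zeta>) ` unit_disc \<subseteq> unit_disc"
      using inball sub by blast
    ultimately show ?thesis
      using holomorphic_on_compose_gen[OF _ f] by (simp add: o_def F_def[abs_def])
  qed
  have cF: "continuous_on unit_disc F" using F by (rule holomorphic_on_imp_continuous_on)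
  let ?\<delta> = "origin_mass"
  have "emeasure dA {z \<in> unit_disc. norm z \<in> {0..1/2}} * (\<integral>\<^sup>+z. ennreal (norm (F z) powr p) * indicator {0} (norm z) \<partial>?\<delta>)
     \<le> emeasure ?\<delta> {z \<in> unit_disc. norm z \<in> {0}} * (\<integral>\<^sup>+z. ennreal (norm (F z) powr p) * indicator {0..1/2} (norm z) \<partial>dA)"
    by (rule radial_mean_comparison[OF radial_measure_origin_mass radial_measure_dA F p, where R = "1/2"]) auto
  also have "{z \<in> unit_disc. norm z \<in> {0..1/2}} = cball (0::complex) (1/2)" by auto
  also have "emeasure dA (cball 0 (1/2)) = ennreal (1/4)"
    by (subst emeasure_dA_disc) (auto simp: power2_eq_square)
  also have "{z \<in> unit_disc. norm z \<in> {0}} = {0::complex}" by auto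
  also have "emeasure ?\<delta> {0} = 1"
    unfolding origin_mass_def
    by (subst emeasure_distr) (auto simp: space_restrict_space sets_restrict_space_iff)
  also have "(\<integral>\<^sup>+z. ennreal (norm (F z) powr p) * indicator {0} (norm z) \<partial>?\<delta>) = ennreal (norm (f w) powr p)"
  proof -
    have "(\<lambda>z. ennreal (norm (F z) powr p) * indicator {0} (norm z)) \<in> borel_measurable (lebesgue_on unit_disc)"
    proof (rule borel_measurable_times_ennreal)
      show "(\<lambda>z. ennreal (norm (F z) powr p)) \<in> borel_measurable (lebesgue_on unit_disc)"
        using area.holomorphic_measurable_M[OF F] by (simp add: measurable_cong_sets[OF sets_dA refl])
      show "(\<lambda>z. indicator {0} (norm z)) \<in> borel_measurable (lebesgue_on unit_disc)"
        by (rule measurable_lebesgue_on_disc_of_borel) measurable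
    qed
    then show ?thesis by (simp add: nn_integral_origin_mass F_def)
  qed
  finally have 1: "ennreal (1/4) * ennreal (norm (f w) powr p)
      \<le> (\<integral>\<^sup>+z. ennreal (norm (F z) powr p) * indicator {0..1/2} (norm z) \<partial>dA)" by simp
  define h where "h z = ennreal (norm (f z) powr p) * indicator (cball w \<rho>) z" for z
  have subc: "cball w \<rho> \<subseteq> unit_disc"
  proof -
    have "cball w \<rho> \<subseteq> ball w (2 * \<rho>)" using \<rho> by auto
    then show ?thesis using sub by blast
  qed
  have h: "h \<in> borel_measurable borel"
    unfolding h_def using p subc
    by (intro continuous_on_indicator_borel continuous_on_norm_powr continuous_on_subset[OF holomorphic_on_imp_continuous_on[OF f]]) auto
  have hF: "h (w + of_real (2 * \<rho>) * z) = ennreal (norm (F z) powr p) * indicator {0..1/2} (norm z)" for z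
  proof -
    have "w + of_real (2 * \<rho>) * z \<in> cball w \<rho> \<longleftrightarrow> norm z \<in> {0..1/2}"
      using \<rho> by (auto simp: dist_norm norm_mult)
    then show ?thesis by (simp add: h_def F_def indicator_def)
  qed
  have h1: "(\<lambda>z. h (w + of_real (2 * \<rho>) * z)) \<in> borel_measurable borel"
    by (rule measurable_compose[OF _ h]) measurable
  have "(\<integral>\<^sup>+z. ennreal (norm (F z) powr p) * indicator {0..1/2} (norm z) \<partial>dA)
      = ennreal (1 / pi) * (\<integral>\<^sup>+z. h (w + of_real (2 * \<rho>) * z) * indicator unit_disc z \<partial>lborel)"
    unfolding hF[symmetric] by (rule nn_integral_dA[OF h1])
  also have "(\<integral>\<^sup>+z. h (w + of_real (2 * \<rho>) * z) * indicator unit_disc z \<partial>lborel) = (\<integral>\<^sup>+z. h (w + of_real (2 * \<rho>) * z) \<partial>lborel)"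
    unfolding hF by (intro nn_integral_cong) (auto simp: indicator_def)
  finally have 2: "ennreal (1/4) * ennreal (norm (f w) powr p)
      \<le> ennreal (1 / pi) * (\<integral>\<^sup>+z. h (w + of_real (2 * \<rho>) * z) \<partial>lborel)"
    using 1 by simp
  have "ennreal (norm (f w) powr p * \<rho>\<^sup>2) = ennreal ((2 * \<rho>)\<^sup>2) * (ennreal (1/4) * ennreal (norm (f w) powr p))"
    by (simp add: ennreal_mult[symmetric] power_mult_distrib)
  also have "\<dots> \<le> ennreal ((2 * \<rho>)\<^sup>2) * (ennreal (1 / pi) * (\<integral>\<^sup>+z. h (w + of_real (2 * \<rho>) * z) \<partial>lborel))"
    using 2 by (intro mult_left_mono) auto
  also have "\<dots> = ennreal (1 / pi) * (\<integral>\<^sup>+z. h z \<partial>lborel)"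
    using nn_integral_lborel_affine_complex[OF h, of "2 * \<rho>" w] \<rho> by (simp add: mult_ac)
  also have "(\<integral>\<^sup>+z. h z \<partial>lborel) = (\<integral>\<^sup>+z. h z * indicator unit_disc z \<partial>lborel)"
    using subc by (intro nn_integral_cong) (auto simp: h_def indicator_def)
  also have "ennreal (1 / pi) * \<dots> = (\<integral>\<^sup>+z. h z \<partial>dA)"
    by (rule nn_integral_dA[OF h, symmetric])
  finally show ?thesis unfolding h_def .
qed

context doubling_measure
begin

lemma tail_anti: "r \<le> r' \<Longrightarrow> tail M r' \<le> tail M r"
  unfolding tail_def
proof (rule finite_measure.finite_measure_mono[OF finite_measure_M])
  show "{z \<in> unit_disc. r < norm z} \<in> sets M" using radial_in_sets_M[of "{r<..}"] by simp
qed auto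

lemma tail_nonneg: "0 \<le> tail M r" by (simp add: tail_def)

lemma emeasure_tail: "emeasure M {z \<in> unit_disc. r < norm z} = ennreal (tail M r)"
  unfolding tail_def by (rule finite_measure.emeasure_eq_measure[OF finite_measure_M])

lemma tail_doubling_factor:
  assumes "1 \<le> K"
  shows "\<exists>C\<ge>1. \<forall>r\<in>{0..<1}. tail M r \<le> C * tail M (1 - (1 - r) / K)"
proof -
  obtain C where C: "C \<ge> 1" "\<And>r. r \<in> {0..<1} \<Longrightarrow> tail M r \<le> C * tail M ((1 + r) / 2)"
    using tail_doubling by auto
  have iter: "tail M r \<le> C ^ n * tail M (1 - (1 - r) / 2 ^ n)" if "r \<in> {0..<1}" for r n
  proof (induction n)
    case (Suc n)
    define r' where "r' = 1 - (1 - r) / 2 ^ n"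
    have "(1 - r) * 1 \<le> (1 - r) * 2 ^ n" using that by (intro mult_left_mono) auto
    then have "(1 - r) / 2 ^ n \<le> 1 - r" by (simp add: pos_divide_le_eq)
    moreover have "0 < (1 - r) / 2 ^ n" using that by simp
    moreover have "0 \<le> r" using that by simp
    ultimately have r': "r' \<in> {0..<1}" unfolding r'_def atLeastLessThan_iff by linarith
    have "tail M r \<le> C ^ n * tail M r'" using Suc by (simp add: r'_def)
    also have "\<dots> \<le> C ^ n * (C * tail M ((1 + r') / 2))"
      using C r' by (intro mult_left_mono) auto
    also have "(1 + r') / 2 = 1 - (1 - r) / 2 ^ Suc n" by (simp add: r'_def field_simps)
    finally show ?case by (simp add: mult_ac)
  qed simp
  obtain n :: nat where n: "K < 2 ^ n" using real_arch_pow[of 2 K] by auto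
  have "tail M r \<le> C ^ n * tail M (1 - (1 - r) / K)" if r: "r \<in> {0..<1}" for r
  proof -
    have "tail M r \<le> C ^ n * tail M (1 - (1 - r) / 2 ^ n)" using r by (rule iter)
    also have "\<dots> \<le> C ^ n * tail M (1 - (1 - r) / K)"
    proof (intro mult_left_mono tail_anti)
      show "1 - (1 - r) / K \<le> 1 - (1 - r) / 2 ^ n"
        using n assms r by (auto intro!: divide_left_mono)
    qed (use C in auto)
    finally show ?thesis .
  qed
  moreover have "C ^ n \<ge> 1" using C by simp
  ultimately show ?thesis by blast
qed

lemma tail_pos:
  assumes "r < 1" shows "0 < tail M r"
proof (cases "r \<le> 0")
  case True then show ?thesis using tail_anti[of r 0] tail_0 by linarith
next
  case False
  define K where "K = 1 / (1 - r)"
  have "1 \<le> K" "1 - (1 - 0) / K = r" using assms False by (auto simp: K_def)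
  then obtain C where "tail M 0 \<le> C * tail M r" using tail_doubling_factor[of K] by force
  then have "tail M r \<noteq> 0" using tail_0 by auto
  then show ?thesis using tail_nonneg[of r] by linarith
qed

lemma measurable_tail [measurable]: "tail M \<in> borel_measurable borel"
proof -
  have "(\<lambda>r. - tail M r) \<in> borel_measurable borel"
    by (rule borel_measurable_mono) (auto simp: mono_def tail_anti)
  then have "(\<lambda>r. - (- tail M r)) \<in> borel_measurable borel" by measurable
  then show ?thesis by simp
qed

text \<open>
  The tail divided by the distance to the boundary: the density of a radial weight that has a
  comparable tail and is nearly constant at the scale of that distance.
\<close>

definition smooth_weight :: "complex \<Rightarrow> real" where
  "smooth_weight z = tail M (norm z) / (1 - norm z)"

lemma smooth_weight_measurable [measurable]: "smooth_weight \<in> borel_measurable borel"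
  unfolding smooth_weight_def by measurable

lemma smooth_weight_nonneg: "z \<in> unit_disc \<Longrightarrow> 0 \<le> smooth_weight z"
  unfolding smooth_weight_def by (simp add: tail_nonneg)

end

section \<open>A smooth substitute for the weight\<close>

context doubling_measure
begin

lemma tail_difference:
  assumes "r \<le> r'"
  shows "emeasure M {z \<in> unit_disc. norm z \<in> {r<..r'}} = ennreal (tail M r - tail M r')"
proof -
  have "{z \<in> unit_disc. norm z \<in> {r<..r'}} = {z \<in> unit_disc. norm z \<in> {r<..}} - {z \<in> unit_disc. norm z \<in> {r'<..}}"
    by auto
  then have "emeasure M {z \<in> unit_disc. norm z \<in> {r<..r'}}
     = emeasure M {z \<in> unit_disc. norm z \<in> {r<..}} - emeasure M {z \<in> unit_disc. norm z \<in> {r'<..}}"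
    using assms finite_measure.emeasure_finite[OF finite_measure_M]
    by (simp only:) (intro emeasure_Diff radial_in_sets_M; auto)
  then show ?thesis using emeasure_tail[of r] emeasure_tail[of r'] tail_nonneg[of r']
    by (simp add: ennreal_minus)
qed

text \<open>
  With \<open>r_k = 1 - K^(-k)\<close>, on the annulus between \<open>r_k\<close> and \<open>r_(k+1)\<close> the smooth weight is at
  most \<open>W(r_k) K^(k+1)\<close> and the area is at most \<open>2 K^(-k)\<close>. The next annulus outwards has mass at
  least \<open>W(r_k) / (2 C)\<close>, since the tail at least halves from each radius to the next. As the means
  of \<open>|f|^p\<close> increase, the integral over the first annulus is bounded by the one over the second, and
  the bounds are summed over \<open>k\<close>.
\<close>

lemma smooth_weight_norm_le:
  "\<exists>C\<ge>0. \<forall>p f. 0 < p \<longrightarrow> f holomorphic_on unit_disc \<longrightarrow>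
     (\<integral>\<^sup>+z. ennreal (norm (f z) powr p) * ennreal (smooth_weight z) \<partial>dA)
       \<le> ennreal C * (\<integral>\<^sup>+z. ennreal (norm (f z) powr p) \<partial>M)"
proof -
  obtain K where K: "K > 1" "\<And>r. r \<in> {0..<1} \<Longrightarrow> 2 * tail M (1 - (1 - r) / K) \<le> tail M r"
    using tail_reverse by auto
  obtain C where C: "C \<ge> 1" "\<And>r. r \<in> {0..<1} \<Longrightarrow> tail M r \<le> C * tail M (1 - (1 - r) / K)"
    using tail_doubling_factor[of K] K(1) by auto
  define r where "r k = 1 - 1 / K ^ k" for k :: nat
  have Kk: "K ^ k \<ge> 1" for k using K(1) by simp
  have r01: "r k \<in> {0..<1}" for k using K(1) Kk[of k] by (simp add: r_def)
  have rSuc: "1 - (1 - r k) / K = r (Suc k)" for k by (simp add: r_def mult.commute)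
  have rmono: "r k \<le> r (Suc k)" for k
    using K(1) by (auto simp: r_def intro!: divide_left_mono mult_pos_pos)
  have rmono': "r i \<le> r j" if "i \<le> j" for i j using that rmono by (rule lift_Suc_mono_le[rotated])
  show ?thesis
  proof (intro exI[of _ "4 * C * K"] conjI allI impI)
    show "0 \<le> 4 * C * K" using C K by simp
    fix p :: real and f assume p: "0 < p" and f: "f holomorphic_on unit_disc"
    define A where "A k = {z \<in> unit_disc. norm z \<in> {r k..<r (Suc k)}}" for k
    define B where "B k = {z \<in> unit_disc. norm z \<in> {r (Suc k)<..r (Suc (Suc k))}}" for k
    define g where "g z = ennreal (norm (f z) powr p)" for z
    have gA: "g \<in> borel_measurable dA" unfolding g_def using area.holomorphic_measurable_M[OF f] by measurable
    have gM: "g \<in> borel_measurable M" unfolding g_def using holomorphic_measurable_M[OF f] by measurable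
    have wA: "(\<lambda>z. ennreal (smooth_weight z)) \<in> borel_measurable dA"
      by (rule measurable_dA_of_borel) measurable
    have As: "A k \<in> sets dA" and Bs: "B k \<in> sets M" for k
      unfolding A_def B_def by (auto intro!: area.radial_in_sets_M radial_in_sets_M)
    have step: "(\<integral>\<^sup>+z. g z * ennreal (smooth_weight z) * indicator (A k) z \<partial>dA)
       \<le> ennreal (4 * C * K) * (\<integral>\<^sup>+z. g z * indicator (B k) z \<partial>M)" for k
    proof -
      define I1 where "I1 = (\<integral>\<^sup>+z. g z * indicator {r k..<r (Suc k)} (norm z) \<partial>dA)"
      define I2 where "I2 = (\<integral>\<^sup>+z. g z * indicator {r (Suc k)<..r (Suc (Suc k))} (norm z) \<partial>M)"
      have I2: "I2 = (\<integral>\<^sup>+z. g z * indicator (B k) z \<partial>M)"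
        unfolding I2_def by (intro nn_integral_cong) (auto simp: B_def indicator_def)
      have m1: "emeasure dA (A k) \<le> ennreal (2 / K ^ k)"
      proof -
        have "emeasure dA (A k) \<le> ennreal (1 - (r k)\<^sup>2)" unfolding A_def
          by (rule emeasure_dA_annulus) (use r01[of k] in auto)
        also have "1 - (r k)\<^sup>2 \<le> 2 / K ^ k" by (simp add: r_def power2_eq_square algebra_simps)
        finally show ?thesis by (simp add: ennreal_leI)
      qed
      have m2: "ennreal (tail M (r k)) \<le> ennreal (2 * C) * emeasure M (B k)"
      proof -
        have "tail M (r k) \<le> C * tail M (r (Suc k))" using C(2)[OF r01[of k]] unfolding rSuc .
        also have "\<dots> \<le> C * (2 * (tail M (r (Suc k)) - tail M (r (Suc (Suc k)))))"
          using K(2)[OF r01[of "Suc k"]] C(1) unfolding rSuc by (intro mult_left_mono) auto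
        finally have "ennreal (tail M (r k)) \<le> ennreal (2 * C * (tail M (r (Suc k)) - tail M (r (Suc (Suc k)))))"
          by (intro ennreal_leI) (simp add: algebra_simps)
        also have "\<dots> = ennreal (2 * C) * emeasure M (B k)"
          unfolding B_def tail_difference[OF rmono] using C(1) tail_anti[OF rmono] by (intro ennreal_mult) auto
        finally show ?thesis .
      qed
      have cmp: "emeasure M (B k) * I1 \<le> emeasure dA (A k) * I2"
        unfolding A_def B_def I1_def I2_def g_def
        by (rule radial_mean_comparison[OF radial_measure_dA radial_measure_axioms f p, where R = "r (Suc (Suc k))"])
           (use r01[of "Suc (Suc k)"] in auto)
      have "(\<integral>\<^sup>+z. g z * ennreal (smooth_weight z) * indicator (A k) z \<partial>dA)
          \<le> (\<integral>\<^sup>+z. ennreal (tail M (r k) * K ^ Suc k) * (g z * indicator {r k..<r (Suc k)} (norm z)) \<partial>dA)"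
      proof (rule nn_integral_mono)
        fix z
        show "g z * ennreal (smooth_weight z) * indicator (A k) z
           \<le> ennreal (tail M (r k) * K ^ Suc k) * (g z * indicator {r k..<r (Suc k)} (norm z))"
        proof (cases "z \<in> A k")
          case True
          then have z: "norm z < 1" "r k \<le> norm z" "norm z < r (Suc k)" by (auto simp: A_def)
          have "1 / K ^ Suc k \<le> 1 - norm z" using z(3) by (simp add: r_def)
          then have "smooth_weight z \<le> tail M (norm z) / (1 / K ^ Suc k)"
            unfolding smooth_weight_def using K(1) z tail_nonneg by (intro divide_left_mono) auto
          also have "\<dots> \<le> tail M (r k) * K ^ Suc k"
            using tail_anti[OF z(2)] K(1) by (simp add: mult_right_mono)
          finally have "ennreal (smooth_weight z) \<le> ennreal (tail M (r k) * K ^ Suc k)" by (rule ennreal_leI)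
          then show ?thesis using True z by (simp add: mult.commute mult_left_mono)
        qed simp
      qed
      also have "\<dots> = ennreal (tail M (r k) * K ^ Suc k) * I1"
        unfolding I1_def
      proof (intro nn_integral_cmult borel_measurable_times_ennreal gA)
        show "(\<lambda>z. indicator {r k..<r (Suc k)} (norm z)) \<in> borel_measurable dA"
          by (rule measurable_dA_of_borel) measurable
      qed
      also have "\<dots> = ennreal (K ^ Suc k) * (ennreal (tail M (r k)) * I1)"
        using K(1) tail_nonneg by (simp add: ennreal_mult mult_ac)
      also have "\<dots> \<le> ennreal (K ^ Suc k) * ((ennreal (2 * C) * emeasure M (B k)) * I1)"
        by (intro mult_left_mono mult_right_mono m2) auto
      also have "\<dots> = ennreal (K ^ Suc k) * (ennreal (2 * C) * (emeasure M (B k) * I1))" by (simp add: mult_ac)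
      also have "\<dots> \<le> ennreal (K ^ Suc k) * (ennreal (2 * C) * (emeasure dA (A k) * I2))"
        by (intro mult_left_mono cmp) auto
      also have "\<dots> \<le> ennreal (K ^ Suc k) * (ennreal (2 * C) * (ennreal (2 / K ^ k) * I2))"
        by (intro mult_left_mono mult_right_mono m1) auto
      also have "\<dots> = ennreal (K ^ Suc k * (2 * C) * (2 / K ^ k)) * I2"
      proof -
        have "ennreal (K ^ Suc k * (2 * C) * (2 / K ^ k)) = ennreal (K ^ Suc k) * ennreal (2 * C) * ennreal (2 / K ^ k)"
          using K(1) C(1) ennreal_mult[of "K ^ Suc k * (2 * C)" "2 / K ^ k"] ennreal_mult[of "K ^ Suc k" "2 * C"] by simp
        then show ?thesis by (simp only: mult_ac)
      qed
      also have "K ^ Suc k * (2 * C) * (2 / K ^ k) = 4 * C * K" using K(1) by simp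
      finally show ?thesis unfolding I2 .
    qed
    have cover: "unit_disc \<subseteq> (\<Union>k. A k)"
    proof
      fix z :: complex assume z: "z \<in> unit_disc"
      obtain n where "1 / (1 - norm z) < K ^ n" using real_arch_pow[OF K(1)] by blast
      then have ex: "norm z < r n" using z K(1) by (simp add: r_def field_simps)
      define n0 where "n0 = (LEAST n. norm z < r n)"
      have n0: "norm z < r n0" unfolding n0_def using ex by (rule LeastI)
      have "n0 \<noteq> 0" using n0 by (intro notI) (simp add: r_def)
      then obtain k where k: "n0 = Suc k" using not0_implies_Suc by blast
      have "\<not> norm z < r k" using not_less_Least[of k "\<lambda>n. norm z < r n"] k unfolding n0_def by simp
      then show "z \<in> (\<Union>k. A k)" using n0 z k by (auto simp: A_def not_less intro!: exI[of _ k])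
    qed
    have disj: "disjoint_family B"
    unfolding disjoint_family_on_def
    proof (intro ballI impI)
      fix i j :: nat assume "i \<noteq> j"
      then show "B i \<inter> B j = {}"
        using rmono'[of "Suc (Suc i)" "Suc j"] rmono'[of "Suc (Suc j)" "Suc i"]
        by (cases "i < j") (auto simp: B_def)
    qed
    define \<mu> where "\<mu> = density dA (\<lambda>z. g z * ennreal (smooth_weight z))"
    define \<sigma> where "\<sigma> = density M g"
    have \<mu>A: "emeasure \<mu> (A k) = (\<integral>\<^sup>+z. g z * ennreal (smooth_weight z) * indicator (A k) z \<partial>dA)" for k
      unfolding \<mu>_def using gA wA As by (intro emeasure_density) auto
    have \<sigma>B: "emeasure \<sigma> (B k) = (\<integral>\<^sup>+z. g z * indicator (B k) z \<partial>M)" for k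
      unfolding \<sigma>_def using gM Bs by (intro emeasure_density) auto
    have "(\<integral>\<^sup>+z. g z * ennreal (smooth_weight z) \<partial>dA) = emeasure \<mu> (\<Union>k. A k)"
    proof -
      have "(\<Union>k. A k) = unit_disc" using cover by (auto simp: A_def)
      moreover have "emeasure \<mu> unit_disc = (\<integral>\<^sup>+z. g z * ennreal (smooth_weight z) * indicator unit_disc z \<partial>dA)"
        unfolding \<mu>_def using gA wA by (intro emeasure_density area.sets_M_borel) auto
      moreover have "\<dots> = (\<integral>\<^sup>+z. g z * ennreal (smooth_weight z) \<partial>dA)"
        by (intro nn_integral_cong) auto
      ultimately show ?thesis by simp
    qed
    also have "\<dots> \<le> (\<Sum>k. emeasure \<mu> (A k))"
      using As by (intro emeasure_subadditive_countably) (auto simp: \<mu>_def)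
    also have "\<dots> \<le> (\<Sum>k. ennreal (4 * C * K) * emeasure \<sigma> (B k))"
      by (intro suminf_le summableI) (simp add: \<mu>A \<sigma>B step)
    also have "\<dots> = ennreal (4 * C * K) * (\<Sum>k. emeasure \<sigma> (B k))" by simp
    also have "(\<Sum>k. emeasure \<sigma> (B k)) = emeasure \<sigma> (\<Union>k. B k)"
      using Bs disj by (intro suminf_emeasure) (auto simp: \<sigma>_def)
    also have "emeasure \<sigma> (\<Union>k. B k) \<le> emeasure \<sigma> (space \<sigma>)"
      using Bs by (intro emeasure_space)
    also have "emeasure \<sigma> (space \<sigma>) = (\<integral>\<^sup>+z. g z \<partial>M)"
    proof -
      have "emeasure \<sigma> (space \<sigma>) = (\<integral>\<^sup>+z. g z * indicator (space M) z \<partial>M)"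
        unfolding \<sigma>_def using gM by (simp only: space_density) (intro emeasure_density sets.top)
      also have "\<dots> = (\<integral>\<^sup>+z. g z \<partial>M)" by (intro nn_integral_cong) auto
      finally show ?thesis .
    qed
    finally show "(\<integral>\<^sup>+z. ennreal (norm (f z) powr p) * ennreal (smooth_weight z) \<partial>dA)
       \<le> ennreal (4 * C * K) * (\<integral>\<^sup>+z. ennreal (norm (f z) powr p) \<partial>M)"
      by (simp add: g_def mult_left_mono)
  qed
qed

end

section \<open>Carleson squares\<close>

lemma cos_gt_iff_near_period:
  fixes x d :: real
  assumes "0 < d" "d \<le> pi"
  shows "(\<exists>k::int. \<bar>x + 2 * pi * of_int k\<bar> < d) \<longleftrightarrow> cos d < cos x"
proof
  have per: "cos (x + 2 * pi * of_int k) = cos x" for k :: int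
    using cos_integer_2pi[of "of_int k"] sin_integer_2pi[of "of_int k"] by (simp add: cos_add)
  show "cos d < cos x" if ex: "\<exists>k::int. \<bar>x + 2 * pi * of_int k\<bar> < d"
  proof -
    obtain k :: int where k: "\<bar>x + 2 * pi * of_int k\<bar> < d" using ex by blast
    have "cos d < cos \<bar>x + 2 * pi * of_int k\<bar>" using k assms by (intro cos_monotone_0_pi) auto
    then show ?thesis by (simp add: per)
  qed
  show "\<exists>k::int. \<bar>x + 2 * pi * of_int k\<bar> < d" if lt: "cos d < cos x"
  proof -
    define k where "k = - round (x / (2 * pi))"
    have "\<bar>of_int (round (x / (2 * pi))) - x / (2 * pi)\<bar> \<le> 1 / 2" by (rule of_int_round_abs_le)
    then have "2 * pi * \<bar>of_int (round (x / (2 * pi))) - x / (2 * pi)\<bar> \<le> pi" by simp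
    also have "2 * pi * \<bar>of_int (round (x / (2 * pi))) - x / (2 * pi)\<bar> = \<bar>2 * pi * (of_int (round (x / (2 * pi))) - x / (2 * pi))\<bar>"
      by (simp add: abs_mult)
    also have "2 * pi * (of_int (round (x / (2 * pi))) - x / (2 * pi)) = - (x + 2 * pi * of_int k)"
      by (simp add: k_def right_diff_distrib)
    finally have le: "\<bar>x + 2 * pi * of_int k\<bar> \<le> pi" by simp
    have "cos d < cos \<bar>x + 2 * pi * of_int k\<bar>" using lt by (simp add: per)
    then have "\<bar>x + 2 * pi * of_int k\<bar> < d"
      using le assms by (subst (asm) cos_mono_less_eq) auto
    then show ?thesis by blast
  qed
qed

text \<open>
  Comparing arguments modulo \<open>2 pi\<close> amounts to comparing cosines, which removes \<open>Arg\<close> and its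
  discontinuity. The square is then visibly a Borel set.
\<close>

lemma carleson_square_eq:
  assumes "a \<noteq> 0" "a \<in> unit_disc"
  shows "carleson_square a = {z \<in> unit_disc. norm a < norm z \<and> norm z * norm a * cos ((1 - norm a) / 2) < Re (z * cnj a)}"
proof -
  have *: "(\<exists>k::int. \<bar>Arg z - Arg a + 2 * pi * of_int k\<bar> < (1 - norm a) / 2) \<longleftrightarrow>
        norm z * norm a * cos ((1 - norm a) / 2) < Re (z * cnj a)" if "norm a < norm z" for z
  proof -
    have nz: "norm z > 0" "norm a > 0" using assms that by auto
    have "z = rcis (norm z) (Arg z)" "a = rcis (norm a) (Arg a)" by (simp_all add: rcis_cmod_Arg)
    then have "z * cnj a = rcis (norm z) (Arg z) * cnj (rcis (norm a) (Arg a))" by metis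
    also have "cnj (rcis (norm a) (Arg a)) = rcis (norm a) (- Arg a)" by (simp add: rcis_def cis_cnj)
    finally have "Re (z * cnj a) = norm z * norm a * cos (Arg z - Arg a)" by (simp add: rcis_mult)
    moreover have "(\<exists>k::int. \<bar>Arg z - Arg a + 2 * pi * of_int k\<bar> < (1 - norm a) / 2) \<longleftrightarrow> cos ((1 - norm a) / 2) < cos (Arg z - Arg a)"
    proof (rule cos_gt_iff_near_period)
      show "0 < (1 - norm a) / 2" using assms by simp
      show "(1 - norm a) / 2 \<le> pi" by (rule order_trans[OF _ pi_ge_two]) (simp add: algebra_simps add_increasing)
    qed
    ultimately show ?thesis using nz by (simp add: mult_less_cancel_left_pos)
  qed
  show ?thesis
  proof (intro set_eqI)
    fix z
    have "z \<in> carleson_square a \<longleftrightarrow> z \<in> unit_disc \<and> norm a < norm z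
        \<and> (\<exists>k::int. \<bar>Arg z - Arg a + 2 * pi * of_int k\<bar> < (1 - norm a) / 2)"
      using assms(1) by (simp add: carleson_square_def)
    then show "z \<in> carleson_square a \<longleftrightarrow>
        z \<in> {z \<in> unit_disc. norm a < norm z \<and> norm z * norm a * cos ((1 - norm a) / 2) < Re (z * cnj a)}"
      using *[of z] unfolding mem_Collect_eq by blast
  qed
qed

lemma carleson_square_borel:
  assumes "a \<in> unit_disc" shows "carleson_square a \<in> sets borel"
proof (cases "a = 0")
  case False
  have "carleson_square a = {z. norm a < norm z \<and> norm z * norm a * cos ((1 - norm a) / 2) < Re (z * cnj a)} \<inter> unit_disc"
    unfolding carleson_square_eq[OF False assms] by blast
  also have "\<dots> \<in> sets borel" by measurable
  finally show ?thesis .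
qed (simp add: carleson_square_def)

lemma carleson_square_subset: "carleson_square a \<subseteq> unit_disc"
  by (auto simp: carleson_square_def)

lemma (in radial_measure) carleson_square_sets: "a \<in> unit_disc \<Longrightarrow> carleson_square a \<in> sets M"
  using carleson_square_borel carleson_square_subset by blast

text \<open>
  Sublevel sets of the kernel \<open>|1 - cnj a z|\<close>; they play the part of enlarged Carleson squares
  without reference to arguments.
\<close>

definition kernel_box :: "complex \<Rightarrow> real \<Rightarrow> complex set" where
  "kernel_box a \<delta> = {z \<in> unit_disc. norm (1 - cnj a * z) < \<delta>}"

lemma kernel_box_borel: "kernel_box a \<delta> \<in> sets borel"
proof -
  have "kernel_box a \<delta> = {z. norm (1 - cnj a * z) < \<delta>} \<inter> unit_disc" by (auto simp: kernel_box_def)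
  also have "\<dots> \<in> sets borel" by measurable
  finally show ?thesis .
qed

lemma norm_one_minus_cnj_mult_ge:
  assumes "a \<in> unit_disc" "z \<in> unit_disc"
  shows "1 - norm a \<le> norm (1 - cnj a * z)" "1 - norm z \<le> norm (1 - cnj a * z)"
    "1 - norm (cnj a * z) \<le> norm (1 - cnj a * z)"
proof -
  show *: "1 - norm (cnj a * z) \<le> norm (1 - cnj a * z)"
    using norm_triangle_ineq2[of 1 "cnj a * z"] by simp
  have "norm (cnj a * z) \<le> norm a * 1" "norm (cnj a * z) \<le> 1 * norm z"
    unfolding norm_mult complex_mod_cnj using assms by (intro mult_mono; simp)+
  with * show "1 - norm a \<le> norm (1 - cnj a * z)" "1 - norm z \<le> norm (1 - cnj a * z)" by simp_all
qed

lemma carleson_square_subset_kernel_box: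
  assumes a: "a \<in> unit_disc"
  shows "carleson_square a \<subseteq> kernel_box a (3 * (1 - norm a))"
proof (cases "a = 0")
  case False
  define h where "h = 1 - norm a"
  have h: "0 < h" "h < 1" using a False by (auto simp: h_def)
  show ?thesis
  proof
    fix z assume "z \<in> carleson_square a"
    then have z: "norm z < 1" "norm a < norm z" "norm z * norm a * cos (h / 2) < Re (z * cnj a)"
      unfolding carleson_square_eq[OF False a] h_def by auto
    define w where "w = cnj a * z"
    define \<rho> where "\<rho> = norm w"
    have \<rho>: "\<rho> = norm a * norm z" by (simp add: \<rho>_def w_def norm_mult)
    have \<rho>1: "0 \<le> \<rho>" "\<rho> \<le> 1" using z(1) a mult_le_one[of "norm a" "norm z"] by (auto simp: \<rho>)
    have \<rho>2: "1 - \<rho> \<le> 2 * h"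
    proof -
      have "norm a * norm a \<le> \<rho>" unfolding \<rho> using z(2) by (intro mult_left_mono) auto
      moreover have "1 - norm a * norm a = h * (1 + norm a)" by (simp add: h_def algebra_simps)
      moreover have "h * (1 + norm a) \<le> h * 2" using h a by (intro mult_left_mono) auto
      ultimately show ?thesis by linarith
    qed
    have "1 - (h / 2)\<^sup>2 / 2 \<le> cos (h / 2)"
    proof -
      have "cos (h / 2) = 1 - 2 * (sin (h / 4))\<^sup>2" using cos_double_sin[of "h / 4"] by simp
      moreover have "(sin (h / 4))\<^sup>2 \<le> (h / 4)\<^sup>2"
        using power_mono[OF abs_sin_x_le_abs_x[of "h / 4"], of 2] by (simp only: power2_abs abs_ge_zero)
      ultimately show ?thesis by (simp add: power2_eq_square)
    qed
    then have "\<rho> * (1 - (h / 2)\<^sup>2 / 2) \<le> \<rho> * cos (h / 2)" using \<rho>1 by (intro mult_left_mono) auto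
    moreover have "\<rho> * cos (h / 2) \<le> Re w" using z(3) by (simp add: \<rho> w_def mult_ac)
    ultimately have Re: "\<rho> * (1 - (h / 2)\<^sup>2 / 2) \<le> Re w" by linarith
    have "(norm (of_real \<rho> - w))\<^sup>2 = 2 * \<rho> * (\<rho> - Re w)"
    proof -
      have "(norm w)\<^sup>2 = (Re w)\<^sup>2 + (Im w)\<^sup>2" by (rule cmod_power2)
      then show ?thesis unfolding cmod_power2[of "of_real \<rho> - w"] \<rho>_def[symmetric]
        by (simp add: power2_eq_square algebra_simps)
    qed
    also have "\<dots> \<le> 2 * \<rho> * (\<rho> * ((h / 2)\<^sup>2 / 2))" using Re \<rho>1 by (intro mult_left_mono) (auto simp: algebra_simps)
    also have "\<dots> = (\<rho> * (h / 2))\<^sup>2" by (simp add: power2_eq_square)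
    finally have "norm (of_real \<rho> - w) \<le> \<rho> * (h / 2)"
      by (rule power2_le_imp_le) (use \<rho>1 h in auto)
    also have "\<dots> \<le> 1 * (h / 2)" using \<rho>1 h by (intro mult_right_mono) auto
    finally have "norm (of_real \<rho> - w) \<le> h / 2" by simp
    moreover have "norm (1 - w) \<le> norm (1 - complex_of_real \<rho>) + norm (of_real \<rho> - w)"
      using norm_triangle_ineq[of "1 - complex_of_real \<rho>" "of_real \<rho> - w"] by simp
    moreover have "norm (1 - complex_of_real \<rho>) = 1 - \<rho>"
      using \<rho>1 by (metis abs_of_nonneg diff_ge_0_iff_ge norm_of_real of_real_1 of_real_diff)
    ultimately have "norm (1 - w) < 3 * h" using \<rho>2 h by linarith
    then show "z \<in> kernel_box a (3 * (1 - norm a))" using z(1) by (simp add: kernel_box_def w_def h_def)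
  qed
qed (auto simp: carleson_square_def kernel_box_def)

context doubling_measure
begin

definition carleson_mass :: "complex \<Rightarrow> real" where "carleson_mass a = measure M (carleson_square a)"

lemma emeasure_M_eq: "emeasure M A = ennreal (measure M A)"
  by (rule finite_measure.emeasure_eq_measure[OF finite_measure_M])

lemma kernel_box_sets: "kernel_box a \<delta> \<in> sets M"
  using kernel_box_borel[of a \<delta>] by (intro sets_M_borel) (auto simp: kernel_box_def)

lemma nn_integral_rotated_indicators:
  assumes E: "E \<in> sets borel" "E \<subseteq> unit_disc" and c: "\<And>j. norm (c j) = 1"
  shows "(\<integral>\<^sup>+z. (\<Sum>j<N. indicator E (c j * z)) \<partial>M) = of_nat N * emeasure M E"
proof -
  have [measurable]: "(\<lambda>z. indicator E (c j * z) :: ennreal) \<in> borel_measurable borel" for j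
    using E(1) by measurable
  have "(\<integral>\<^sup>+z. (\<Sum>j<N. indicator E (c j * z)) \<partial>M) = (\<Sum>j<N. \<integral>\<^sup>+z. indicator E (c j * z) \<partial>M)"
    by (intro nn_integral_sum measurable_M_of_borel) measurable
  also have "\<dots> = (\<Sum>j<N. \<integral>\<^sup>+z. indicator E z \<partial>M)"
    using E by (intro sum.cong rotate c) auto
  also have "\<dots> = of_nat N * emeasure M E" using E by (simp add: sets_M_borel)
  finally show ?thesis .
qed

text \<open>
  About \<open>1 / (4 \<delta>)\<close> rotated copies of the box are pairwise disjoint and lie in the annulus
  \<open>1 - \<delta> < |z|\<close>, so each has at most the corresponding share of the tail.
\<close>

lemma kernel_box_measure_le:
  assumes a: "a \<in> unit_disc" and \<delta>: "0 < \<delta>"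
  shows "measure M (kernel_box a \<delta>) \<le> 8 * \<delta> * tail M (1 - \<delta>)"
proof -
  have sub: "kernel_box a \<delta> \<subseteq> {z \<in> unit_disc. 1 - \<delta> < norm z}"
    using norm_one_minus_cnj_mult_ge(2)[OF a] by (fastforce simp: kernel_box_def)
  have ann: "{z \<in> unit_disc. 1 - \<delta> < norm z} \<in> sets M" using radial_in_sets_M[of "{1 - \<delta><..}"] by simp
  show ?thesis
  proof (cases "\<delta> \<le> 1 / 8")
    case False
    have "measure M (kernel_box a \<delta>) \<le> tail M (1 - \<delta>)"
      unfolding tail_def by (rule finite_measure.finite_measure_mono[OF finite_measure_M sub ann])
    also have "1 * tail M (1 - \<delta>) \<le> (8 * \<delta>) * tail M (1 - \<delta>)"
      using False tail_nonneg by (intro mult_right_mono) auto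
    finally show ?thesis by simp
  next
    case True
    define N where "N = nat \<lfloor>1 / (4 * \<delta>)\<rfloor>"
    have "2 \<le> 1 / (4 * \<delta>)" using True \<delta> by (simp add: field_simps)
    then have N: "real N \<le> 1 / (4 * \<delta>)" "1 / (4 * \<delta>) < real N + 1" "2 \<le> N"
    proof -
      assume "2 \<le> 1 / (4 * \<delta>)"
      then have f2: "2 \<le> \<lfloor>1 / (4 * \<delta>)\<rfloor>" by (simp add: le_floor_iff)
      then have "real N = of_int \<lfloor>1 / (4 * \<delta>)\<rfloor>" unfolding N_def by (intro of_nat_nat) linarith
      then show "real N \<le> 1 / (4 * \<delta>)" "1 / (4 * \<delta>) < real N + 1"
        using floor_correct[of "1 / (4 * \<delta>)"] by simp_all
      show "2 \<le> N" using f2 unfolding N_def by linarith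
    qed
    (* Points on the unit circle with imaginary parts j / N are 1 / N apart, which avoids any
       estimate of sines. The minimum only makes c total. *)
    define t where "t j = real j / real N" for j :: nat
    define c where "c j = Complex (sqrt (1 - (t (min j N))\<^sup>2)) (t (min j N))" for j
    have t1: "(t (min j N))\<^sup>2 \<le> 1" for j
      unfolding t_def using N(3) by (intro power_le_one) (auto simp: divide_le_eq_1)
    have c: "norm (c j) = 1" for j
      using t1[of j] by (simp add: c_def cmod_def)
    have dist: "norm (c i - c j) \<ge> 1 / N" if "i < N" "j < N" "i \<noteq> j" for i j
    proof -
      have "1 \<le> \<bar>real i - real j\<bar>" using that by linarith
      then have "1 / N \<le> \<bar>real i - real j\<bar> / N" by (intro divide_right_mono) auto
      also have "\<dots> = \<bar>Im (c i - c j)\<bar>" using that by (simp add: c_def t_def min_def diff_divide_distrib[symmetric] abs_divide)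
      also have "\<dots> \<le> norm (c i - c j)" by (rule abs_Im_le_cmod)
      finally show ?thesis .
    qed
    have "of_nat N * emeasure M (kernel_box a \<delta>) = (\<integral>\<^sup>+z. (\<Sum>j<N. indicator (kernel_box a \<delta>) (c j * z)) \<partial>M)"
      by (rule nn_integral_rotated_indicators[OF kernel_box_borel _ c, symmetric]) (auto simp: kernel_box_def)
    also have "\<dots> \<le> (\<integral>\<^sup>+z. indicator {z \<in> unit_disc. 1 - \<delta> < norm z} z \<partial>M)"
    proof (rule nn_integral_mono)
      fix z assume "z \<in> space M"
      define J where "J = {j \<in> {..<N}. c j * z \<in> kernel_box a \<delta>}"
      have "(\<Sum>j<N. indicator (kernel_box a \<delta>) (c j * z) :: ennreal) = of_nat (card J)"
        unfolding J_def by (simp add: indicator_def sum.If_cases Int_def)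
      moreover have "card J \<le> 1"
      proof -
        have "i = j" if ij: "i \<in> J" "j \<in> J" for i j
        proof (rule ccontr)
          assume "i \<noteq> j"
          have b: "norm (1 - cnj a * (c i * z)) < \<delta>" "norm (1 - cnj a * (c j * z)) < \<delta>" "z \<in> unit_disc"
            using ij \<open>z \<in> space M\<close> by (auto simp: J_def kernel_box_def)
          have "norm (cnj a * z) = norm (cnj a * (c i * z))" by (simp add: norm_mult c)
          also have "\<dots> > 1 - \<delta>"
            using norm_triangle_ineq2[of 1 "cnj a * (c i * z)"] b(1) by simp
          finally have az: "1 / 2 < norm (cnj a * z)" using True by simp
          have "norm (cnj a * z) * norm (c i - c j) = norm ((1 - cnj a * (c j * z)) - (1 - cnj a * (c i * z)))"
            by (simp add: norm_mult[symmetric] algebra_simps)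
          also have "\<dots> < 2 * \<delta>"
            using norm_triangle_ineq4[of "1 - cnj a * (c j * z)" "1 - cnj a * (c i * z)"] b by linarith
          finally have lt: "norm (cnj a * z) * norm (c i - c j) < 2 * \<delta>" .
          have "2 * \<delta> \<le> 1 / 2 * (1 / N)" using N \<delta> by (simp add: field_simps)
          also have "\<dots> \<le> norm (cnj a * z) * norm (c i - c j)"
            using az dist[of i j] \<open>i \<noteq> j\<close> ij by (intro mult_mono) (auto simp: J_def)
          finally show False using lt by simp
        qed
        then show ?thesis using card_le_Suc0_iff_eq[of J] by (simp add: J_def)
      qed
      moreover have "z \<in> {z \<in> unit_disc. 1 - \<delta> < norm z}" if "J \<noteq> {}"
        using that sub c by (auto simp: J_def norm_mult subset_iff)
      ultimately show "(\<Sum>j<N. indicator (kernel_box a \<delta>) (c j * z) :: ennreal) \<le> indicator {z \<in> unit_disc. 1 - \<delta> < norm z} z"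
        by (cases "J = {}") (auto simp: indicator_def)
    qed
    also have "\<dots> = ennreal (tail M (1 - \<delta>))" using ann emeasure_tail[of "1 - \<delta>"] by simp
    finally have "ennreal (real N * measure M (kernel_box a \<delta>)) \<le> ennreal (tail M (1 - \<delta>))"
      by (simp add: emeasure_M_eq ennreal_mult ennreal_of_nat_eq_real_of_nat)
    then have le: "real N * measure M (kernel_box a \<delta>) \<le> tail M (1 - \<delta>)"
      using tail_nonneg by (subst (asm) ennreal_le_iff) auto
    have "1 / (8 * \<delta>) \<le> N"
    proof -
      have "1 / (8 * \<delta>) = 1 / (4 * \<delta>) / 2" by simp
      moreover have "2 \<le> real N" using N(3) by simp
      ultimately show ?thesis using N(2) by linarith
    qed
    then have "1 / (8 * \<delta>) * measure M (kernel_box a \<delta>) \<le> real N * measure M (kernel_box a \<delta>)"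
      by (intro mult_right_mono) auto
    with le have "1 / (8 * \<delta>) * measure M (kernel_box a \<delta>) \<le> tail M (1 - \<delta>)" by linarith
    then show ?thesis using \<delta> by (simp add: field_simps)
  qed
qed

text \<open>
  The rotations of the square by the \<open>N\<close>-th roots of unity, with \<open>N\<close> about \<open>13 / (1 - |a|)\<close>,
  cover the annulus \<open>|a| < |z| < 1\<close>.
\<close>

lemma carleson_mass_lower:
  assumes a: "a \<in> unit_disc"
  shows "(1 - norm a) * tail M (norm a) \<le> 14 * carleson_mass a"
proof (cases "a = 0")
  case True
  have "tail M 0 \<le> carleson_mass 0"
    unfolding tail_def carleson_mass_def
    by (rule finite_measure.finite_measure_mono[OF finite_measure_M])
       (use sets.top[of M] in \<open>auto simp: carleson_square_def\<close>)
  then show ?thesis using True tail_nonneg[of 0] by simp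
next
  case False
  define h where "h = 1 - norm a"
  have h: "0 < h" "h < 1" using a False by (auto simp: h_def)
  (* 13 > 4 pi, so that the step 2 pi / N is less than the half-width h / 2. *)
  define N where "N = nat \<lceil>13 / h\<rceil>"
  have N: "13 / h \<le> N" "real N \<le> 13 / h + 1" unfolding N_def using h
    by (simp_all add: of_nat_nat real_nat_ceiling_ge of_int_ceiling_le_add_one less_imp_le)
  have N0: "0 < real N" using N(1) h by (smt (verit) divide_pos_pos)
  define c where "c j = cis (2 * pi * real j / N)" for j
  have c: "norm (c j) = 1" for j by (simp add: c_def)
  have "ennreal (tail M (norm a)) = (\<integral>\<^sup>+z. indicator {z \<in> unit_disc. norm a < norm z} z \<partial>M)"
    using radial_in_sets_M[of "{norm a<..}"] emeasure_tail[of "norm a"] by simp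
  also have "\<dots> \<le> (\<integral>\<^sup>+z. (\<Sum>j<N. indicator (carleson_square a) (c j * z)) \<partial>M)"
  proof (rule nn_integral_mono)
    fix z assume "z \<in> space M"
    show "indicator {z \<in> unit_disc. norm a < norm z} z \<le> (\<Sum>j<N. indicator (carleson_square a) (c j * z) :: ennreal)"
    proof (cases "norm a < norm z")
      case True
      (* Rotate z by j steps so that its argument relative to a falls just short of 2 pi. *)
      define \<psi> where "\<psi> = Arg (z * cnj a)"
      define \<theta> where "\<theta> = 2 * pi - \<psi>"
      have \<theta>: "0 \<le> \<theta>" using Arg_bounded[of "z * cnj a"] pi_gt_zero unfolding \<theta>_def \<psi>_def by linarith
      define k where "k = nat \<lfloor>\<theta> * N / (2 * pi)\<rfloor>"
      have kf: "real k \<le> \<theta> * N / (2 * pi)" "\<theta> * N / (2 * pi) < real k + 1"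
        using \<theta> N0 unfolding k_def by (auto simp: of_nat_nat)
      define x where "x = \<theta> - 2 * pi * k / N"
      have "2 * pi * k \<le> \<theta> * N" "\<theta> * N < 2 * pi * k + 2 * pi"
        using kf by (simp_all add: field_simps)
      then have "2 * pi * k / N \<le> \<theta>" "\<theta> < (2 * pi * k + 2 * pi) / N"
        using N0 by (simp_all add: pos_divide_le_eq pos_less_divide_eq)
      then have x: "0 \<le> x" "x < 2 * pi / N" by (simp_all add: x_def add_divide_distrib)
      have "2 * pi / N < h / 2"
      proof -
        have "4 * pi < 13" using pi_approx by simp
        moreover have "13 \<le> N * h" using N(1) h by (simp add: field_simps)
        ultimately show ?thesis using N0 h by (simp add: field_simps)
      qed
      then have xh: "x < h / 2" using x by linarith
      define j where "j = k mod N"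
      have jN: "j < N" using N0 by (simp add: j_def)
      have cj: "c j = c k"
      proof -
        have "real k = real j + real N * real (k div N)"
          unfolding j_def by (metis mod_mult_div_eq of_nat_add of_nat_mult)
        then have "2 * pi * real k / N = 2 * pi * real j / N + 2 * pi * real (k div N)"
          using N0 by (simp add: field_simps)
        then have "c k = c j * cis (2 * pi * of_nat (k div N))" by (simp only: c_def cis_mult)
        also have "cis (2 * pi * of_nat (k div N)) = 1" by simp
        finally show ?thesis by simp
      qed
      have zr: "z * cnj a = rcis (norm z * norm a) \<psi>"
        unfolding \<psi>_def by (metis complex_mod_cnj norm_mult rcis_cmod_Arg)
      have "c j * z * cnj a = cis (2 * pi * k / N) * rcis (norm z * norm a) \<psi>"
        unfolding cj by (simp add: c_def zr mult.assoc)
      also have "\<dots> = rcis (norm z * norm a) (2 * pi - x)"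
        unfolding cis_rcis_eq rcis_mult by (simp add: x_def \<theta>_def add.commute)
      finally have "Re (c j * z * cnj a) = norm z * norm a * cos (2 * pi - x)" by simp
      also have "cos (2 * pi - x) = cos x" by (simp add: cos_diff)
      finally have Re: "Re (c j * z * cnj a) = norm z * norm a * cos x" .
      have "cos (h / 2) < cos x" using x xh h pi_ge_two by (intro cos_monotone_0_pi) auto
      moreover have "0 < norm z * norm a" using True False by (auto intro!: mult_pos_pos)
      ultimately have "norm z * norm a * cos (h / 2) < Re (c j * z * cnj a)"
        unfolding Re by (intro mult_strict_left_mono)
      then have "c j * z \<in> carleson_square a"
        unfolding carleson_square_eq[OF False a] using True \<open>z \<in> space M\<close> by (simp add: norm_mult c h_def)
      then have "(indicator {z \<in> unit_disc. norm a < norm z} z :: ennreal) \<le> indicator (carleson_square a) (c j * z)"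
        by (simp add: indicator_def)
      also have "\<dots> \<le> (\<Sum>j<N. indicator (carleson_square a) (c j * z))"
        using jN by (intro member_le_sum) auto
      finally show ?thesis .
    qed simp
  qed
  also have "\<dots> = of_nat N * emeasure M (carleson_square a)"
    by (rule nn_integral_rotated_indicators[OF carleson_square_borel[OF a] carleson_square_subset c])
  also have "\<dots> = ennreal (N * carleson_mass a)"
    by (simp add: carleson_mass_def emeasure_M_eq ennreal_mult ennreal_of_nat_eq_real_of_nat)
  finally have le: "tail M (norm a) \<le> N * carleson_mass a"
    by (subst (asm) ennreal_le_iff) (auto simp: carleson_mass_def)
  have "h * tail M (norm a) \<le> h * (N * carleson_mass a)" using le h by (intro mult_left_mono) auto
  also have "\<dots> = (h * N) * carleson_mass a" by simp
  also have "\<dots> \<le> 14 * carleson_mass a"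
  proof (intro mult_right_mono)
    have "h * N \<le> h * (13 / h + 1)" using N(2) h by (intro mult_left_mono) auto
    also have "\<dots> = 13 + h" using h by (simp add: distrib_left)
    finally show "h * N \<le> 14" using h by simp
  qed (simp add: carleson_mass_def)
  finally show ?thesis by (simp add: h_def)
qed

text \<open>
  The first doubling condition in terms of the distance \<open>x\<close> to the circle and for every positive
  \<open>x\<close>. When \<open>1 - 2 x\<close> is negative the tail is the total mass, which is finite.
\<close>

lemma tail_double_step: "\<exists>C\<ge>1. \<forall>x>0. tail M (1 - 2 * x) \<le> C * tail M (1 - x)"
proof -
  obtain C where C: "C \<ge> 1" "\<And>r. r \<in> {0..<1} \<Longrightarrow> tail M r \<le> C * tail M ((1 + r) / 2)"
    using tail_doubling by auto
  define C' where "C' = C + tail M (- 1) / tail M (1 / 2)"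
  have half: "0 < tail M (1 / 2)" by (rule tail_pos) simp
  have C': "C \<le> C'" "tail M (- 1) / tail M (1 / 2) \<le> C'"
    using C(1) half tail_nonneg[of "- 1"] by (auto simp: C'_def)
  have tot: "tail M r \<le> tail M (- 1)" for r
    unfolding tail_def
  proof (rule finite_measure.finite_measure_mono[OF finite_measure_M])
    show "{z \<in> unit_disc. - 1 < norm z} \<in> sets M" using radial_in_sets_M[of "{- 1<..}"] by simp
    show "{z \<in> unit_disc. r < norm z} \<subseteq> {z \<in> unit_disc. - 1 < norm z}"
      by (auto intro: less_le_trans[OF _ norm_ge_zero])
  qed
  have "tail M (1 - 2 * x) \<le> C' * tail M (1 - x)" if "x > 0" for x
  proof (cases "x \<le> 1 / 2")
    case True
    have "tail M (1 - 2 * x) \<le> C * tail M ((1 + (1 - 2 * x)) / 2)" using that True by (intro C) auto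
    also have "(1 + (1 - 2 * x)) / 2 = 1 - x" by simp
    also have "C * tail M (1 - x) \<le> C' * tail M (1 - x)" using C'(1) tail_nonneg by (intro mult_right_mono)
    finally show ?thesis .
  next
    case False
    have "tail M (1 - 2 * x) \<le> tail M (- 1)" by (rule tot)
    also have "\<dots> = tail M (- 1) / tail M (1 / 2) * tail M (1 / 2)" using half by simp
    also have "\<dots> \<le> C' * tail M (1 - x)"
      using C' C(1) False half tail_nonneg by (intro mult_mono tail_anti) auto
    finally show ?thesis .
  qed
  then show ?thesis using C C' by (intro exI[of _ C']) auto
qed

end

section \<open>Integrals of powers of the kernel\<close>

context doubling_measure
begin

text \<open>
  One constant is fixed once and for all, because the condition on \<open>\<gamma>\<close> has to refer to it.
\<close>

definition doubling_const :: real where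
  "doubling_const = (SOME C. C \<ge> 1 \<and> (\<forall>x>0. tail M (1 - 2 * x) \<le> C * tail M (1 - x)))"

lemma doubling_const: "doubling_const \<ge> 1" "x > 0 \<Longrightarrow> tail M (1 - 2 * x) \<le> doubling_const * tail M (1 - x)"
proof -
  have "doubling_const \<ge> 1 \<and> (\<forall>x>0. tail M (1 - 2 * x) \<le> doubling_const * tail M (1 - x))"
    unfolding doubling_const_def by (rule someI_ex) (use tail_double_step in blast)
  then show "doubling_const \<ge> 1" "x > 0 \<Longrightarrow> tail M (1 - 2 * x) \<le> doubling_const * tail M (1 - x)" by blast+
qed

lemma tail_dbl_power: "x > 0 \<Longrightarrow> tail M (1 - 2 ^ k * x) \<le> doubling_const ^ k * tail M (1 - x)"
proof (induction k)
  case (Suc k)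
  have "tail M (1 - 2 * (2 ^ k * x)) \<le> doubling_const * tail M (1 - 2 ^ k * x)" using Suc.prems by (intro doubling_const) auto
  also have "\<dots> \<le> doubling_const * (doubling_const ^ k * tail M (1 - x))" using Suc doubling_const(1) by (intro mult_left_mono) auto
  finally show ?case by (simp add: mult_ac)
qed simp

lemma carleson_mass_upper:
  assumes a: "a \<in> unit_disc"
  shows "carleson_mass a \<le> 24 * doubling_const\<^sup>2 * ((1 - norm a) * tail M (norm a))"
proof -
  define h where "h = 1 - norm a"
  have h: "0 < h" using a by (simp add: h_def)
  have "carleson_mass a \<le> measure M (kernel_box a (3 * h))"
    unfolding carleson_mass_def h_def
    by (rule finite_measure.finite_measure_mono[OF finite_measure_M carleson_square_subset_kernel_box[OF a] kernel_box_sets])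
  also have "\<dots> \<le> 8 * (3 * h) * tail M (1 - 3 * h)" using h by (intro kernel_box_measure_le a) auto
  also have "\<dots> \<le> 8 * (3 * h) * tail M (1 - 2 ^ 2 * h)" using h by (intro mult_left_mono tail_anti) auto
  also have "\<dots> \<le> 8 * (3 * h) * (doubling_const ^ 2 * tail M (1 - h))" using h by (intro mult_left_mono tail_dbl_power) auto
  finally show ?thesis by (simp add: h_def algebra_simps)
qed

lemma carleson_mass_pos: assumes "a \<in> unit_disc" shows "0 < carleson_mass a"
proof -
  have "0 < (1 - norm a) * tail M (norm a)" using assms tail_pos[of "norm a"] by simp
  also have "\<dots> \<le> 14 * carleson_mass a" by (rule carleson_mass_lower[OF assms])
  finally show ?thesis by simp
qed

text \<open>
  The kernel is at least \<open>1 - |a|\<close>. On the part of the disc where it lies between \<open>2^k (1 - |a|)\<close> and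
  twice that, its power \<open>-s\<close> is at most \<open>(2^k (1 - |a|))^(-s)\<close>, while the mass of that part is at
  most of order \<open>(2 doubling_const)^k (1 - |a|) W(|a|)\<close>. The hypothesis on \<open>s\<close> makes the resulting
  series decay at least like \<open>2^(-k)\<close>.
\<close>

lemma kernel_integral:
  assumes s: "4 * doubling_const \<le> 2 powr s" and a: "a \<in> unit_disc"
  shows "(\<integral>\<^sup>+z. ennreal (norm (1 - cnj a * z) powr (- s)) \<partial>M)
     \<le> ennreal (32 * doubling_const * (1 - norm a) powr (1 - s) * tail M (norm a))"
proof -
  define h where "h = 1 - norm a"
  have h: "0 < h" using a by (simp add: h_def)
  have s0: "0 \<le> s"
  proof (rule ccontr)
    assume "\<not> 0 \<le> s"
    then have "2 powr s \<le> 2 powr 0" by (intro powr_mono) auto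
    with s doubling_const(1) show False by simp
  qed
  define w where "w k = (2 ^ k * h) powr (- s)" for k :: nat
  have pt: "ennreal (norm (1 - cnj a * z) powr (- s)) \<le> (\<Sum>k. ennreal (w k) * indicator (kernel_box a (2 ^ Suc k * h)) z)"
    if z: "z \<in> unit_disc" for z
  proof -
    define x where "x = norm (1 - cnj a * z)"
    have xh: "h \<le> x" using norm_one_minus_cnj_mult_ge(1)[OF a z] by (simp add: h_def x_def)
    obtain n where "x / h < 2 ^ n" using real_arch_pow[of 2 "x / h"] by auto
    then have ex: "x < 2 ^ n * h" using h by (simp add: field_simps)
    define n0 where "n0 = (LEAST n. x < 2 ^ n * h)"
    have n0: "x < 2 ^ n0 * h" unfolding n0_def using ex by (rule LeastI)
    have "n0 \<noteq> 0" using n0 xh by (intro notI) simp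
    then obtain k where k: "n0 = Suc k" using not0_implies_Suc by blast
    have "\<not> x < 2 ^ k * h" using not_less_Least[of k "\<lambda>n. x < 2 ^ n * h"] k unfolding n0_def by simp
    then have "x powr (- s) \<le> w k"
      unfolding w_def using h s0 by (intro powr_mono2') auto
    then have "ennreal (x powr (- s)) \<le> ennreal (w k) * indicator (kernel_box a (2 ^ Suc k * h)) z"
      using n0 k z by (simp add: kernel_box_def x_def ennreal_leI)
    also have "\<dots> \<le> (\<Sum>k. ennreal (w k) * indicator (kernel_box a (2 ^ Suc k * h)) z)"
    proof -
      define F where "F k = ennreal (w k) * indicator (kernel_box a (2 ^ Suc k * h)) z" for k
      have "sum F {k} \<le> suminf F" by (rule sum_le_suminf) auto
      then have "F k \<le> suminf F" by simp
      then show ?thesis unfolding F_def .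
    qed
    finally show ?thesis by (simp add: x_def)
  qed
  have "(\<integral>\<^sup>+z. ennreal (norm (1 - cnj a * z) powr (- s)) \<partial>M)
     \<le> (\<integral>\<^sup>+z. (\<Sum>k. ennreal (w k) * indicator (kernel_box a (2 ^ Suc k * h)) z) \<partial>M)"
    using pt by (intro nn_integral_mono) auto
  also have "\<dots> = (\<Sum>k. \<integral>\<^sup>+z. ennreal (w k) * indicator (kernel_box a (2 ^ Suc k * h)) z \<partial>M)"
    using kernel_box_sets by (intro nn_integral_suminf) auto
  also have "\<dots> = (\<Sum>k. ennreal (w k * measure M (kernel_box a (2 ^ Suc k * h))))"
    using kernel_box_sets by (simp add: nn_integral_cmult emeasure_M_eq ennreal_mult w_def)
  also have "\<dots> \<le> (\<Sum>k. ennreal (16 * doubling_const * h powr (1 - s) * tail M (1 - h) * (1 / 2) ^ k))"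
  proof (intro suminf_le summableI ennreal_leI)
    fix k
    have wk: "w k = (1 / 2 powr s) ^ k * h powr (- s)"
    proof -
      have "w k = (2 ^ k) powr (- s) * h powr (- s)" unfolding w_def using h by (simp add: powr_mult)
      also have "(2 ^ k) powr (- s) = (2 powr (- s)) ^ k"
        by (simp add: powr_realpow[symmetric] powr_powr mult.commute)
      finally show ?thesis by (simp add: powr_minus_divide)
    qed
    have "measure M (kernel_box a (2 ^ Suc k * h)) \<le> 8 * (2 ^ Suc k * h) * tail M (1 - 2 ^ Suc k * h)"
      using h by (intro kernel_box_measure_le a) auto
    also have "\<dots> \<le> 8 * (2 ^ Suc k * h) * (doubling_const ^ Suc k * tail M (1 - h))"
      using h by (intro mult_left_mono tail_dbl_power) auto
    finally have "w k * measure M (kernel_box a (2 ^ Suc k * h)) \<le> w k * (8 * (2 ^ Suc k * h) * (doubling_const ^ Suc k * tail M (1 - h)))"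
      by (intro mult_left_mono) (auto simp: w_def)
    also have "w k * (8 * (2 ^ Suc k * h) * (doubling_const ^ Suc k * tail M (1 - h)))
        = (16 * doubling_const * (h * h powr (- s)) * tail M (1 - h)) * (2 * doubling_const / 2 powr s) ^ k"
      by (simp add: wk power_divide power_mult_distrib)
    also have "h * h powr (- s) = h powr (1 - s)" using h by (simp add: powr_diff powr_minus_divide)
    also have "(16 * doubling_const * h powr (1 - s) * tail M (1 - h)) * (2 * doubling_const / 2 powr s) ^ k
       \<le> (16 * doubling_const * h powr (1 - s) * tail M (1 - h)) * (1 / 2) ^ k"
      using s doubling_const(1) tail_nonneg[of "1 - h"] by (intro mult_left_mono power_mono) (auto simp: field_simps)
    finally show "w k * measure M (kernel_box a (2 ^ Suc k * h)) \<le> 16 * doubling_const * h powr (1 - s) * tail M (1 - h) * (1 / 2) ^ k" .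
  qed
  also have "\<dots> = ennreal (16 * doubling_const * h powr (1 - s) * tail M (1 - h) * (1 / (1 - 1 / 2)))"
    using doubling_const(1) tail_nonneg[of "1 - h"] by (intro suminf_ennreal_eq sums_mult geometric_sums) auto
  finally show ?thesis by (simp add: h_def mult.assoc)
qed

text \<open>
  On the disc of radius \<open>(1 - |w|) / 4\<close> about \<open>w\<close> the distance to the circle and the tail are
  comparable to their values at \<open>w\<close>, and the kernel joining a point of that disc to \<open>w\<close> is as
  small as it can be, up to a constant.
\<close>

lemma near_point:
  assumes w: "w \<in> unit_disc" and \<zeta>: "\<zeta> \<in> cball w ((1 - norm w) / 4)"
  shows "\<zeta> \<in> unit_disc" "3 / 4 * (1 - norm w) \<le> 1 - norm \<zeta>" "1 - norm \<zeta> \<le> 5 / 4 * (1 - norm w)"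
    "tail M (norm w) \<le> doubling_const * tail M (norm \<zeta>)" "tail M (norm \<zeta>) \<le> doubling_const * tail M (norm w)"
    "norm (1 - cnj \<zeta> * w) \<le> 3 * (1 - norm \<zeta>)"
proof -
  define h where "h = 1 - norm w"
  have h: "0 < h" using w by (simp add: h_def)
  have d: "norm (\<zeta> - w) \<le> h / 4" using \<zeta> by (simp add: dist_norm norm_minus_commute h_def)
  have n: "norm \<zeta> \<le> norm w + h / 4" "norm w \<le> norm \<zeta> + h / 4"
    using d norm_triangle_sub[of \<zeta> w] norm_triangle_sub[of w \<zeta>] by (auto simp: norm_minus_commute)
  show 1: "3 / 4 * (1 - norm w) \<le> 1 - norm \<zeta>" using n h_def by argo
  show 2: "1 - norm \<zeta> \<le> 5 / 4 * (1 - norm w)" using n h_def by argo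
  show \<zeta>D: "\<zeta> \<in> unit_disc" using 1 h by (simp add: h_def)
  have "tail M (1 - h) \<le> tail M (1 - 2 * (1 - norm \<zeta>))" using 1 h by (intro tail_anti) (simp add: h_def)
  also have "\<dots> \<le> doubling_const * tail M (1 - (1 - norm \<zeta>))" using \<zeta>D by (intro doubling_const) auto
  finally show "tail M (norm w) \<le> doubling_const * tail M (norm \<zeta>)" by (simp add: h_def)
  have "tail M (norm \<zeta>) \<le> tail M (1 - 2 * h)" using 2 h by (intro tail_anti) (simp add: h_def)
  also have "\<dots> \<le> doubling_const * tail M (1 - h)" using h by (intro doubling_const) auto
  finally show "tail M (norm \<zeta>) \<le> doubling_const * tail M (norm w)" by (simp add: h_def)
  (* 1 - cnj \<zeta> w is about 1 - |\<zeta>|^2, with an error controlled by |\<zeta> - w|. *)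
  have eq: "1 - cnj \<zeta> * w = of_real (1 - (norm \<zeta>)\<^sup>2) + cnj \<zeta> * (\<zeta> - w)"
    by (simp add: algebra_simps complex_norm_square[symmetric] mult.commute[of "cnj \<zeta>" \<zeta>])
  have "norm (1 - cnj \<zeta> * w) \<le> \<bar>1 - (norm \<zeta>)\<^sup>2\<bar> + norm \<zeta> * norm (\<zeta> - w)"
    unfolding eq using norm_triangle_ineq[of "of_real (1 - (norm \<zeta>)\<^sup>2)" "cnj \<zeta> * (\<zeta> - w)"]
    by (simp add: norm_mult del: of_real_diff)
  also have "\<bar>1 - (norm \<zeta>)\<^sup>2\<bar> = (1 - norm \<zeta>) * (1 + norm \<zeta>)"
    using \<zeta>D by (simp add: abs_square_le_1 power2_eq_square algebra_simps mult_le_one)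
  also have "(1 - norm \<zeta>) * (1 + norm \<zeta>) \<le> (1 - norm \<zeta>) * 2" using \<zeta>D by (intro mult_left_mono) auto
  also have "norm \<zeta> * norm (\<zeta> - w) \<le> 1 * (h / 4)" using \<zeta>D d by (intro mult_mono) auto
  also have "(1 - norm \<zeta>) * 2 + 1 * (h / 4) \<le> 3 * (1 - norm \<zeta>)" using 1 h unfolding h_def by argo
  finally show "norm (1 - cnj \<zeta> * w) \<le> 3 * (1 - norm \<zeta>)" by simp
qed

end

section \<open>Pointwise estimates and the Carleson embedding\<close>

text \<open>
  Cauchy's estimate on the circle of radius \<open>(1 - |w|) / 8\<close>, whose points are handled by the
  sub-mean value property on discs of the same radius. These stay inside the disc of radius
  \<open>(1 - |w|) / 4\<close>.
\<close>

lemma norm_higher_deriv_le_area_mean: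
  assumes f: "f holomorphic_on unit_disc" and p: "0 < p" and w: "w \<in> unit_disc"
  shows "ennreal (norm ((deriv ^^ n) f w) powr p * (1 - norm w) powr (real n * p) * (1 - norm w)\<^sup>2)
    \<le> ennreal ((fact n * 8 ^ n) powr p * 64) *
       (\<integral>\<^sup>+z. ennreal (norm (f z) powr p) * indicator (cball w ((1 - norm w) / 4)) z \<partial>dA)"
    (is "_ \<le> ennreal ?C * ?Y")
proof (cases "?Y = top")
  case True
  have "0 < ?C" by simp
  then show ?thesis unfolding True by (simp add: ennreal_mult_top)
next
  case False
  define h where "h = 1 - norm w"
  have h: "0 < h" using w by (simp add: h_def)
  obtain y where y: "?Y = ennreal y" "0 \<le> y" using False by (cases ?Y) auto
  define B where "B = (64 * y / h\<^sup>2) powr (1 / p)"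
  have sub: "ball \<zeta> (2 * (h / 8)) \<subseteq> unit_disc" "cball \<zeta> (h / 8) \<subseteq> cball w (h / 4)"
    if "norm (w - \<zeta>) = h / 8" for \<zeta>
  proof -
    have d: "dist \<zeta> w = h / 8" using that by (simp add: dist_norm norm_minus_commute)
    have "dist 0 \<zeta> \<le> norm w + h / 8" using dist_triangle[of 0 \<zeta> w] d by (simp add: dist_commute)
    show "ball \<zeta> (2 * (h / 8)) \<subseteq> unit_disc"
    proof
      fix x assume "x \<in> ball \<zeta> (2 * (h / 8))"
      then have "dist \<zeta> x < 2 * (h / 8)" by simp
      then have "dist 0 x < norm w + h / 8 + 2 * (h / 8)"
        using dist_triangle[of 0 x \<zeta>] \<open>dist 0 \<zeta> \<le> norm w + h / 8\<close> by linarith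
      then have "dist 0 x < 1" using h h_def by argo
      then show "x \<in> unit_disc" by simp
    qed
    show "cball \<zeta> (h / 8) \<subseteq> cball w (h / 4)"
      using d by (intro cball_subset_cball_iff[THEN iffD2]) (simp add: dist_commute)
  qed
  have fB: "norm (f \<zeta>) \<le> B" if \<zeta>: "norm (w - \<zeta>) = h / 8" for \<zeta>
  proof -
    have "ennreal (norm (f \<zeta>) powr p * (h / 8)\<^sup>2) \<le> (\<integral>\<^sup>+z. ennreal (norm (f z) powr p) * indicator (cball \<zeta> (h / 8)) z \<partial>dA)"
      using h sub[OF \<zeta>] by (intro norm_powr_submean f p) auto
    also have "\<dots> \<le> ?Y"
      using sub(2)[OF \<zeta>] unfolding h_def by (intro nn_integral_mono) (auto simp: indicator_def)
    finally have "norm (f \<zeta>) powr p * (h / 8)\<^sup>2 \<le> y" using y by (simp add: ennreal_le_iff)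
    then have "norm (f \<zeta>) powr p \<le> 64 * y / h\<^sup>2"
      using h by (simp add: power_divide pos_le_divide_eq)
    then have "(norm (f \<zeta>) powr p) powr (1 / p) \<le> B"
      unfolding B_def using p by (intro powr_mono2) auto
    then show ?thesis using p by (simp add: powr_powr)
  qed
  have cball_sub: "cball w (h / 8) \<subseteq> unit_disc"
  proof
    fix x assume "x \<in> cball w (h / 8)"
    then have "dist 0 x \<le> norm w + h / 8" using dist_triangle[of 0 x w] by simp
    then have "dist 0 x < 1" using h h_def by argo
    then show "x \<in> unit_disc" by simp
  qed
  have "norm ((deriv ^^ n) f w) \<le> fact n * B / (h / 8) ^ n"
  proof (rule Cauchy_inequality)
    show "f holomorphic_on ball w (h / 8)"
      using f cball_sub ball_subset_cball by (meson holomorphic_on_subset subset_trans)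
    show "continuous_on (cball w (h / 8)) f"
      using f cball_sub by (meson holomorphic_on_imp_continuous_on holomorphic_on_subset)
  qed (use h fB in auto)
  also have "\<dots> = fact n * 8 ^ n * B / h ^ n" by (simp add: power_divide)
  finally have le: "norm ((deriv ^^ n) f w) * h ^ n \<le> fact n * 8 ^ n * B"
    using h by (simp add: pos_le_divide_eq)
  have "norm ((deriv ^^ n) f w) powr p * h powr (real n * p) = (norm ((deriv ^^ n) f w) * h ^ n) powr p"
    using h by (simp add: powr_mult powr_powr powr_realpow[symmetric])
  also have "\<dots> \<le> (fact n * 8 ^ n * B) powr p" using le h p by (intro powr_mono2) auto
  also have "\<dots> = (fact n * 8 ^ n) powr p * (64 * y / h\<^sup>2)"
    using p y(2) h by (simp add: B_def powr_mult powr_powr)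
  finally have "norm ((deriv ^^ n) f w) powr p * h powr (real n * p) * h\<^sup>2 \<le> (fact n * 8 ^ n) powr p * (64 * y / h\<^sup>2) * h\<^sup>2"
    by (intro mult_right_mono) auto
  also have "\<dots> = ?C * y" using h by simp
  finally have "ennreal (norm ((deriv ^^ n) f w) powr p * h powr (real n * p) * h\<^sup>2) \<le> ennreal (?C * y)"
    by (rule ennreal_leI)
  also have "\<dots> = ennreal ?C * ?Y" unfolding y(1) using y(2) by (intro ennreal_mult) auto
  finally show ?thesis by (simp add: h_def)
qed

context doubling_measure
begin

lemma smooth_weight_lower:
  assumes w: "w \<in> unit_disc" and \<zeta>: "\<zeta> \<in> cball w ((1 - norm w) / 4)"
  shows "tail M (norm w) / (1 - norm w) \<le> 2 * doubling_const * smooth_weight \<zeta>"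
proof -
  note np = near_point[OF w \<zeta>]
  have \<zeta>1: "0 < 1 - norm \<zeta>" and w1: "0 < 1 - norm w" using np(1) w by auto
  have "tail M (norm w) / (1 - norm w) \<le> (doubling_const * tail M (norm \<zeta>)) / (1 - norm w)"
    using np(4) w1 by (intro divide_right_mono) auto
  also have "\<dots> \<le> (doubling_const * tail M (norm \<zeta>)) * (2 / (1 - norm \<zeta>))"
  proof -
    have "1 / (1 - norm w) \<le> 2 / (1 - norm \<zeta>)" using np(3) \<zeta>1 w1 by (simp add: field_simps)
    then show ?thesis using doubling_const(1) tail_nonneg[of "norm \<zeta>"]
      by (metis mult.right_neutral mult_left_mono mult_nonneg_nonneg order_trans times_divide_eq_right zero_le_one)
  qed
  finally show ?thesis by (simp add: smooth_weight_def mult_ac)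
qed

text \<open>
  The smooth weight is at least a multiple of \<open>W(|w|) / (1 - |w|)\<close> on the disc of integration, so it
  can be inserted there at the price of that factor.
\<close>

lemma norm_higher_deriv_le_smooth_mean:
  assumes f: "f holomorphic_on unit_disc" and p: "0 < p" and w: "w \<in> unit_disc"
  shows "ennreal (norm ((deriv ^^ n) f w) powr p * (1 - norm w) powr (real n * p) * ((1 - norm w) * tail M (norm w)))
    \<le> ennreal ((fact n * 8 ^ n) powr p * 128 * doubling_const) *
       (\<integral>\<^sup>+z. ennreal (norm (f z) powr p) * ennreal (smooth_weight z) * indicator (cball w ((1 - norm w) / 4)) z \<partial>dA)"
proof -
  define h where "h = 1 - norm w"
  have h: "0 < h" using w by (simp add: h_def)
  define t where "t = tail M (norm w) / h"
  have t: "0 \<le> t" using h tail_nonneg by (simp add: t_def)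
  let ?g = "\<lambda>z. ennreal (norm (f z) powr p)" and ?I = "indicator (cball w (h / 4))"
  have m1: "?g \<in> borel_measurable dA" using area.holomorphic_measurable_M[OF f] by measurable
  have m2: "(\<lambda>z. ennreal (smooth_weight z)) \<in> borel_measurable dA" by (rule measurable_dA_of_borel) measurable
  have m3: "(\<lambda>z. ?I z :: ennreal) \<in> borel_measurable dA"
    by (rule measurable_dA_of_borel) (auto intro!: borel_measurable_indicator)
  define D where "D = norm ((deriv ^^ n) f w) powr p * h powr (real n * p)"
  have "ennreal (D * (h * tail M (norm w))) = ennreal t * ennreal (D * h\<^sup>2)"
  proof -
    have eq: "D * (h * tail M (norm w)) = t * (D * h\<^sup>2)" using h by (simp add: t_def power2_eq_square)
    show ?thesis unfolding eq by (rule ennreal_mult) (use t in \<open>auto simp: D_def\<close>)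
  qed
  also have "\<dots> \<le> ennreal t * (ennreal ((fact n * 8 ^ n) powr p * 64) * (\<integral>\<^sup>+z. ?g z * ?I z \<partial>dA))"
    using norm_higher_deriv_le_area_mean[OF f p w, of n] by (intro mult_left_mono) (auto simp: D_def h_def)
  also have "\<dots> = ennreal ((fact n * 8 ^ n) powr p * 64) * (\<integral>\<^sup>+z. ennreal t * (?g z * ?I z) \<partial>dA)"
    using m1 m3 by (subst nn_integral_cmult) (auto simp: mult_ac)
  also have "\<dots> \<le> ennreal ((fact n * 8 ^ n) powr p * 64) * (\<integral>\<^sup>+z. ennreal (2 * doubling_const) * (?g z * ennreal (smooth_weight z) * ?I z) \<partial>dA)"
  proof (intro mult_left_mono nn_integral_mono)
    fix z
    show "ennreal t * (?g z * ?I z) \<le> ennreal (2 * doubling_const) * (?g z * ennreal (smooth_weight z) * ?I z)"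
    proof (cases "z \<in> cball w (h / 4)")
      case True
      then have z: "z \<in> cball w ((1 - norm w) / 4)" by (simp add: h_def)
      have "ennreal t \<le> ennreal (2 * doubling_const * smooth_weight z)"
        using smooth_weight_lower[OF w z] by (intro ennreal_leI) (simp add: t_def h_def)
      also have "\<dots> = ennreal (2 * doubling_const) * ennreal (smooth_weight z)"
        using doubling_const(1) near_point(1)[OF w z] by (intro ennreal_mult smooth_weight_nonneg) auto
      finally have "ennreal t * ?g z \<le> ennreal (2 * doubling_const) * ennreal (smooth_weight z) * ?g z" by (intro mult_right_mono) auto
      then show ?thesis using True by (simp add: mult_ac)
    qed simp
  qed auto
  also have "\<dots> = ennreal ((fact n * 8 ^ n) powr p * 64) * (ennreal (2 * doubling_const) * (\<integral>\<^sup>+z. ?g z * ennreal (smooth_weight z) * ?I z \<partial>dA))"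
    using m1 m2 m3 by (subst nn_integral_cmult) auto
  also have "\<dots> = ennreal ((fact n * 8 ^ n) powr p * 64 * (2 * doubling_const)) * (\<integral>\<^sup>+z. ?g z * ennreal (smooth_weight z) * ?I z \<partial>dA)"
    using doubling_const(1) ennreal_mult[of "(fact n * 8 ^ n) powr p * 64" "2 * doubling_const"] by (simp add: mult.assoc)
  finally show ?thesis by (simp add: D_def h_def mult_ac)
qed

end

context doubling_measure
begin

text \<open>
  The integrand of the criterion, apart from the factor \<open>|u|^q \<nu>\<close>, as a function of \<open>w = \<phi>(z)\<close>.
\<close>

definition test_kernel :: "real \<Rightarrow> nat \<Rightarrow> real \<Rightarrow> real \<Rightarrow> complex \<Rightarrow> complex \<Rightarrow> real" where
  "test_kernel \<gamma> n q p a w = (1 - norm a) powr (\<gamma> * q) / norm (1 - cnj a * w) powr ((\<gamma> + real n) * q) / carleson_mass a powr (q / p)"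

lemma test_kernel_nonneg: "0 \<le> test_kernel \<gamma> n q p a w"
  by (simp add: test_kernel_def)

lemma test_kernel_measurable [measurable]: "test_kernel \<gamma> n q p a \<in> borel_measurable borel"
  unfolding test_kernel_def by measurable

text \<open>
  The factor by which \<open>|f^(n)(w)|^q\<close> may exceed the \<open>q/p\<close>-th power of the local average of
  \<open>|f|^p\<close>.
\<close>

definition local_size :: "nat \<Rightarrow> real \<Rightarrow> real \<Rightarrow> complex \<Rightarrow> real" where
  "local_size n q p w = (1 - norm w) powr (- (real n * q)) * ((1 - norm w) * tail M (norm w)) powr (- (q / p))"

lemma local_size_measurable [measurable]: "local_size n q p \<in> borel_measurable borel"
  unfolding local_size_def by measurable

text \<open>
  For \<open>\<zeta>\<close> close to \<open>w\<close> the kernel \<open>|1 - cnj \<zeta> w|\<close> is at most \<open>3 (1 - |\<zeta>|)\<close>, so the test kernel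
  with parameter \<open>\<zeta>\<close> is at \<open>w\<close> as large as \<open>local_size\<close>, up to a constant. This is where the testing condition enters
  the embedding.
\<close>

lemma local_size_le_test_kernel:
  assumes p: "0 < p" and q: "0 < q" and \<gamma>: "0 < \<gamma>"
    and w: "w \<in> unit_disc" and \<zeta>: "\<zeta> \<in> cball w ((1 - norm w) / 4)"
  shows "local_size n q p w \<le> 3 powr ((\<gamma> + real n) * q) * 2 powr (real n * q) * (48 * doubling_const ^ 3) powr (q / p) * test_kernel \<gamma> n q p \<zeta> w"
proof -
  note np = near_point[OF w \<zeta>]
  define h where "h = 1 - norm w"
  define k where "k = 1 - norm \<zeta>"
  define x where "x = norm (1 - cnj \<zeta> * w)"
  have h: "0 < h" using w by (simp add: h_def)
  have k: "0 < k" "k \<le> 2 * h" using np(1,3) h by (auto simp: k_def h_def)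
  have x: "0 < x" "x \<le> 3 * k"
  proof -
    show "x \<le> 3 * k" using np(6) by (simp add: x_def k_def)
    have "k \<le> x" using norm_one_minus_cnj_mult_ge(1)[OF np(1) w] by (simp add: x_def k_def)
    then show "0 < x" using k by simp
  qed
  have s: "0 < carleson_mass \<zeta>" by (rule carleson_mass_pos[OF np(1)])
  have tw: "0 < tail M (norm w)" using w by (intro tail_pos) simp
  have sqle: "carleson_mass \<zeta> \<le> (48 * doubling_const ^ 3) * (h * tail M (norm w))"
  proof -
    have "carleson_mass \<zeta> \<le> 24 * doubling_const\<^sup>2 * (k * tail M (norm \<zeta>))" using carleson_mass_upper[OF np(1)] by (simp add: k_def)
    also have "\<dots> \<le> 24 * doubling_const\<^sup>2 * ((2 * h) * (doubling_const * tail M (norm w)))"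
      using k np(5) doubling_const(1) tail_nonneg by (intro mult_left_mono mult_mono) auto
    finally show ?thesis by (simp add: power2_eq_square power3_eq_cube mult_ac)
  qed
  define \<alpha> where "\<alpha> = (\<gamma> + real n) * q"
  have \<alpha>: "0 < \<alpha>" using \<gamma> q by (simp add: \<alpha>_def)
  have 1: "h powr (- (real n * q)) \<le> 2 powr (real n * q) * k powr (- (real n * q))"
  proof -
    have "(2 * h) powr (- (real n * q)) \<le> k powr (- (real n * q))"
      using k q by (intro powr_mono2') auto
    then have "2 powr (real n * q) * (2 * h) powr (- (real n * q)) \<le> 2 powr (real n * q) * k powr (- (real n * q))"
      by (intro mult_left_mono) auto
    moreover have "2 powr (real n * q) * (2 * h) powr (- (real n * q)) = h powr (- (real n * q))"
      using h by (simp add: powr_mult powr_minus)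
    ultimately show ?thesis by (simp only:)
  qed
  have 2: "k powr (- (real n * q)) \<le> 3 powr \<alpha> * (k powr (\<gamma> * q) / x powr \<alpha>)"
  proof -
    have "(3 * k) powr (- \<alpha>) \<le> x powr (- \<alpha>)" using x \<alpha> by (intro powr_mono2') auto
    then have "3 powr \<alpha> * k powr (\<gamma> * q) * (3 * k) powr (- \<alpha>) \<le> 3 powr \<alpha> * k powr (\<gamma> * q) * x powr (- \<alpha>)"
      by (intro mult_left_mono) auto
    moreover have "3 powr \<alpha> * k powr (\<gamma> * q) * (3 * k) powr (- \<alpha>) = k powr (- (real n * q))"
    proof -
      have "3 powr \<alpha> * k powr (\<gamma> * q) * (3 * k) powr (- \<alpha>) = k powr (\<gamma> * q) * k powr (- \<alpha>)"
        using k by (simp add: powr_mult powr_minus)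
      also have "\<dots> = k powr (- (real n * q))"
        unfolding powr_add[symmetric] by (simp add: \<alpha>_def algebra_simps)
      finally show ?thesis .
    qed
    ultimately show ?thesis by (simp add: powr_minus_divide)
  qed
  have 3: "(h * tail M (norm w)) powr (- (q / p)) \<le> (48 * doubling_const ^ 3) powr (q / p) * (1 / carleson_mass \<zeta> powr (q / p))"
  proof -
    have "((48 * doubling_const ^ 3) * (h * tail M (norm w))) powr (- (q / p)) \<le> carleson_mass \<zeta> powr (- (q / p))"
      using sqle s p q by (intro powr_mono2') auto
    then have "(48 * doubling_const ^ 3) powr (q / p) * ((48 * doubling_const ^ 3) * (h * tail M (norm w))) powr (- (q / p))
        \<le> (48 * doubling_const ^ 3) powr (q / p) * carleson_mass \<zeta> powr (- (q / p))"
      by (intro mult_left_mono) auto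
    moreover have "(48 * doubling_const ^ 3) powr (q / p) * ((48 * doubling_const ^ 3) * (h * tail M (norm w))) powr (- (q / p)) = (h * tail M (norm w)) powr (- (q / p))"
    proof -
      have "0 < 48 * doubling_const ^ 3" using doubling_const(1) by simp
      then show ?thesis using h tw by (subst powr_mult) (auto simp: powr_minus)
    qed
    ultimately show ?thesis by (simp add: powr_minus_divide)
  qed
  have "local_size n q p w = h powr (- (real n * q)) * (h * tail M (norm w)) powr (- (q / p))"
    by (simp add: local_size_def h_def)
  also have "\<dots> \<le> (2 powr (real n * q) * (3 powr \<alpha> * (k powr (\<gamma> * q) / x powr \<alpha>))) * ((48 * doubling_const ^ 3) powr (q / p) * (1 / carleson_mass \<zeta> powr (q / p)))"
  proof (rule mult_mono[OF _ 3])
    show "h powr (- (real n * q)) \<le> 2 powr (real n * q) * (3 powr \<alpha> * (k powr (\<gamma> * q) / x powr \<alpha>))"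
      using 1 mult_left_mono[OF 2, of "2 powr (real n * q)"] by simp
  qed (auto intro!: mult_nonneg_nonneg)
  also have "\<dots> = 3 powr \<alpha> * 2 powr (real n * q) * (48 * doubling_const ^ 3) powr (q / p) * test_kernel \<gamma> n q p \<zeta> w"
    by (simp add: test_kernel_def \<alpha>_def x_def k_def)
  finally show ?thesis by (simp add: \<alpha>_def)
qed

text \<open>
  Let \<open>y\<close> be the local average and \<open>x\<close> a bound for the total integral. Raising the estimate for
  \<open>|f^(n)(w)|^p\<close> to the power \<open>q/p \<ge> 1\<close> gives \<open>y^(q/p)\<close>, which is at most \<open>x^(q/p - 1) y\<close>: this
  keeps the estimate linear in the local average, as Tonelli's theorem requires.
\<close>

lemma norm_higher_deriv_powr_le:
  assumes f: "f holomorphic_on unit_disc" and p: "0 < p" and pq: "p \<le> q" and w: "w \<in> unit_disc"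
    and X: "(\<integral>\<^sup>+z. ennreal (norm (f z) powr p) * ennreal (smooth_weight z) \<partial>dA) \<le> ennreal x" "0 \<le> x"
  shows "ennreal (norm ((deriv ^^ n) f w) powr q)
    \<le> ennreal (((fact n * 8 ^ n) powr p * 128 * doubling_const) powr (q / p) * x powr (q / p - 1) * local_size n q p w) *
       (\<integral>\<^sup>+z. ennreal (norm (f z) powr p) * ennreal (smooth_weight z) * indicator (cball w ((1 - norm w) / 4)) z \<partial>dA)"
    (is "_ \<le> ennreal ?c * ?Y")
proof -
  define C where "C = (fact n * 8 ^ n) powr p * 128 * doubling_const"
  have C: "0 \<le> C" using doubling_const(1) by (simp add: C_def)
  define h where "h = 1 - norm w"
  have h: "0 < h" using w by (simp add: h_def)
  have tw: "0 < tail M (norm w)" using w by (intro tail_pos) simp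
  have Yx: "?Y \<le> ennreal x"
  proof -
    have "?Y \<le> (\<integral>\<^sup>+z. ennreal (norm (f z) powr p) * ennreal (smooth_weight z) \<partial>dA)"
      by (intro nn_integral_mono) (auto simp: indicator_def)
    then show ?thesis using X(1) by (rule order_trans)
  qed
  then have "?Y < top" by (meson ennreal_less_top order_le_less_trans)
  then obtain y where y: "?Y = ennreal y" "0 \<le> y" by (cases ?Y) auto
  have yx: "y \<le> x" using Yx y X(2) by simp
  define D where "D = norm ((deriv ^^ n) f w)"
  have "ennreal (D powr p * h powr (real n * p) * (h * tail M (norm w))) \<le> ennreal C * ennreal y"
    using norm_higher_deriv_le_smooth_mean[OF f p w, of n] y(1) by (simp add: D_def h_def C_def)
  also have "\<dots> = ennreal (C * y)" using C y(2) by (intro ennreal_mult[symmetric])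
  finally have "D powr p * h powr (real n * p) * (h * tail M (norm w)) \<le> C * y"
    using C y(2) by (subst (asm) ennreal_le_iff) auto
  then have e1: "(D powr p * h powr (real n * p) * (h * tail M (norm w))) powr (q / p) \<le> (C * y) powr (q / p)"
    using p pq h tw by (intro powr_mono2) auto
  have e2: "(D powr p * h powr (real n * p) * (h * tail M (norm w))) powr (q / p)
      = D powr q * (h powr (real n * q) * (h * tail M (norm w)) powr (q / p))"
    using p h tw by (simp add: powr_mult powr_powr D_def)
  have le: "D powr q * (h powr (real n * q) * (h * tail M (norm w)) powr (q / p)) \<le> C powr (q / p) * y powr (q / p)"
    using e1 unfolding e2 powr_mult[of C y "q / p"] .
  define L where "L = local_size n q p w"
  have L: "L * (h powr (real n * q) * (h * tail M (norm w)) powr (q / p)) = 1"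
    using h tw by (simp add: L_def local_size_def h_def[symmetric] powr_minus field_simps)
  have Lnn: "0 \<le> L" by (simp add: L_def local_size_def)
  have "D powr q = L * (D powr q * (h powr (real n * q) * (h * tail M (norm w)) powr (q / p)))"
    using L by (simp add: mult.left_commute)
  also have "\<dots> \<le> L * (C powr (q / p) * y powr (q / p))" using le Lnn by (rule mult_left_mono)
  also have "y powr (q / p) \<le> x powr (q / p - 1) * y"
  proof (cases "y = 0")
    case False
    then have "y powr (q / p) = y powr (q / p - 1) * y" using y(2) by (simp add: powr_diff)
    also have "\<dots> \<le> x powr (q / p - 1) * y"
      using y(2) yx p pq False by (intro mult_right_mono powr_mono2) auto
    finally show ?thesis .
  qed simp
  then have "L * (C powr (q / p) * y powr (q / p)) \<le> L * (C powr (q / p) * (x powr (q / p - 1) * y))"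
    using Lnn by (intro mult_left_mono) auto
  finally have "D powr q \<le> ?c * y" by (simp add: L_def C_def mult_ac)
  then have "ennreal (D powr q) \<le> ennreal (?c * y)" by (rule ennreal_leI)
  also have "\<dots> = ennreal ?c * ?Y" unfolding y(1) using y(2) Lnn by (intro ennreal_mult) (auto simp: L_def)
  finally show ?thesis by (simp add: D_def)
qed

text \<open>
  Insert \<open>norm_higher_deriv_powr_le\<close> and exchange the integrals. For fixed \<open>\<zeta>\<close>, the inner
  integral runs over those \<open>z\<close> with \<open>\<phi>(z)\<close> close to \<open>\<zeta>\<close> and is at most a multiple of the testing
  integral at \<open>\<zeta>\<close>. If \<open>1 - |\<phi>(z)| < \<epsilon>\<close> then \<open>1 - |\<zeta>| < 5/4 \<epsilon>\<close>, so only parameters near the circle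
  matter; a large \<open>\<epsilon>\<close> gives the global embedding.
\<close>

lemma carleson_embedding:
  assumes p: "0 < p" and pq: "p \<le> q" and \<gamma>: "0 < \<gamma>"
  shows "\<exists>C\<ge>0. \<forall>m \<phi> f A B \<epsilon>.
     m \<in> borel_measurable dA \<longrightarrow> \<phi> \<in> borel_measurable dA \<longrightarrow> \<phi> \<in> unit_disc \<rightarrow> unit_disc \<longrightarrow>
     f holomorphic_on unit_disc \<longrightarrow> 0 \<le> A \<longrightarrow> 0 \<le> B \<longrightarrow>
     (\<forall>a\<in>unit_disc. 1 - norm a < 5 / 4 * \<epsilon> \<longrightarrow> (\<integral>\<^sup>+z. m z * ennreal (test_kernel \<gamma> n q p a (\<phi> z)) \<partial>dA) \<le> ennreal A) \<longrightarrow>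
     (\<integral>\<^sup>+z. ennreal (norm (f z) powr p) \<partial>M) \<le> ennreal B \<longrightarrow>
     (\<integral>\<^sup>+z. m z * ennreal (norm ((deriv ^^ n) f (\<phi> z)) powr q) * indicator {z. 1 - norm (\<phi> z) < \<epsilon>} z \<partial>dA)
       \<le> ennreal (C * A * B powr (q / p))"
proof -
  interpret area: finite_measure dA by (rule area.finite_measure_M)
  interpret P: pair_sigma_finite dA dA by standard
  have q: "0 < q" using p pq by simp
  obtain C2 where C2: "0 \<le> C2" "\<And>f. f holomorphic_on unit_disc \<Longrightarrow>
     (\<integral>\<^sup>+z. ennreal (norm (f z) powr p) * ennreal (smooth_weight z) \<partial>dA) \<le> ennreal C2 * (\<integral>\<^sup>+z. ennreal (norm (f z) powr p) \<partial>M)"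
    using smooth_weight_norm_le p by blast
  define C1 where "C1 = ((fact n * 8 ^ n) powr p * 128 * doubling_const) powr (q / p)"
  define C4 where "C4 = 3 powr ((\<gamma> + real n) * q) * 2 powr (real n * q) * (48 * doubling_const ^ 3) powr (q / p)"
  have C14: "0 \<le> C1" "0 \<le> C4" by (simp_all add: C1_def C4_def)
  show ?thesis
  proof (intro exI[of _ "C1 * C4 * C2 powr (q / p)"] conjI allI impI)
    show "0 \<le> C1 * C4 * C2 powr (q / p)" using C14 by simp
    fix m :: "complex \<Rightarrow> ennreal" and \<phi> f A B \<epsilon>
    assume m [measurable]: "m \<in> borel_measurable dA" and \<phi> [measurable]: "\<phi> \<in> borel_measurable dA"
      and \<phi>D: "\<phi> \<in> unit_disc \<rightarrow> unit_disc" and f: "f holomorphic_on unit_disc"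
      and A: "0 \<le> A" and B: "0 \<le> B"
      and hyp: "\<forall>a\<in>unit_disc. 1 - norm a < 5 / 4 * \<epsilon> \<longrightarrow> (\<integral>\<^sup>+z. m z * ennreal (test_kernel \<gamma> n q p a (\<phi> z)) \<partial>dA) \<le> ennreal A"
      and fB: "(\<integral>\<^sup>+z. ennreal (norm (f z) powr p) \<partial>M) \<le> ennreal B"
    define x where "x = C2 * B"
    have x0: "0 \<le> x" using C2 B by (simp add: x_def)
    define G where "G z = ennreal (norm (f z) powr p) * ennreal (smooth_weight z)" for z
    have sw: "smooth_weight \<in> borel_measurable dA" by (rule measurable_dA_of_borel) measurable
    have G [measurable]: "G \<in> borel_measurable dA"
      unfolding G_def using area.holomorphic_measurable_M[OF f] sw by measurable
    have Gx: "(\<integral>\<^sup>+z. G z \<partial>dA) \<le> ennreal x"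
    proof -
      have "(\<integral>\<^sup>+z. G z \<partial>dA) \<le> ennreal C2 * (\<integral>\<^sup>+z. ennreal (norm (f z) powr p) \<partial>M)"
        unfolding G_def by (rule C2(2)[OF f])
      also have "\<dots> \<le> ennreal C2 * ennreal B" using fB by (intro mult_left_mono) auto
      finally show ?thesis using C2(1) B by (simp add: x_def ennreal_mult)
    qed
    define V where "V z = m z * ennreal (local_size n q p (\<phi> z)) * indicator {z. 1 - norm (\<phi> z) < \<epsilon>} z" for z
    have ls: "(\<lambda>z. local_size n q p (\<phi> z)) \<in> borel_measurable dA"
      by (rule measurable_compose[OF \<phi> local_size_measurable])
    have indm: "(\<lambda>z. indicator {z. 1 - norm (\<phi> z) < \<epsilon>} z :: ennreal) \<in> borel_measurable dA"
    proof -
      have "(\<lambda>z. indicator {y. 1 - norm y < \<epsilon>} (\<phi> z) :: ennreal) \<in> borel_measurable dA"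
        by (rule measurable_compose[OF \<phi>]) measurable
      then show ?thesis by (simp add: indicator_def)
    qed
    have V [measurable]: "V \<in> borel_measurable dA" unfolding V_def using ls indm by measurable
    define S where "S = {(z, \<zeta>). dist (\<phi> z) \<zeta> \<le> (1 - norm (\<phi> z)) / 4}"
    have idm [measurable]: "(\<lambda>\<zeta>. \<zeta>) \<in> dA \<rightarrow>\<^sub>M borel" by (rule measurable_dA_of_borel) measurable
    have indS: "(\<lambda>(z, \<zeta>). indicator S (z, \<zeta>) :: ennreal) \<in> borel_measurable (dA \<Otimes>\<^sub>M dA)"
    proof -
      have "(\<lambda>(z, \<zeta>). of_bool (dist (\<phi> z) \<zeta> \<le> (1 - norm (\<phi> z)) / 4) :: ennreal) \<in> borel_measurable (dA \<Otimes>\<^sub>M dA)"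
        by measurable
      then show ?thesis by (simp add: S_def indicator_def case_prod_unfold)
    qed
    have indS': "(\<lambda>x. indicator S x :: ennreal) \<in> borel_measurable (dA \<Otimes>\<^sub>M dA)"
      using indS by (simp add: case_prod_unfold)
    have GS: "(\<lambda>(z, \<zeta>). G \<zeta> * indicator S (z, \<zeta>)) \<in> borel_measurable (dA \<Otimes>\<^sub>M dA)"
      using borel_measurable_times_ennreal[OF measurable_compose[OF measurable_snd G] indS']
      by (simp add: case_prod_unfold)
    have VGS: "(\<lambda>(z, \<zeta>). V z * (G \<zeta> * indicator S (z, \<zeta>))) \<in> borel_measurable (dA \<Otimes>\<^sub>M dA)"
      using borel_measurable_times_ennreal[OF measurable_compose[OF measurable_fst V] GS]
      by (simp add: case_prod_unfold)
    have S_cball: "indicator S (z, \<zeta>) = (indicator (cball (\<phi> z) ((1 - norm (\<phi> z)) / 4)) \<zeta> :: ennreal)" for z \<zeta>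
      by (simp add: S_def indicator_def)
    have "(\<integral>\<^sup>+z. m z * ennreal (norm ((deriv ^^ n) f (\<phi> z)) powr q) * indicator {z. 1 - norm (\<phi> z) < \<epsilon>} z \<partial>dA)
       \<le> (\<integral>\<^sup>+z. ennreal (C1 * x powr (q / p - 1)) * (V z * (\<integral>\<^sup>+\<zeta>. G \<zeta> * indicator S (z, \<zeta>) \<partial>dA)) \<partial>dA)"
    proof (rule nn_integral_mono)
      fix z assume "z \<in> space dA"
      then have \<phi>z: "\<phi> z \<in> unit_disc" using \<phi>D by auto
      have "ennreal (norm ((deriv ^^ n) f (\<phi> z)) powr q)
         \<le> ennreal (C1 * x powr (q / p - 1) * local_size n q p (\<phi> z)) * (\<integral>\<^sup>+\<zeta>. G \<zeta> * indicator S (z, \<zeta>) \<partial>dA)"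
        unfolding C1_def G_def S_cball
        by (rule norm_higher_deriv_powr_le[OF f p pq \<phi>z Gx[unfolded G_def] x0])
      also have "ennreal (C1 * x powr (q / p - 1) * local_size n q p (\<phi> z)) = ennreal (C1 * x powr (q / p - 1)) * ennreal (local_size n q p (\<phi> z))"
        using C14 by (intro ennreal_mult) (auto simp: local_size_def)
      finally have "m z * indicator {z. 1 - norm (\<phi> z) < \<epsilon>} z * ennreal (norm ((deriv ^^ n) f (\<phi> z)) powr q)
         \<le> m z * indicator {z. 1 - norm (\<phi> z) < \<epsilon>} z * (ennreal (C1 * x powr (q / p - 1)) * ennreal (local_size n q p (\<phi> z)) * (\<integral>\<^sup>+\<zeta>. G \<zeta> * indicator S (z, \<zeta>) \<partial>dA))"
        by (intro mult_left_mono) auto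
      then show "m z * ennreal (norm ((deriv ^^ n) f (\<phi> z)) powr q) * indicator {z. 1 - norm (\<phi> z) < \<epsilon>} z
         \<le> ennreal (C1 * x powr (q / p - 1)) * (V z * (\<integral>\<^sup>+\<zeta>. G \<zeta> * indicator S (z, \<zeta>) \<partial>dA))"
        by (simp add: V_def mult_ac)
    qed
    also have "\<dots> = ennreal (C1 * x powr (q / p - 1)) * (\<integral>\<^sup>+z. V z * (\<integral>\<^sup>+\<zeta>. G \<zeta> * indicator S (z, \<zeta>) \<partial>dA) \<partial>dA)"
      by (intro nn_integral_cmult borel_measurable_times_ennreal V area.borel_measurable_nn_integral GS)
    also have "(\<integral>\<^sup>+z. V z * (\<integral>\<^sup>+\<zeta>. G \<zeta> * indicator S (z, \<zeta>) \<partial>dA) \<partial>dA) = (\<integral>\<^sup>+z. (\<integral>\<^sup>+\<zeta>. V z * (G \<zeta> * indicator S (z, \<zeta>)) \<partial>dA) \<partial>dA)"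
    proof (rule nn_integral_cong)
      fix z assume "z \<in> space dA"
      have "(\<lambda>\<zeta>. indicator S (z, \<zeta>) :: ennreal) \<in> borel_measurable dA"
        unfolding S_cball by (rule measurable_dA_of_borel) (auto intro!: borel_measurable_indicator)
      then show "V z * (\<integral>\<^sup>+\<zeta>. G \<zeta> * indicator S (z, \<zeta>) \<partial>dA) = (\<integral>\<^sup>+\<zeta>. V z * (G \<zeta> * indicator S (z, \<zeta>)) \<partial>dA)"
        by (intro nn_integral_cmult[symmetric] borel_measurable_times_ennreal G)
    qed
    also have "\<dots> = (\<integral>\<^sup>+\<zeta>. (\<integral>\<^sup>+z. V z * (G \<zeta> * indicator S (z, \<zeta>)) \<partial>dA) \<partial>dA)"
      by (rule P.Fubini'[OF VGS, symmetric])
    also have "\<dots> \<le> (\<integral>\<^sup>+\<zeta>. G \<zeta> * ennreal (C4 * A) \<partial>dA)"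
    proof (rule nn_integral_mono)
      fix \<zeta> assume "\<zeta> \<in> space dA"
      then have \<zeta>D: "\<zeta> \<in> unit_disc" by simp
      have "(\<integral>\<^sup>+z. V z * indicator S (z, \<zeta>) \<partial>dA) \<le> ennreal (C4 * A)"
      proof (cases "1 - norm \<zeta> < 5 / 4 * \<epsilon>")
        case True
        have "(\<integral>\<^sup>+z. V z * indicator S (z, \<zeta>) \<partial>dA) \<le> (\<integral>\<^sup>+z. ennreal C4 * (m z * ennreal (test_kernel \<gamma> n q p \<zeta> (\<phi> z))) \<partial>dA)"
        proof (rule nn_integral_mono)
          fix z assume "z \<in> space dA"
          then have \<phi>z: "\<phi> z \<in> unit_disc" using \<phi>D by auto
          show "V z * indicator S (z, \<zeta>) \<le> ennreal C4 * (m z * ennreal (test_kernel \<gamma> n q p \<zeta> (\<phi> z)))"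
          proof (cases "(z, \<zeta>) \<in> S")
            case inS: True
            then have "\<zeta> \<in> cball (\<phi> z) ((1 - norm (\<phi> z)) / 4)" by (simp add: S_def)
            from local_size_le_test_kernel[OF p q \<gamma> \<phi>z this, of n]
            have "ennreal (local_size n q p (\<phi> z)) \<le> ennreal (C4 * test_kernel \<gamma> n q p \<zeta> (\<phi> z))"
              unfolding C4_def by (rule ennreal_leI)
            also have "\<dots> = ennreal C4 * ennreal (test_kernel \<gamma> n q p \<zeta> (\<phi> z))"
              using C14 by (intro ennreal_mult test_kernel_nonneg)
            finally have "m z * ennreal (local_size n q p (\<phi> z)) * indicator {z. 1 - norm (\<phi> z) < \<epsilon>} z
               \<le> m z * (ennreal C4 * ennreal (test_kernel \<gamma> n q p \<zeta> (\<phi> z))) * 1"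
              by (intro mult_mono) (auto simp: indicator_def)
            then show ?thesis using inS by (simp add: V_def mult_ac)
          qed simp
        qed
        also have "\<dots> = ennreal C4 * (\<integral>\<^sup>+z. m z * ennreal (test_kernel \<gamma> n q p \<zeta> (\<phi> z)) \<partial>dA)"
          using measurable_compose[OF \<phi> test_kernel_measurable] by (intro nn_integral_cmult) measurable
        also have "\<dots> \<le> ennreal C4 * ennreal A" using hyp \<zeta>D True by (intro mult_left_mono) auto
        finally show ?thesis using C14 A by (simp add: ennreal_mult)
      next
        case False
        have "V z * indicator S (z, \<zeta>) = 0" if "z \<in> space dA" for z
        proof (rule ccontr)
          assume nz: "V z * indicator S (z, \<zeta>) \<noteq> 0"
          have \<phi>z: "\<phi> z \<in> unit_disc" using \<phi>D that by auto
          have "\<zeta> \<in> cball (\<phi> z) ((1 - norm (\<phi> z)) / 4)" "1 - norm (\<phi> z) < \<epsilon>"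
            using nz by (auto simp: V_def S_def indicator_def split: if_splits)
          with near_point(3)[OF \<phi>z this(1)] False show False by argo
        qed
        then have "(\<integral>\<^sup>+z. V z * indicator S (z, \<zeta>) \<partial>dA) = (\<integral>\<^sup>+z. 0 \<partial>dA)" by (intro nn_integral_cong)
        then show ?thesis by simp
      qed
      then have "G \<zeta> * (\<integral>\<^sup>+z. V z * indicator S (z, \<zeta>) \<partial>dA) \<le> G \<zeta> * ennreal (C4 * A)" by (rule mult_left_mono) simp
      moreover have "(\<integral>\<^sup>+z. V z * (G \<zeta> * indicator S (z, \<zeta>)) \<partial>dA) = G \<zeta> * (\<integral>\<^sup>+z. V z * indicator S (z, \<zeta>) \<partial>dA)"
      proof -
        have "(\<lambda>z. indicator {w. dist w \<zeta> \<le> (1 - norm w) / 4} (\<phi> z) :: ennreal) \<in> borel_measurable dA"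
          by (rule measurable_compose[OF \<phi>]) measurable
        then have "(\<lambda>z. indicator S (z, \<zeta>) :: ennreal) \<in> borel_measurable dA"
          by (simp add: S_def indicator_def)
        then have "(\<integral>\<^sup>+z. G \<zeta> * (V z * indicator S (z, \<zeta>)) \<partial>dA) = G \<zeta> * (\<integral>\<^sup>+z. V z * indicator S (z, \<zeta>) \<partial>dA)"
          by (intro nn_integral_cmult borel_measurable_times_ennreal V)
        then show ?thesis by (simp add: mult_ac)
      qed
      ultimately show "(\<integral>\<^sup>+z. V z * (G \<zeta> * indicator S (z, \<zeta>)) \<partial>dA) \<le> G \<zeta> * ennreal (C4 * A)" by simp
    qed
    also have "\<dots> = (\<integral>\<^sup>+z. G z \<partial>dA) * ennreal (C4 * A)" by (intro nn_integral_multc) measurable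
    also have "\<dots> \<le> ennreal x * ennreal (C4 * A)" using Gx by (intro mult_right_mono) auto
    finally have "(\<integral>\<^sup>+z. m z * ennreal (norm ((deriv ^^ n) f (\<phi> z)) powr q) * indicator {z. 1 - norm (\<phi> z) < \<epsilon>} z \<partial>dA)
       \<le> ennreal (C1 * x powr (q / p - 1)) * (ennreal x * ennreal (C4 * A))"
      by (simp add: mult_left_mono)
    also have "\<dots> = ennreal (C1 * x powr (q / p - 1) * (x * (C4 * A)))"
      using C14 A x0 by (simp add: ennreal_mult)
    also have "C1 * x powr (q / p - 1) * (x * (C4 * A)) = C1 * C4 * C2 powr (q / p) * A * B powr (q / p)"
    proof -
      have "x powr (q / p - 1) * x = x powr (q / p)"
        using x0 by (cases "x = 0") (auto simp: powr_diff)
      also have "\<dots> = C2 powr (q / p) * B powr (q / p)" using C2(1) B by (simp add: x_def powr_mult)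
      finally have e: "x powr (q / p - 1) * x = C2 powr (q / p) * B powr (q / p)" .
      have "C1 * x powr (q / p - 1) * (x * (C4 * A)) = C1 * C4 * A * (x powr (q / p - 1) * x)" by (simp only: mult_ac)
      then show ?thesis unfolding e by (simp only: mult_ac)
    qed
    finally show "(\<integral>\<^sup>+z. m z * ennreal (norm ((deriv ^^ n) f (\<phi> z)) powr q) * indicator {z. 1 - norm (\<phi> z) < \<epsilon>} z \<partial>dA)
       \<le> ennreal (C1 * C4 * C2 powr (q / p) * A * B powr (q / p))" .
  qed
qed

end

section \<open>Test functions\<close>

definition test_fun :: "nat \<Rightarrow> complex \<Rightarrow> complex \<Rightarrow> complex" where
  "test_fun g a z = (of_real (1 - norm a) / (1 - cnj a * z)) ^ g"

lemma one_minus_cnj_mult_nonzero: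
  assumes "a \<in> unit_disc" "z \<in> unit_disc" shows "1 - cnj a * z \<noteq> 0"
  using norm_one_minus_cnj_mult_ge(1)[OF assms] assms(1) by auto

lemma test_fun_holomorphic:
  assumes "a \<in> unit_disc" shows "test_fun g a holomorphic_on unit_disc"
  unfolding test_fun_def using one_minus_cnj_mult_nonzero[OF assms]
  by (intro holomorphic_intros) auto

lemma higher_deriv_test_fun:
  assumes a: "a \<in> unit_disc" and "w \<in> unit_disc"
  shows "(deriv ^^ n) (test_fun g a) w
     = of_real (1 - norm a) ^ g * pochhammer (of_nat g) n * cnj a ^ n / (1 - cnj a * w) ^ (g + n)"
  using assms(2)
proof (induction n arbitrary: w)
  case 0
  then show ?case by (simp add: test_fun_def power_divide)
next
  case (Suc n)
  define c where "c = of_real (1 - norm a) ^ g * pochhammer (of_nat g) n * cnj a ^ n"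
  have nz: "1 - cnj a * w \<noteq> 0" by (rule one_minus_cnj_mult_nonzero[OF a Suc.prems])
  define h where "h z = c * inverse ((1 - cnj a * z) ^ (g + n))" for z
  have "((\<lambda>z. inverse ((1 - cnj a * z) ^ (g + n))) has_field_derivative
      of_nat (g + n) * cnj a / (1 - cnj a * w) ^ Suc (g + n)) (at w)"
  proof -
    define k where "k = g + n"
    define X where "X = 1 - cnj a * w"
    have X: "X \<noteq> 0" using nz by (simp add: X_def)
    have "((\<lambda>z. (1 - cnj a * z) ^ k) has_field_derivative of_nat k * X ^ (k - 1) * (- cnj a)) (at w)"
      unfolding X_def by (auto intro!: derivative_eq_intros)
    then have "((\<lambda>z. inverse ((1 - cnj a * z) ^ k)) has_field_derivative
        - ((of_nat k * X ^ (k - 1) * (- cnj a)) * inverse ((X ^ k) ^ Suc (Suc 0)))) (at w)"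
      unfolding X_def using nz by (intro DERIV_inverse_fun) auto
    moreover have "- ((of_nat k * X ^ (k - 1) * (- cnj a)) * inverse ((X ^ k) ^ Suc (Suc 0))) = of_nat k * cnj a / X ^ Suc k"
      using X by (cases k) (simp_all add: field_simps)
    ultimately show ?thesis by (simp add: k_def X_def)
  qed
  then have "(h has_field_derivative c * (of_nat (g + n) * cnj a / (1 - cnj a * w) ^ Suc (g + n))) (at w)"
    unfolding h_def by (rule DERIV_cmult)
  then have "((deriv ^^ n) (test_fun g a) has_field_derivative c * (of_nat (g + n) * cnj a / (1 - cnj a * w) ^ Suc (g + n))) (at w)"
  proof (rule has_field_derivative_transform_within_open)
    show "h x = (deriv ^^ n) (test_fun g a) x" if "x \<in> unit_disc" for x
      using Suc.IH[OF that] by (simp add: h_def c_def divide_inverse)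
  qed (use Suc.prems in auto)
  then have "(deriv ^^ Suc n) (test_fun g a) w = c * (of_nat (g + n) * cnj a / (1 - cnj a * w) ^ Suc (g + n))"
    by (simp add: DERIV_imp_deriv)
  also have "\<dots> = of_real (1 - norm a) ^ g * pochhammer (of_nat g) (Suc n) * cnj a ^ Suc n / (1 - cnj a * w) ^ (g + Suc n)"
    by (simp add: c_def pochhammer_Suc)
  finally show ?case .
qed

lemma pochhammer_of_nat_nonneg: "0 \<le> pochhammer (real g) n"
  unfolding pochhammer_prod by (intro prod_nonneg) auto

lemma norm_higher_deriv_test_fun:
  assumes a: "a \<in> unit_disc" and w: "w \<in> unit_disc"
  shows "norm ((deriv ^^ n) (test_fun g a) w)
     = pochhammer (real g) n * norm a ^ n * ((1 - norm a) ^ g / norm (1 - cnj a * w) ^ (g + n))"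
proof -
  have "norm (pochhammer (of_nat g) n :: complex) = pochhammer (real g) n"
  proof -
    have "(pochhammer (of_nat g) n :: complex) = of_real (pochhammer (real g) n)"
      by (simp add: pochhammer_of_real[symmetric])
    moreover have "0 \<le> pochhammer (real g) n" by (rule pochhammer_of_nat_nonneg)
    ultimately show ?thesis by simp
  qed
  moreover have "norm (of_real (1 - norm a) :: complex) = 1 - norm a"
    using a by (metis abs_of_nonneg diff_ge_0_iff_ge less_imp_le mem_ball_0 norm_of_real)
  ultimately show ?thesis
    unfolding higher_deriv_test_fun[OF assms] by (simp add: norm_mult norm_divide norm_power del: of_real_diff)
qed

context doubling_measure
begin

lemma test_kernel_bounded:
  assumes p: "0 < p" and q: "0 < q" and \<gamma>: "0 < \<gamma>" and r: "r < 1"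
  shows "\<exists>K\<ge>0. \<forall>a\<in>unit_disc. \<forall>w\<in>unit_disc. norm a \<le> r \<longrightarrow> test_kernel \<gamma> n q p a w \<le> K"
proof -
  define \<alpha> where "\<alpha> = (\<gamma> + real n) * q"
  have \<alpha>: "0 < \<alpha>" using \<gamma> q by (simp add: \<alpha>_def)
  define s where "s = (1 - r) * tail M r / 14"
  have s: "0 < s" using r tail_pos[OF r] by (simp add: s_def)
  show ?thesis
  proof (intro exI[of _ "1 / (1 - r) powr \<alpha> / s powr (q / p)"] conjI ballI impI)
    fix a w :: complex assume a: "a \<in> unit_disc" and w: "w \<in> unit_disc" and ar: "norm a \<le> r"
    have "1 - r \<le> norm (1 - cnj a * w)" using norm_one_minus_cnj_mult_ge(1)[OF a w] ar by simp
    then have 1: "(1 - r) powr \<alpha> \<le> norm (1 - cnj a * w) powr \<alpha>" using r \<alpha> by (intro powr_mono2) auto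
    have "(1 - r) * tail M r \<le> (1 - norm a) * tail M (norm a)"
      using r ar a tail_anti[OF ar] tail_nonneg by (intro mult_mono) auto
    then have "s \<le> carleson_mass a" using carleson_mass_lower[OF a] by (simp add: s_def)
    then have 2: "s powr (q / p) \<le> carleson_mass a powr (q / p)" using s p q by (intro powr_mono2) auto
    have 3: "(1 - norm a) powr (\<gamma> * q) \<le> 1" using a \<gamma> q by (intro powr_le1) auto
    have le1: "(1 - norm a) powr (\<gamma> * q) / norm (1 - cnj a * w) powr \<alpha> \<le> 1 / (1 - r) powr \<alpha>"
      by (rule frac_le) (use 1 3 r in auto)
    have "(1 - norm a) powr (\<gamma> * q) / norm (1 - cnj a * w) powr \<alpha> / carleson_mass a powr (q / p) \<le> 1 / (1 - r) powr \<alpha> / s powr (q / p)"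
      by (rule frac_le) (use le1 2 s r in auto)
    then show "test_kernel \<gamma> n q p a w \<le> 1 / (1 - r) powr \<alpha> / s powr (q / p)"
      by (simp add: test_kernel_def \<alpha>_def)
  qed simp
qed

lemma test_fun_norm_le:
  assumes g: "4 * doubling_const \<le> 2 powr (real g * p)" and a: "a \<in> unit_disc"
  shows "(\<integral>\<^sup>+z. ennreal (norm (test_fun g a z) powr p) \<partial>M) \<le> ennreal (448 * doubling_const * carleson_mass a)"
proof -
  define h where "h = 1 - norm a"
  have h: "0 < h" using a by (simp add: h_def)
  have ker: "(\<lambda>z. ennreal (norm (1 - cnj a * z) powr (- (real g * p)))) \<in> borel_measurable M"
    by (rule measurable_M_of_borel) measurable
  have "(\<integral>\<^sup>+z. ennreal (norm (test_fun g a z) powr p) \<partial>M)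
      = (\<integral>\<^sup>+z. ennreal (h powr (real g * p)) * ennreal (norm (1 - cnj a * z) powr (- (real g * p))) \<partial>M)"
  proof (rule nn_integral_cong)
    fix z assume "z \<in> space M"
    then have nz: "norm (1 - cnj a * z) > 0" using one_minus_cnj_mult_nonzero[OF a, of z] by simp
    have "norm (test_fun g a z) = (h / norm (1 - cnj a * z)) ^ g"
      using h by (simp add: test_fun_def norm_power norm_divide h_def del: of_real_diff)
    then have "norm (test_fun g a z) powr p = (h / norm (1 - cnj a * z)) powr (real g * p)"
      using nz h by (simp add: powr_realpow[symmetric] powr_powr)
    also have "\<dots> = h powr (real g * p) * norm (1 - cnj a * z) powr (- (real g * p))"
      using nz h by (simp add: powr_divide powr_minus_divide)
    finally show "ennreal (norm (test_fun g a z) powr p) = ennreal (h powr (real g * p)) * ennreal (norm (1 - cnj a * z) powr (- (real g * p)))"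
      by (simp add: ennreal_mult)
  qed
  also have "\<dots> = ennreal (h powr (real g * p)) * (\<integral>\<^sup>+z. ennreal (norm (1 - cnj a * z) powr (- (real g * p))) \<partial>M)"
    using ker by (rule nn_integral_cmult)
  also have "\<dots> \<le> ennreal (h powr (real g * p)) * ennreal (32 * doubling_const * h powr (1 - real g * p) * tail M (norm a))"
    using kernel_integral[OF g a] by (intro mult_left_mono) (auto simp: h_def)
  also have "\<dots> = ennreal (h powr (real g * p) * (32 * doubling_const * h powr (1 - real g * p) * tail M (norm a)))"
    using doubling_const(1) tail_nonneg by (intro ennreal_mult[symmetric]) auto
  also have "h powr (real g * p) * (32 * doubling_const * h powr (1 - real g * p) * tail M (norm a)) = 32 * doubling_const * (h * tail M (norm a))"
    using h by (simp add: powr_diff)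
  also have "\<dots> \<le> 32 * doubling_const * (14 * carleson_mass a)"
    using carleson_mass_lower[OF a] doubling_const(1) by (intro mult_left_mono) (auto simp: h_def)
  finally show ?thesis by (simp add: ennreal_leI mult.assoc)
qed

text \<open>
  Apply \<open>kernel_integral\<close> with the smaller exponent \<open>s - 1\<close>. Its left side is bounded
  below because \<open>|1 - cnj a z| \<le> 2\<close>, and the gain of one power of \<open>1 - |a|\<close> over the bound needed for
  \<open>test_fun_norm_le\<close> makes the normalised test functions tend to \<open>0\<close>.
\<close>

lemma test_fun_decay:
  assumes s: "4 * doubling_const \<le> 2 powr (s - 1)"
  shows "\<exists>C\<ge>0. \<forall>a\<in>unit_disc. (1 - norm a) powr s \<le> C * (1 - norm a) * carleson_mass a"
proof -
  have s1: "0 \<le> s - 1"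
  proof (rule ccontr)
    assume "\<not> 0 \<le> s - 1"
    then have "2 powr (s - 1) \<le> 2 powr 0" by (intro powr_mono) auto
    with s doubling_const(1) show False by simp
  qed
  define c where "c = 2 powr (- (s - 1)) * tail M 0"
  have c: "0 < c" using tail_0 by (simp add: c_def)
  show ?thesis
  proof (intro exI[of _ "448 * doubling_const / c"] conjI ballI)
    show "0 \<le> 448 * doubling_const / c" using c doubling_const(1) by simp
    fix a :: complex assume a: "a \<in> unit_disc"
    define h where "h = 1 - norm a"
    have h: "0 < h" using a by (simp add: h_def)
    have D: "unit_disc \<in> sets M" using sets.top[of M] by simp
    have "ennreal c \<le> ennreal (2 powr (- (s - 1))) * emeasure M unit_disc"
    proof -
      have "tail M 0 \<le> measure M unit_disc"
        unfolding tail_def by (intro finite_measure.finite_measure_mono[OF finite_measure_M] D) auto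
      then have "ennreal c \<le> ennreal (2 powr (- (s - 1)) * measure M unit_disc)"
        unfolding c_def by (intro ennreal_leI mult_left_mono) auto
      then show ?thesis by (simp add: emeasure_M_eq ennreal_mult)
    qed
    also have "\<dots> = (\<integral>\<^sup>+z. ennreal (2 powr (- (s - 1))) * indicator unit_disc z \<partial>M)"
      using D by (simp add: nn_integral_cmult)
    also have "\<dots> \<le> (\<integral>\<^sup>+z. ennreal (norm (1 - cnj a * z) powr (- (s - 1))) \<partial>M)"
    proof (rule nn_integral_mono)
      fix z assume "z \<in> space M"
      then have z: "z \<in> unit_disc" by simp
      have "norm (cnj a * z) \<le> 1 * 1" unfolding norm_mult using a z by (intro mult_mono) auto
      then have "norm (1 - cnj a * z) \<le> 2" using norm_triangle_ineq4[of 1 "cnj a * z"] by simp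
      then have "2 powr (- (s - 1)) \<le> norm (1 - cnj a * z) powr (- (s - 1))"
        using one_minus_cnj_mult_nonzero[OF a z] s1 by (intro powr_mono2') auto
      then show "ennreal (2 powr (- (s - 1))) * indicator unit_disc z \<le> ennreal (norm (1 - cnj a * z) powr (- (s - 1)))"
        using z by (simp add: ennreal_leI)
    qed
    also have "\<dots> \<le> ennreal (32 * doubling_const * h powr (1 - (s - 1)) * tail M (norm a))"
      using kernel_integral[OF s a] by (simp add: h_def)
    finally have "c \<le> 32 * doubling_const * h powr (1 - (s - 1)) * tail M (norm a)"
      using doubling_const(1) tail_nonneg by (subst (asm) ennreal_le_iff) auto
    then have "h powr s * c \<le> h powr s * (32 * doubling_const * h powr (1 - (s - 1)) * tail M (norm a))"
      by (intro mult_left_mono) auto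
    also have "\<dots> = 32 * doubling_const * h * (h * tail M (norm a))"
    proof -
      have "h powr s * h powr (1 - (s - 1)) = h powr 2" by (simp add: powr_add[symmetric])
      also have "\<dots> = h * h" using h by (simp add: power2_eq_square)
      finally have "h powr s * h powr (1 - (s - 1)) = h * h" .
      moreover have "h powr s * (32 * doubling_const * h powr (1 - (s - 1)) * tail M (norm a)) = 32 * doubling_const * (h powr s * h powr (1 - (s - 1))) * tail M (norm a)"
        by (simp only: mult_ac)
      ultimately show ?thesis by (simp only: mult.assoc)
    qed
    also have "\<dots> \<le> 32 * doubling_const * h * (14 * carleson_mass a)"
      using carleson_mass_lower[OF a] h doubling_const(1) by (intro mult_left_mono) (auto simp: h_def)
    finally have "h powr s \<le> 448 * doubling_const * h * carleson_mass a / c" using c by (simp add: pos_le_divide_eq)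
    then show "(1 - norm a) powr s \<le> 448 * doubling_const / c * (1 - norm a) * carleson_mass a" by (simp add: h_def)
  qed
qed

lemma test_fun_deriv_powr:
  assumes p: "0 < p" and q: "0 < q" and a: "a \<in> unit_disc" and w: "w \<in> unit_disc"
  shows "norm ((deriv ^^ n) (test_fun g a) w) powr q
     = (pochhammer (real g) n * norm a ^ n) powr q * carleson_mass a powr (q / p) * test_kernel (real g) n q p a w"
proof -
  have s: "0 < carleson_mass a" by (rule carleson_mass_pos[OF a])
  have nz: "0 < norm (1 - cnj a * w)" using one_minus_cnj_mult_nonzero[OF a w] by simp
  have h: "0 < 1 - norm a" using a by simp
  have P: "0 \<le> pochhammer (real g) n * norm a ^ n" by (intro mult_nonneg_nonneg pochhammer_of_nat_nonneg) auto
  have "((1 - norm a) ^ g / norm (1 - cnj a * w) ^ (g + n)) powr q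
      = (1 - norm a) powr (real g * q) / norm (1 - cnj a * w) powr ((real g + real n) * q)"
    using h nz by (simp add: powr_divide powr_realpow[symmetric] powr_powr)
  then show ?thesis
    unfolding norm_higher_deriv_test_fun[OF a w] test_kernel_def
    using P s h nz by (subst powr_mult) auto
qed

end

section \<open>Testing conditions for the embedding\<close>

text \<open>
  Here \<open>m\<close> stands for \<open>|u|^q \<nu>\<close>; the embedding depends on \<open>u\<close> and \<open>\<nu>\<close> only through it. The
  exponent in the hypothesis on \<open>g\<close> is \<open>g p - 1\<close> instead of \<open>g p\<close> so that \<open>test_fun_decay\<close> applies.
\<close>

locale carleson_setting = doubling_measure +
  fixes p q :: real and g n :: nat and m :: "complex \<Rightarrow> ennreal" and \<phi> :: "complex \<Rightarrow> complex"
  assumes p: "0 < p" and pq: "p \<le> q" and g: "4 * doubling_const \<le> 2 powr (real g * p - 1)"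
    and m [measurable]: "m \<in> borel_measurable dA" and m_finite: "(\<integral>\<^sup>+z. m z \<partial>dA) < top"
    and \<phi>: "analytic_self_map \<phi>"
begin

lemma q: "0 < q" using p pq by simp

lemma g_pos: "0 < real g"
proof (rule ccontr)
  assume "\<not> 0 < real g"
  then have "2 powr (real g * p - 1) \<le> 2 powr (0::real)" by (intro powr_mono) auto
  with g doubling_const(1) show False by simp
qed

lemma g': "4 * doubling_const \<le> 2 powr (real g * p)"
proof -
  have "2 powr (real g * p - 1) \<le> 2 powr (real g * p)" by (intro powr_mono) auto
  with g show ?thesis by linarith
qed

lemma \<phi>_disc: "z \<in> unit_disc \<Longrightarrow> \<phi> z \<in> unit_disc"
  using \<phi> unfolding analytic_self_map_def by blast

lemma \<phi>_measurable [measurable]: "\<phi> \<in> borel_measurable dA"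
  using \<phi> radial_measure.holomorphic_measurable_M[OF radial_measure_dA]
  unfolding analytic_self_map_def by blast

definition testing_integral :: "complex \<Rightarrow> ennreal" where
  "testing_integral a = (\<integral>\<^sup>+z. m z * ennreal (test_kernel (real g) n q p a (\<phi> z)) \<partial>dA)"

text \<open>
  The \<open>q\<close>-th power of the norm of the image of \<open>f\<close>. Without the root it makes sense as a
  possibly infinite integral, for all functions alike.
\<close>

definition target_size :: "(complex \<Rightarrow> complex) \<Rightarrow> ennreal" where
  "target_size f = (\<integral>\<^sup>+z. m z * ennreal (norm ((deriv ^^ n) f (\<phi> z)) powr q) \<partial>dA)"

definition source_size :: "(complex \<Rightarrow> complex) \<Rightarrow> ennreal" where
  "source_size f = (\<integral>\<^sup>+z. ennreal (norm (f z) powr p) \<partial>M)"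

lemma higher_deriv_phi_measurable:
  assumes "f holomorphic_on unit_disc"
  shows "(\<lambda>z. (deriv ^^ n) f (\<phi> z)) \<in> borel_measurable dA"
proof -
  have "(deriv ^^ n) f holomorphic_on unit_disc"
    using assms by (rule holomorphic_higher_deriv) simp
  then have "((deriv ^^ n) f \<circ> \<phi>) holomorphic_on unit_disc"
    using \<phi> unfolding analytic_self_map_def
    by (intro holomorphic_on_compose_gen[where t = unit_disc]) auto
  then show ?thesis
    using radial_measure.holomorphic_measurable_M[OF radial_measure_dA] by (simp add: o_def)
qed

text \<open>
  For \<open>|a| \<le> r < 1\<close> the test kernel is bounded, and \<open>m\<close> has finite integral because \<open>u\<close> belongs to the
  target space.
\<close>

lemma testing_integral_bounded_inside:
  assumes "r < 1"
  shows "\<exists>K\<ge>0. \<forall>a\<in>unit_disc. norm a \<le> r \<longrightarrow> testing_integral a \<le> ennreal K"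
proof -
  obtain K where K: "0 \<le> K" "\<And>a w. a \<in> unit_disc \<Longrightarrow> w \<in> unit_disc \<Longrightarrow> norm a \<le> r \<Longrightarrow> test_kernel (real g) n q p a w \<le> K"
    using test_kernel_bounded[OF p q g_pos assms, of n] by blast
  obtain m0 where m0: "(\<integral>\<^sup>+z. m z \<partial>dA) = ennreal m0" "0 \<le> m0"
    using m_finite by (cases "\<integral>\<^sup>+z. m z \<partial>dA") auto
  have "testing_integral a \<le> ennreal (m0 * K)" if a: "a \<in> unit_disc" "norm a \<le> r" for a
  proof -
    have "testing_integral a \<le> (\<integral>\<^sup>+z. m z * ennreal K \<partial>dA)"
      unfolding testing_integral_def using K a \<phi>_disc by (intro nn_integral_mono mult_left_mono ennreal_leI) auto
    also have "\<dots> = ennreal (m0 * K)" using m0 K by (simp add: nn_integral_multc ennreal_mult)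
    finally show ?thesis .
  qed
  then show ?thesis using m0 K by (intro exI[of _ "m0 * K"]) auto
qed

lemma target_size_test_fun:
  assumes a: "a \<in> unit_disc"
  shows "target_size (test_fun g a) = ennreal ((pochhammer (real g) n * norm a ^ n) powr q * carleson_mass a powr (q / p)) * testing_integral a"
proof -
  have "target_size (test_fun g a) = (\<integral>\<^sup>+z. ennreal ((pochhammer (real g) n * norm a ^ n) powr q * carleson_mass a powr (q / p)) *
      (m z * ennreal (test_kernel (real g) n q p a (\<phi> z))) \<partial>dA)"
    unfolding target_size_def
  proof (rule nn_integral_cong)
    fix z assume "z \<in> space dA"
    then have "\<phi> z \<in> unit_disc" using \<phi>_disc by simp
    from test_fun_deriv_powr[OF p q a this, of n g]
    show "m z * ennreal (norm ((deriv ^^ n) (test_fun g a) (\<phi> z)) powr q)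
        = ennreal ((pochhammer (real g) n * norm a ^ n) powr q * carleson_mass a powr (q / p)) * (m z * ennreal (test_kernel (real g) n q p a (\<phi> z)))"
      by (simp add: ennreal_mult test_kernel_nonneg mult_ac)
  qed
  also have "\<dots> = ennreal ((pochhammer (real g) n * norm a ^ n) powr q * carleson_mass a powr (q / p)) * testing_integral a"
    unfolding testing_integral_def using measurable_compose[OF \<phi>_measurable test_kernel_measurable]
    by (intro nn_integral_cmult) measurable
  finally show ?thesis .
qed

lemma embedding_near_boundary:
  "\<exists>C\<ge>0. \<forall>f A B \<epsilon>. f holomorphic_on unit_disc \<longrightarrow> 0 \<le> A \<longrightarrow> 0 \<le> B \<longrightarrow>
     (\<forall>a\<in>unit_disc. 1 - norm a < 5 / 4 * \<epsilon> \<longrightarrow> testing_integral a \<le> ennreal A) \<longrightarrow> source_size f \<le> ennreal B \<longrightarrow>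
     (\<integral>\<^sup>+z. m z * ennreal (norm ((deriv ^^ n) f (\<phi> z)) powr q) * indicator {z. 1 - norm (\<phi> z) < \<epsilon>} z \<partial>dA)
       \<le> ennreal (C * A * B powr (q / p))"
proof -
  have "\<phi> \<in> unit_disc \<rightarrow> unit_disc" using \<phi>_disc by auto
  then show ?thesis
    using carleson_embedding[OF p pq g_pos, of n] m \<phi>_measurable
    unfolding testing_integral_def source_size_def by blast
qed

lemma bounded_sufficient:
  assumes A: "0 \<le> A" and testing_integral: "\<And>a. a \<in> unit_disc \<Longrightarrow> testing_integral a \<le> ennreal A"
  shows "\<exists>C\<ge>0. \<forall>f B. f holomorphic_on unit_disc \<longrightarrow> 0 \<le> B \<longrightarrow> source_size f \<le> ennreal B \<longrightarrow> target_size f \<le> ennreal (C * B powr (q / p))"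
proof -
  obtain C where C: "0 \<le> C" "\<And>f A B \<epsilon>. f holomorphic_on unit_disc \<Longrightarrow> 0 \<le> A \<Longrightarrow> 0 \<le> B \<Longrightarrow>
     (\<forall>a\<in>unit_disc. 1 - norm a < 5 / 4 * \<epsilon> \<longrightarrow> testing_integral a \<le> ennreal A) \<Longrightarrow> source_size f \<le> ennreal B \<Longrightarrow>
     (\<integral>\<^sup>+z. m z * ennreal (norm ((deriv ^^ n) f (\<phi> z)) powr q) * indicator {z. 1 - norm (\<phi> z) < \<epsilon>} z \<partial>dA)
       \<le> ennreal (C * A * B powr (q / p))"
    using embedding_near_boundary by blast
  show ?thesis
  proof (intro exI[of _ "C * A"] conjI allI impI)
    show "0 \<le> C * A" using C A by simp
    fix f B assume f: "f holomorphic_on unit_disc" and B: "0 \<le> B" and s: "source_size f \<le> ennreal B"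
    have "target_size f = (\<integral>\<^sup>+z. m z * ennreal (norm ((deriv ^^ n) f (\<phi> z)) powr q) * indicator {z. 1 - norm (\<phi> z) < 2} z \<partial>dA)"
      unfolding target_size_def
    proof (intro nn_integral_cong)
      fix z
      have "1 - norm (\<phi> z) < 2" using norm_ge_zero[of "\<phi> z"] by linarith
      then show "m z * ennreal (norm ((deriv ^^ n) f (\<phi> z)) powr q)
        = m z * ennreal (norm ((deriv ^^ n) f (\<phi> z)) powr q) * indicator {z. 1 - norm (\<phi> z) < 2} z" by simp
    qed
    also have "\<dots> \<le> ennreal (C * A * B powr (q / p))"
      using testing_integral by (intro C f A B s) auto
    finally show "target_size f \<le> ennreal (C * A * B powr (q / p))" .
  qed
qed

lemma testing_integral_le_of_target_size:
  assumes a: "a \<in> unit_disc" "1 / 2 \<le> norm a" and C: "0 \<le> C"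
    and le: "target_size (test_fun g a) \<le> ennreal (C * carleson_mass a powr (q / p))"
  shows "testing_integral a \<le> ennreal (C / (pochhammer (real g) n * (1 / 2) ^ n) powr q)"
proof -
  define P where "P = (pochhammer (real g) n * (1 / 2) ^ n) powr q"
  have poch: "0 < pochhammer (real g) n" by (rule pochhammer_pos) (rule g_pos)
  have P: "0 < P" using poch by (simp add: P_def)
  have s: "0 < carleson_mass a powr (q / p)" using carleson_mass_pos[OF a(1)] by simp
  have PP: "P \<le> (pochhammer (real g) n * norm a ^ n) powr q"
    unfolding P_def using poch a(2) q by (intro powr_mono2 mult_left_mono power_mono) auto
  have "ennreal (P * carleson_mass a powr (q / p)) * testing_integral a
      \<le> ennreal ((pochhammer (real g) n * norm a ^ n) powr q * carleson_mass a powr (q / p)) * testing_integral a"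
    using PP by (intro mult_right_mono ennreal_leI) auto
  also have "\<dots> \<le> ennreal (C * carleson_mass a powr (q / p))"
    using le unfolding target_size_test_fun[OF a(1)] .
  finally have 1: "ennreal (P * carleson_mass a powr (q / p)) * testing_integral a \<le> ennreal (C * carleson_mass a powr (q / p))" .
  have "testing_integral a \<noteq> top"
  proof
    assume "testing_integral a = top"
    then have "ennreal (P * carleson_mass a powr (q / p)) * testing_integral a = top" using P s by (simp add: ennreal_mult_top)
    with 1 show False by (simp add: top_unique)
  qed
  then obtain x where x: "testing_integral a = ennreal x" "0 \<le> x" by (cases "testing_integral a") auto
  have "ennreal (P * carleson_mass a powr (q / p) * x) \<le> ennreal (C * carleson_mass a powr (q / p))"
    using 1 P s x by (simp add: ennreal_mult)
  then have "P * carleson_mass a powr (q / p) * x \<le> C * carleson_mass a powr (q / p)"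
    using C by (subst (asm) ennreal_le_iff) auto
  then have "(P * x) * carleson_mass a powr (q / p) \<le> C * carleson_mass a powr (q / p)" by (simp add: mult_ac)
  then have "P * x \<le> C" using s by (simp only: mult_le_cancel_right_pos)
  then have "x \<le> C / P" using P by (simp add: pos_le_divide_eq mult.commute)
  then show ?thesis unfolding x(1) P_def by (rule ennreal_leI)
qed

text \<open>
  Test functions with \<open>|a| \<ge> 1/2\<close> suffice away from the origin, where the factor \<open>|a|^n\<close> from the
  derivatives is harmless; the other parameters are covered by \<open>testing_integral_bounded_inside\<close>.
\<close>

lemma bounded_necessary:
  assumes C: "0 \<le> C" and bd: "\<And>f B. f holomorphic_on unit_disc \<Longrightarrow> 0 \<le> B \<Longrightarrow> source_size f \<le> ennreal B \<Longrightarrow> target_size f \<le> ennreal (C * B powr (q / p))"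
  shows "\<exists>A\<ge>0. \<forall>a\<in>unit_disc. testing_integral a \<le> ennreal A"
proof -
  obtain K where K: "0 \<le> K" "\<And>a. a \<in> unit_disc \<Longrightarrow> norm a \<le> 1 / 2 \<Longrightarrow> testing_integral a \<le> ennreal K"
    using testing_integral_bounded_inside[of "1 / 2"] by auto
  define K' where "K' = C * (448 * doubling_const) powr (q / p) / (pochhammer (real g) n * (1 / 2) ^ n) powr q"
  have K': "0 \<le> K'" using C by (simp add: K'_def)
  have out: "testing_integral a \<le> ennreal K'" if a: "a \<in> unit_disc" "1 / 2 \<le> norm a" for a
    unfolding K'_def
  proof (rule testing_integral_le_of_target_size[OF a])
    show "0 \<le> C * (448 * doubling_const) powr (q / p)" using C by simp
    have s: "0 < carleson_mass a" by (rule carleson_mass_pos[OF a(1)])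
    have "target_size (test_fun g a) \<le> ennreal (C * (448 * doubling_const * carleson_mass a) powr (q / p))"
      using doubling_const(1) s test_fun_norm_le[OF g' a(1)]
      by (intro bd test_fun_holomorphic a) (auto simp: source_size_def)
    also have "C * (448 * doubling_const * carleson_mass a) powr (q / p) = C * (448 * doubling_const) powr (q / p) * carleson_mass a powr (q / p)"
      using doubling_const(1) s by (simp add: powr_mult)
    finally show "target_size (test_fun g a) \<le> ennreal (C * (448 * doubling_const) powr (q / p) * carleson_mass a powr (q / p))" .
  qed
  show ?thesis
  proof (intro exI[of _ "max K K'"] conjI ballI)
    fix a assume a: "a \<in> unit_disc"
    show "testing_integral a \<le> ennreal (max K K')"
    proof (cases "norm a \<le> 1 / 2")
      case True
      have "testing_integral a \<le> ennreal K" by (rule K(2)[OF a True])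
      also have "\<dots> \<le> ennreal (max K K')" by (intro ennreal_leI) simp
      finally show ?thesis .
    next
      case False
      have "testing_integral a \<le> ennreal K'" using False by (intro out a) simp
      also have "\<dots> \<le> ennreal (max K K')" by (intro ennreal_leI) simp
      finally show ?thesis .
    qed
  qed (use K in auto)
qed

text \<open>
  The hypothesis of Montel's theorem for bounded subsets of the source space.
\<close>

lemma locally_bounded:
  assumes r: "r < 1" and B: "0 \<le> B"
  shows "\<exists>b. \<forall>f w. f holomorphic_on unit_disc \<longrightarrow> source_size f \<le> ennreal B \<longrightarrow> w \<in> unit_disc \<longrightarrow> norm w \<le> r \<longrightarrow> norm (f w) \<le> b"
proof -
  obtain C2 where C2: "0 \<le> C2" "\<And>f. f holomorphic_on unit_disc \<Longrightarrow>
     (\<integral>\<^sup>+z. ennreal (norm (f z) powr p) * ennreal (smooth_weight z) \<partial>dA) \<le> ennreal C2 * (\<integral>\<^sup>+z. ennreal (norm (f z) powr p) \<partial>M)"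
    using smooth_weight_norm_le p by blast
  define s where "s = (1 - r) * tail M r"
  have s: "0 < s" using r tail_pos[OF r] by (simp add: s_def)
  have "norm (f w) \<le> (128 * doubling_const * (C2 * B) / s) powr (1 / p)"
    if f: "f holomorphic_on unit_disc" and src: "source_size f \<le> ennreal B" and w: "w \<in> unit_disc" "norm w \<le> r" for f w
  proof -
    have "s \<le> (1 - norm w) * tail M (norm w)"
      unfolding s_def using r w tail_anti[OF w(2)] tail_nonneg by (intro mult_mono) auto
    then have "ennreal (norm (f w) powr p * s) \<le> ennreal (norm (f w) powr p * ((1 - norm w) * tail M (norm w)))"
      by (intro ennreal_leI mult_left_mono) auto
    also have "\<dots> \<le> ennreal (128 * doubling_const) * (\<integral>\<^sup>+z. ennreal (norm (f z) powr p) * ennreal (smooth_weight z) * indicator (cball w ((1 - norm w) / 4)) z \<partial>dA)"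
      using norm_higher_deriv_le_smooth_mean[OF f p w(1), of 0] w by simp
    also have "\<dots> \<le> ennreal (128 * doubling_const) * (\<integral>\<^sup>+z. ennreal (norm (f z) powr p) * ennreal (smooth_weight z) \<partial>dA)"
      by (intro mult_left_mono nn_integral_mono) (auto simp: indicator_def)
    also have "\<dots> \<le> ennreal (128 * doubling_const) * (ennreal C2 * ennreal B)"
    proof (rule mult_left_mono)
      show "(\<integral>\<^sup>+z. ennreal (norm (f z) powr p) * ennreal (smooth_weight z) \<partial>dA) \<le> ennreal C2 * ennreal B"
        using C2(2)[OF f] src unfolding source_size_def by (meson mult_left_mono order_trans zero_le)
    qed simp
    also have "\<dots> = ennreal (128 * doubling_const * (C2 * B))"
      using doubling_const(1) C2(1) B ennreal_mult[of "128 * doubling_const" "C2 * B"] by (simp add: ennreal_mult)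
    finally have "norm (f w) powr p * s \<le> 128 * doubling_const * (C2 * B)"
      using doubling_const(1) C2(1) B by (subst (asm) ennreal_le_iff) auto
    then have "norm (f w) powr p \<le> 128 * doubling_const * (C2 * B) / s" using s by (simp add: pos_le_divide_eq)
    then have "(norm (f w) powr p) powr (1 / p) \<le> (128 * doubling_const * (C2 * B) / s) powr (1 / p)"
      using p by (intro powr_mono2) auto
    then show ?thesis using p by (simp add: powr_powr)
  qed
  then show ?thesis by blast
qed

text \<open>
  Split at \<open>1 - |\<phi>(z)| = \<epsilon>\<close>. Near the circle the local embedding has small norm; elsewhere the
  \<open>n\<close>-th derivatives tend to \<open>0\<close> uniformly by Cauchy's estimate on discs of radius \<open>\<epsilon>/2\<close>.
\<close>

lemma compact_sufficient:
  assumes testing_integral: "\<And>e. 0 < e \<Longrightarrow> \<exists>\<delta>>0. \<forall>a\<in>unit_disc. 1 - norm a < \<delta> \<longrightarrow> testing_integral a \<le> ennreal e"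
    and H: "\<And>k. H k holomorphic_on unit_disc" and src: "\<And>k. source_size (H k) \<le> ennreal B" and B: "0 \<le> B"
    and lim: "\<And>K. compact K \<Longrightarrow> K \<subseteq> unit_disc \<Longrightarrow> uniform_limit K H (\<lambda>_. 0) sequentially"
    and e: "0 < e"
  shows "\<forall>\<^sub>F k in sequentially. target_size (H k) \<le> ennreal e"
proof -
  obtain C where C: "0 \<le> C" "\<And>f A B \<epsilon>. f holomorphic_on unit_disc \<Longrightarrow> 0 \<le> A \<Longrightarrow> 0 \<le> B \<Longrightarrow>
     (\<forall>a\<in>unit_disc. 1 - norm a < 5 / 4 * \<epsilon> \<longrightarrow> testing_integral a \<le> ennreal A) \<Longrightarrow> source_size f \<le> ennreal B \<Longrightarrow>
     (\<integral>\<^sup>+z. m z * ennreal (norm ((deriv ^^ n) f (\<phi> z)) powr q) * indicator {z. 1 - norm (\<phi> z) < \<epsilon>} z \<partial>dA)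
       \<le> ennreal (C * A * B powr (q / p))"
    using embedding_near_boundary by blast
  (* Chosen so that the embedding near the circle contributes at most e / 2. *)
  define A where "A = e / (2 * (C * B powr (q / p) + 1))"
  have CB: "0 \<le> C * B powr (q / p)" using C by simp
  have A: "0 < A" using e CB by (simp add: A_def add_nonneg_pos)
  have CAB: "C * A * B powr (q / p) \<le> e / 2"
  proof -
    have "C * A * B powr (q / p) = (e / 2) * ((C * B powr (q / p)) / (C * B powr (q / p) + 1))"
      by (simp add: A_def)
    also have "\<dots> \<le> (e / 2) * 1" using e CB by (intro mult_left_mono) (auto simp: divide_le_eq)
    finally show ?thesis by simp
  qed
  obtain \<delta> where \<delta>: "\<delta> > 0" "\<And>a. a \<in> unit_disc \<Longrightarrow> 1 - norm a < \<delta> \<Longrightarrow> testing_integral a \<le> ennreal A"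
    using testing_integral[OF A] by blast
  define \<epsilon> where "\<epsilon> = min (4 / 5 * \<delta>) (1 / 2)"
  have \<epsilon>: "0 < \<epsilon>" "\<epsilon> \<le> 1 / 2" "5 / 4 * \<epsilon> \<le> \<delta>" using \<delta>(1) by (auto simp: \<epsilon>_def min_def)
  obtain m0 where m0: "(\<integral>\<^sup>+z. m z \<partial>dA) = ennreal m0" "0 \<le> m0"
    using m_finite by (cases "\<integral>\<^sup>+z. m z \<partial>dA") auto
  define c where "c = fact n * (2 / \<epsilon>) ^ n"
  have c: "0 < c" using \<epsilon> by (simp add: c_def)
  (* A sup-norm bound d on the larger disc gives at most c d for the derivatives, hence at most
     e / 2 for the remaining part. *)
  define d where "d = (e / (2 * (m0 + 1))) powr (1 / q) / c"
  have d: "0 < d" using e m0 c by (simp add: d_def)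
  have cd: "(c * d) powr q * m0 \<le> e / 2"
  proof -
    have "(c * d) powr q = e / (2 * (m0 + 1))" using c e m0 q by (simp add: d_def powr_powr)
    then have "(c * d) powr q * m0 = (e / 2) * (m0 / (m0 + 1))" by simp
    also have "\<dots> \<le> (e / 2) * 1" using e m0 by (intro mult_left_mono) (auto simp: divide_le_eq)
    finally show ?thesis by simp
  qed
  have "compact (cball (0::complex) (1 - \<epsilon> / 2))" "cball (0::complex) (1 - \<epsilon> / 2) \<subseteq> unit_disc" using \<epsilon> by auto
  then have "\<forall>\<^sub>F k in sequentially. \<forall>x\<in>cball 0 (1 - \<epsilon> / 2). dist (H k x) 0 < d"
    using lim d by (auto simp: uniform_limit_iff)
  then show ?thesis
  proof eventually_elim
    case (elim k)
    have deriv_small: "norm ((deriv ^^ n) (H k) w) \<le> c * d" if w: "norm w \<le> 1 - \<epsilon>" for w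
    proof -
      have sub: "cball w (\<epsilon> / 2) \<subseteq> cball 0 (1 - \<epsilon> / 2)"
      proof
        fix x assume "x \<in> cball w (\<epsilon> / 2)"
        then have "dist 0 x \<le> norm w + \<epsilon> / 2" using dist_triangle[of 0 x w] by simp
        then have "dist 0 x \<le> 1 - \<epsilon> / 2" using w by argo
        then show "x \<in> cball 0 (1 - \<epsilon> / 2)" by simp
      qed
      then have subD: "cball w (\<epsilon> / 2) \<subseteq> unit_disc" using \<epsilon> by fastforce
      have "norm ((deriv ^^ n) (H k) w) \<le> fact n * d / (\<epsilon> / 2) ^ n"
      proof (rule Cauchy_inequality)
        show "H k holomorphic_on ball w (\<epsilon> / 2)"
          using H subD ball_subset_cball by (meson holomorphic_on_subset subset_trans)
        show "continuous_on (cball w (\<epsilon> / 2)) (H k)"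
          using H subD by (meson holomorphic_on_imp_continuous_on holomorphic_on_subset)
        show "norm (H k x) \<le> d" if "norm (w - x) = \<epsilon> / 2" for x
        proof -
          have "x \<in> cball w (\<epsilon> / 2)" using that by (simp add: dist_norm)
          then show ?thesis using elim sub by (force simp: dist_norm)
        qed
      qed (use \<epsilon> in auto)
      also have "\<dots> = c * d" by (simp add: c_def power_divide)
      finally show ?thesis .
    qed
    let ?D = "\<lambda>z. ennreal (norm ((deriv ^^ n) (H k) (\<phi> z)) powr q)"
    have Dm: "?D \<in> borel_measurable dA" using higher_deriv_phi_measurable[OF H] by measurable
    have im: "(\<lambda>z. indicator {z. 1 - norm (\<phi> z) < \<epsilon>} z :: ennreal) \<in> borel_measurable dA"
    proof -
      have "(\<lambda>z. indicator {y. 1 - norm y < \<epsilon>} (\<phi> z) :: ennreal) \<in> borel_measurable dA"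
        by (rule measurable_compose[OF \<phi>_measurable]) measurable
      then show ?thesis by (simp add: indicator_def)
    qed
    have "target_size (H k) \<le> (\<integral>\<^sup>+z. m z * ?D z * indicator {z. 1 - norm (\<phi> z) < \<epsilon>} z + m z * ennreal ((c * d) powr q) \<partial>dA)"
      unfolding target_size_def
    proof (rule nn_integral_mono)
      fix z assume "z \<in> space dA"
      show "m z * ?D z \<le> m z * ?D z * indicator {z. 1 - norm (\<phi> z) < \<epsilon>} z + m z * ennreal ((c * d) powr q)"
      proof (cases "1 - norm (\<phi> z) < \<epsilon>")
        case False
        then have "norm ((deriv ^^ n) (H k) (\<phi> z)) \<le> c * d" by (intro deriv_small) linarith
        then have "?D z \<le> ennreal ((c * d) powr q)" using q by (intro ennreal_leI powr_mono2) auto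
        then have "m z * ?D z \<le> m z * ennreal ((c * d) powr q)" by (intro mult_left_mono) auto
        then show ?thesis by (rule order_trans) simp
      qed simp
    qed
    also have "\<dots> = (\<integral>\<^sup>+z. m z * ?D z * indicator {z. 1 - norm (\<phi> z) < \<epsilon>} z \<partial>dA) + (\<integral>\<^sup>+z. m z * ennreal ((c * d) powr q) \<partial>dA)"
      using m Dm im by (intro nn_integral_add borel_measurable_times_ennreal) auto
    also have "\<dots> \<le> ennreal (C * A * B powr (q / p)) + ennreal ((c * d) powr q * m0)"
    proof (rule add_mono)
      show "(\<integral>\<^sup>+z. m z * ?D z * indicator {z. 1 - norm (\<phi> z) < \<epsilon>} z \<partial>dA) \<le> ennreal (C * A * B powr (q / p))"
      proof (intro C H B src ballI impI)
        show "0 \<le> A" using A by simp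
        fix a :: complex assume "a \<in> unit_disc" "1 - norm a < 5 / 4 * \<epsilon>"
        then show "testing_integral a \<le> ennreal A" using \<epsilon>(3) by (intro \<delta>) auto
      qed
      show "(\<integral>\<^sup>+z. m z * ennreal ((c * d) powr q) \<partial>dA) \<le> ennreal ((c * d) powr q * m0)"
        using m0 by (simp add: nn_integral_multc ennreal_mult mult.commute)
    qed
    also have "\<dots> \<le> ennreal (e / 2) + ennreal (e / 2)" using CAB cd by (intro add_mono ennreal_leI)
    also have "\<dots> = ennreal e" using e by (subst ennreal_plus[symmetric]) auto
    finally show ?case .
  qed
qed

lemma normalised_test_fun_deriv_le:
  assumes a: "a \<in> unit_disc" and w: "w \<in> unit_disc"
  shows "norm ((deriv ^^ n) (test_fun g a) w) / carleson_mass a powr (1 / p)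
    \<le> pochhammer (real g) n / (1 - norm w) ^ (g + n) * ((1 - norm a) powr (real g * p) / carleson_mass a) powr (1 / p)"
proof -
  have s: "0 < carleson_mass a" by (rule carleson_mass_pos[OF a])
  have h: "0 < 1 - norm a" "0 < 1 - norm w" using a w by auto
  have "1 - norm w \<le> norm (1 - cnj a * w)" by (rule norm_one_minus_cnj_mult_ge(2)[OF a w])
  then have le: "(1 - norm w) ^ (g + n) \<le> norm (1 - cnj a * w) ^ (g + n)" using h by (intro power_mono) auto
  have pos: "0 < norm (1 - cnj a * w) ^ (g + n)" using zero_less_power[OF h(2)] le by (rule less_le_trans)
  have an: "norm a ^ n \<le> 1" using a by (intro power_le_one) auto
  have e: "((1 - norm a) powr (real g * p) / carleson_mass a) powr (1 / p) = (1 - norm a) ^ g / carleson_mass a powr (1 / p)"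
    using h s p by (simp add: powr_divide powr_powr powr_realpow)
  have le2: "(1 - norm a) ^ g / norm (1 - cnj a * w) ^ (g + n) \<le> (1 - norm a) ^ g / (1 - norm w) ^ (g + n)"
    by (rule divide_left_mono[OF le _ mult_pos_pos[OF pos zero_less_power[OF h(2)]]]) (use h in simp)
  have "norm ((deriv ^^ n) (test_fun g a) w) \<le> pochhammer (real g) n * 1 * ((1 - norm a) ^ g / (1 - norm w) ^ (g + n))"
    unfolding norm_higher_deriv_test_fun[OF a w]
    by (rule mult_mono[OF mult_left_mono[OF an pochhammer_of_nat_nonneg] le2])
       (use h pochhammer_of_nat_nonneg[of g n] in \<open>auto intro!: divide_nonneg_nonneg\<close>)
  then have "norm ((deriv ^^ n) (test_fun g a) w) / carleson_mass a powr (1 / p)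
    \<le> (pochhammer (real g) n * 1 * ((1 - norm a) ^ g / (1 - norm w) ^ (g + n))) / carleson_mass a powr (1 / p)"
    by (intro divide_right_mono) auto
  also have "\<dots> = pochhammer (real g) n / (1 - norm w) ^ (g + n) * ((1 - norm a) powr (real g * p) / carleson_mass a) powr (1 / p)"
    unfolding e by simp
  finally show ?thesis .
qed

lemma normalised_test_fun_deriv_tendsto_0:
  assumes a: "\<And>k. a k \<in> unit_disc" and lim: "(\<lambda>k. norm (a k)) \<longlonglongrightarrow> 1" and w: "w \<in> unit_disc"
  shows "(\<lambda>k. norm ((deriv ^^ n) (test_fun g (a k)) w) / carleson_mass (a k) powr (1 / p)) \<longlonglongrightarrow> 0"
proof -
  obtain C where C: "0 \<le> C" "\<And>a. a \<in> unit_disc \<Longrightarrow> (1 - norm a) powr (real g * p) \<le> C * (1 - norm a) * carleson_mass a"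
    using test_fun_decay[OF g] by blast
  define K where "K = pochhammer (real g) n / (1 - norm w) ^ (g + n)"
  have K: "0 \<le> K" using w pochhammer_of_nat_nonneg[of g n] by (simp add: K_def)
  have up: "norm ((deriv ^^ n) (test_fun g (a k)) w) / carleson_mass (a k) powr (1 / p) \<le> K * (C * (1 - norm (a k))) powr (1 / p)" for k
  proof -
    have "(1 - norm (a k)) powr (real g * p) / carleson_mass (a k) \<le> C * (1 - norm (a k))"
      using C(2)[OF a] carleson_mass_pos[OF a] by (simp add: pos_divide_le_eq)
    then have "((1 - norm (a k)) powr (real g * p) / carleson_mass (a k)) powr (1 / p) \<le> (C * (1 - norm (a k))) powr (1 / p)"
      using p carleson_mass_pos[OF a[of k]] by (intro powr_mono2) auto
    then have "K * ((1 - norm (a k)) powr (real g * p) / carleson_mass (a k)) powr (1 / p) \<le> K * (C * (1 - norm (a k))) powr (1 / p)"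
      using K by (intro mult_left_mono)
    then show ?thesis using normalised_test_fun_deriv_le[OF a[of k] w] unfolding K_def by linarith
  qed
  have "(\<lambda>k. C * (1 - norm (a k))) \<longlonglongrightarrow> C * (1 - 1)" by (intro tendsto_intros lim)
  then have "(\<lambda>k. (C * (1 - norm (a k))) powr (1 / p)) \<longlonglongrightarrow> (C * (1 - 1)) powr (1 / p)"
    using p C(1) a by (intro tendsto_powr' tendsto_const) (auto simp: less_imp_le)
  then have "(\<lambda>k. K * (C * (1 - norm (a k))) powr (1 / p)) \<longlonglongrightarrow> K * (C * (1 - 1)) powr (1 / p)"
    by (intro tendsto_mult tendsto_const)
  then have "(\<lambda>k. K * (C * (1 - norm (a k))) powr (1 / p)) \<longlonglongrightarrow> 0" by simp
  then show ?thesis by (rule tendsto_sandwich[rotated 3, of _ _ _ "\<lambda>_. 0"]) (auto intro!: always_eventually up)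
qed

end

section \<open>The operator between Bergman spaces\<close>

lemma weightD:
  assumes "weight \<omega>"
  shows "\<omega> \<in> borel_measurable dA" "z \<in> unit_disc \<Longrightarrow> 0 \<le> \<omega> z"
  using assms unfolding weight_def by auto

lemma nn_integral_weighted_area:
  assumes "weight \<omega>" "h \<in> borel_measurable dA"
  shows "(\<integral>\<^sup>+z. h z \<partial>weighted_area \<omega>) = (\<integral>\<^sup>+z. ennreal (\<omega> z) * h z \<partial>dA)"
  unfolding weighted_area_def using weightD(1)[OF assms(1)] assms(2) by (intro nn_integral_density) auto

lemma nn_integral_weighted_area_norm_powr:
  assumes \<omega>: "weight \<omega>" and f: "f holomorphic_on unit_disc"
  shows "(\<integral>\<^sup>+z. ennreal (norm (f z) powr p) \<partial>weighted_area \<omega>) = (\<integral>\<^sup>+z. ennreal (norm (f z) powr p * \<omega> z) \<partial>dA)"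
proof -
  have "f \<in> borel_measurable dA" by (rule radial_measure.holomorphic_measurable_M[OF radial_measure_dA f])
  then have "(\<lambda>z. ennreal (norm (f z) powr p)) \<in> borel_measurable dA" by measurable
  then have "(\<integral>\<^sup>+z. ennreal (norm (f z) powr p) \<partial>weighted_area \<omega>) = (\<integral>\<^sup>+z. ennreal (\<omega> z) * ennreal (norm (f z) powr p) \<partial>dA)"
    by (rule nn_integral_weighted_area[OF \<omega>])
  also have "\<dots> = (\<integral>\<^sup>+z. ennreal (norm (f z) powr p * \<omega> z) \<partial>dA)"
    using weightD(2)[OF \<omega>] by (intro nn_integral_cong) (simp add: ennreal_mult mult.commute)
  finally show ?thesis .
qed

lemma bergman_integrand_measurable:
  assumes "weight \<omega>" "f holomorphic_on unit_disc"
  shows "(\<lambda>z. norm (f z) powr p * \<omega> z) \<in> borel_measurable dA"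
  using radial_measure.holomorphic_measurable_M[OF radial_measure_dA assms(2)] weightD(1)[OF assms(1)] by measurable

lemma bergman_space_iff:
  assumes \<omega>: "weight \<omega>"
  shows "f \<in> bergman_space p \<omega> \<longleftrightarrow> f holomorphic_on unit_disc \<and> (\<integral>\<^sup>+z. ennreal (norm (f z) powr p) \<partial>weighted_area \<omega>) < top"
proof (cases "f holomorphic_on unit_disc")
  case True
  have "(\<integral>\<^sup>+z. ennreal (norm (norm (f z) powr p * \<omega> z)) \<partial>dA) = (\<integral>\<^sup>+z. ennreal (norm (f z) powr p * \<omega> z) \<partial>dA)"
    using weightD(2)[OF \<omega>] by (intro nn_integral_cong) auto
  then show ?thesis
    using True bergman_integrand_measurable[OF \<omega> True, of p]
    unfolding bergman_space_def nn_integral_weighted_area_norm_powr[OF \<omega> True] by (simp add: integrable_iff_bounded)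
qed (simp add: bergman_space_def)

lemma bergman_norm_eq:
  assumes \<omega>: "weight \<omega>" and f: "f holomorphic_on unit_disc"
  shows "bergman_norm p \<omega> f = enn2real (\<integral>\<^sup>+z. ennreal (norm (f z) powr p) \<partial>weighted_area \<omega>) powr (1 / p)"
proof -
  have "(LINT z|dA. norm (f z) powr p * \<omega> z) = enn2real (\<integral>\<^sup>+z. ennreal (norm (f z) powr p * \<omega> z) \<partial>dA)"
    using bergman_integrand_measurable[OF assms] weightD(2)[OF \<omega>]
    by (intro integral_eq_nn_integral) (auto intro!: AE_I2)
  then show ?thesis unfolding bergman_norm_def nn_integral_weighted_area_norm_powr[OF assms] by simp
qed

lemma weight_measure_eq:
  assumes \<omega>: "weight \<omega>" and E: "E \<in> sets dA"
  shows "weight_measure \<omega> E = measure (weighted_area \<omega>) E"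
proof -
  have sub: "E \<subseteq> unit_disc" using sets.sets_into_space[OF E] by simp
  have "weight_measure \<omega> E = (LINT z|dA. indicator E z *\<^sub>R \<omega> z)"
    unfolding weight_measure_def set_lebesgue_integral_def ..
  also have "\<dots> = enn2real (\<integral>\<^sup>+z. ennreal (indicator E z *\<^sub>R \<omega> z) \<partial>dA)"
    using weightD[OF \<omega>] E by (intro integral_eq_nn_integral) (auto intro!: AE_I2 simp: indicator_def)
  also have "(\<integral>\<^sup>+z. ennreal (indicator E z *\<^sub>R \<omega> z) \<partial>dA) = (\<integral>\<^sup>+z. ennreal (\<omega> z) * indicator E z \<partial>dA)"
    by (intro nn_integral_cong) (auto simp: indicator_def)
  also have "\<dots> = emeasure (weighted_area \<omega>) E"
    unfolding weighted_area_def using weightD(1)[OF \<omega>] E by (intro emeasure_density[symmetric]) auto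
  finally show ?thesis by (simp add: measure_def)
qed

text \<open>
  A quasi-triangle inequality valid for all positive exponents.
\<close>

lemma norm_diff_powr_le:
  fixes x y :: complex
  assumes "0 < p"
  shows "norm (x - y) powr p \<le> 2 powr p * (norm x powr p + norm y powr p)"
proof -
  have "norm (x - y) \<le> 2 * max (norm x) (norm y)" using norm_triangle_ineq4[of x y] by (simp add: max_def)
  then have "norm (x - y) powr p \<le> (2 * max (norm x) (norm y)) powr p" using assms by (intro powr_mono2) auto
  also have "\<dots> = 2 powr p * max (norm x) (norm y) powr p" by (simp add: powr_mult)
  also have "\<dots> \<le> 2 powr p * (norm x powr p + norm y powr p)" by (intro mult_left_mono) (auto simp: max_def)
  finally show ?thesis .
qed

lemma nn_integral_norm_diff_powr_le:
  assumes p: "0 < p" and f: "f \<in> borel_measurable M" and h: "h \<in> borel_measurable M"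
  shows "(\<integral>\<^sup>+z. ennreal (norm (f z - h z :: complex) powr p) \<partial>M)
     \<le> ennreal (2 powr p) * ((\<integral>\<^sup>+z. ennreal (norm (f z) powr p) \<partial>M) + (\<integral>\<^sup>+z. ennreal (norm (h z) powr p) \<partial>M))"
proof -
  have [measurable]: "f \<in> borel_measurable M" "h \<in> borel_measurable M" by fact+
  have "(\<integral>\<^sup>+z. ennreal (norm (f z - h z) powr p) \<partial>M) \<le> (\<integral>\<^sup>+z. ennreal (2 powr p) * (ennreal (norm (f z) powr p) + ennreal (norm (h z) powr p)) \<partial>M)"
  proof (rule nn_integral_mono)
    fix z
    have "ennreal (norm (f z - h z) powr p) \<le> ennreal (2 powr p * (norm (f z) powr p + norm (h z) powr p))"
      by (intro ennreal_leI norm_diff_powr_le p)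
    then show "ennreal (norm (f z - h z) powr p) \<le> ennreal (2 powr p) * (ennreal (norm (f z) powr p) + ennreal (norm (h z) powr p))"
      by (simp add: ennreal_mult)
  qed
  also have "\<dots> = ennreal (2 powr p) * ((\<integral>\<^sup>+z. ennreal (norm (f z) powr p) \<partial>M) + (\<integral>\<^sup>+z. ennreal (norm (h z) powr p) \<partial>M))"
    by (simp add: nn_integral_cmult nn_integral_add)
  finally show ?thesis .
qed

lemma enn2real_powr_tendsto_0:
  fixes t :: "nat \<Rightarrow> ennreal"
  assumes q: "0 < q" and t: "\<And>e. 0 < e \<Longrightarrow> \<forall>\<^sub>F k in sequentially. t k \<le> ennreal e"
  shows "(\<lambda>k. enn2real (t k) powr (1 / q)) \<longlonglongrightarrow> 0"
proof -
  have "(\<lambda>k. enn2real (t k)) \<longlonglongrightarrow> 0"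
  proof (rule tendstoI)
    fix e :: real assume e: "0 < e"
    then have "\<forall>\<^sub>F k in sequentially. t k \<le> ennreal (e / 2)" by (intro t) simp
    then show "\<forall>\<^sub>F k in sequentially. dist (enn2real (t k)) 0 < e"
    proof eventually_elim
      case (elim k)
      then have "enn2real (t k) \<le> e / 2" using e by (intro enn2real_leI) auto
      then show ?case using e by simp
    qed
  qed
  then have "(\<lambda>k. enn2real (t k) powr (1 / q)) \<longlonglongrightarrow> 0 powr (1 / q)"
    using q by (intro tendsto_powr' tendsto_const) auto
  then show ?thesis by simp
qed

locale bergman_operator = carleson_setting "weighted_area \<omega>" p q g n "\<lambda>z. ennreal (norm (u z) powr q * \<nu> z)" \<phi>
  for \<omega> \<nu> :: "complex \<Rightarrow> real" and u \<phi> :: "complex \<Rightarrow> complex" and p q :: real and g n :: nat +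
  assumes \<omega>: "weight \<omega>" and \<nu>: "weight \<nu>" and u: "u \<in> bergman_space q \<nu>"
begin

abbreviation T :: "(complex \<Rightarrow> complex) \<Rightarrow> complex \<Rightarrow> complex" where "T \<equiv> D_op n \<phi> u"

lemma u_holomorphic: "u holomorphic_on unit_disc"
  using u by (simp add: bergman_space_def)

lemma T_holomorphic:
  assumes "f holomorphic_on unit_disc" shows "T f holomorphic_on unit_disc"
proof -
  have "(deriv ^^ n) f holomorphic_on unit_disc"
    using assms by (rule holomorphic_higher_deriv) simp
  then have "((deriv ^^ n) f \<circ> \<phi>) holomorphic_on unit_disc"
    using \<phi> unfolding analytic_self_map_def
    by (intro holomorphic_on_compose_gen[where t = unit_disc]) auto
  then show ?thesis unfolding D_op_def
    using u_holomorphic by (intro holomorphic_on_mult) (auto simp: o_def)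
qed

lemma T_size:
  assumes "f holomorphic_on unit_disc"
  shows "(\<integral>\<^sup>+z. ennreal (norm (T f z) powr q) \<partial>weighted_area \<nu>) = target_size f"
  unfolding nn_integral_weighted_area_norm_powr[OF \<nu> T_holomorphic[OF assms]] target_size_def
  using weightD(2)[OF \<nu>]
  by (intro nn_integral_cong) (simp add: D_op_def norm_mult powr_mult ennreal_mult[symmetric] mult_ac)

lemma source_iff: "f \<in> bergman_space p \<omega> \<longleftrightarrow> f holomorphic_on unit_disc \<and> source_size f < top"
  unfolding source_size_def by (rule bergman_space_iff[OF \<omega>])

lemma source_norm: "f holomorphic_on unit_disc \<Longrightarrow> bergman_norm p \<omega> f = enn2real (source_size f) powr (1 / p)"
  unfolding source_size_def by (rule bergman_norm_eq[OF \<omega>])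

lemma target_iff: "f holomorphic_on unit_disc \<Longrightarrow> T f \<in> bergman_space q \<nu> \<longleftrightarrow> target_size f < top"
  unfolding bergman_space_iff[OF \<nu>] by (simp add: T_holomorphic T_size)

lemma target_norm: "f holomorphic_on unit_disc \<Longrightarrow> bergman_norm q \<nu> (T f) = enn2real (target_size f) powr (1 / q)"
  by (simp add: bergman_norm_eq[OF \<nu> T_holomorphic] T_size)

lemma source_size_le_of_norm:
  assumes f: "f \<in> bergman_space p \<omega>" and le: "bergman_norm p \<omega> f \<le> C"
  shows "source_size f \<le> ennreal (C powr p)"
proof -
  have hol: "f holomorphic_on unit_disc" and fin: "source_size f < top" using f source_iff by auto
  obtain x where x: "source_size f = ennreal x" "0 \<le> x" using fin by (cases "source_size f") auto
  have "x powr (1 / p) \<le> C" using le unfolding source_norm[OF hol] x(1) using x(2) by simp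
  then have "(x powr (1 / p)) powr p \<le> C powr p" using p by (intro powr_mono2) auto
  then have "x \<le> C powr p" using x(2) p by (simp add: powr_powr)
  then show ?thesis unfolding x(1) by (rule ennreal_leI)
qed

lemma bounded_iff:
  "bounded_operator p \<omega> q \<nu> T \<longleftrightarrow> (\<exists>A\<ge>0. \<forall>a\<in>unit_disc. testing_integral a \<le> ennreal A)"
proof
  assume bd: "bounded_operator p \<omega> q \<nu> T"
  then obtain C0 where mem: "\<And>f. f \<in> bergman_space p \<omega> \<Longrightarrow> T f \<in> bergman_space q \<nu>"
    and C0: "\<And>f. f \<in> bergman_space p \<omega> \<Longrightarrow> bergman_norm q \<nu> (T f) \<le> C0 * bergman_norm p \<omega> f"
    unfolding bounded_operator_def by blast
  define C where "C = max C0 0"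
  have C: "0 \<le> C" "C0 \<le> C" by (simp_all add: C_def)
  show "\<exists>A\<ge>0. \<forall>a\<in>unit_disc. testing_integral a \<le> ennreal A"
  proof (rule bounded_necessary[of "C powr q"])
    fix f B assume f: "f holomorphic_on unit_disc" and B: "0 \<le> B" and src: "source_size f \<le> ennreal B"
    have "source_size f < top" using src by (meson ennreal_less_top order_le_less_trans)
    then have fA: "f \<in> bergman_space p \<omega>" using f source_iff by blast
    then have "target_size f < top" using mem target_iff[OF f] by blast
    then obtain y where y: "target_size f = ennreal y" "0 \<le> y" by (cases "target_size f") auto
    have "enn2real (source_size f) \<le> B" using src B by (rule enn2real_leI[rotated])
    then have "bergman_norm p \<omega> f \<le> B powr (1 / p)"
      unfolding source_norm[OF f] using p by (intro powr_mono2) auto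
    then have "y powr (1 / q) \<le> C * B powr (1 / p)"
      using C0[OF fA] C unfolding target_norm[OF f] y(1)
      by (smt (verit) enn2real_ennreal mult_mono powr_ge_zero source_norm[OF f] y(2))
    then have "(y powr (1 / q)) powr q \<le> (C * B powr (1 / p)) powr q"
      using q by (intro powr_mono2) auto
    then have "y \<le> C powr q * B powr (q / p)"
      using y(2) q C B by (simp add: powr_powr powr_mult)
    then show "target_size f \<le> ennreal (C powr q * B powr (q / p))" unfolding y(1) by (rule ennreal_leI)
  qed simp
next
  assume "\<exists>A\<ge>0. \<forall>a\<in>unit_disc. testing_integral a \<le> ennreal A"
  then obtain A where "0 \<le> A" "\<And>a. a \<in> unit_disc \<Longrightarrow> testing_integral a \<le> ennreal A" by blast
  from bounded_sufficient[OF this]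
  obtain C where C: "0 \<le> C" "\<And>f B. f holomorphic_on unit_disc \<Longrightarrow> 0 \<le> B \<Longrightarrow> source_size f \<le> ennreal B \<Longrightarrow> target_size f \<le> ennreal (C * B powr (q / p))"
    by blast
  have key: "T f \<in> bergman_space q \<nu> \<and> bergman_norm q \<nu> (T f) \<le> C powr (1 / q) * bergman_norm p \<omega> f"
    if f: "f \<in> bergman_space p \<omega>" for f
  proof -
    have hol: "f holomorphic_on unit_disc" and "source_size f < top" using f source_iff by auto
    then obtain x where x: "source_size f = ennreal x" "0 \<le> x" by (cases "source_size f") auto
    have le: "target_size f \<le> ennreal (C * x powr (q / p))" using x by (intro C hol) auto
    then have "target_size f < top" by (meson ennreal_less_top order_le_less_trans)
    moreover have "enn2real (target_size f) \<le> C * x powr (q / p)" using le C(1) by (intro enn2real_leI) auto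
    then have "enn2real (target_size f) powr (1 / q) \<le> (C * x powr (q / p)) powr (1 / q)"
      using q by (intro powr_mono2) auto
    then have "bergman_norm q \<nu> (T f) \<le> C powr (1 / q) * bergman_norm p \<omega> f"
      unfolding target_norm[OF hol] source_norm[OF hol] x(1) using x(2) q C(1) by (simp add: powr_mult powr_powr)
    ultimately show ?thesis using target_iff[OF hol] by blast
  qed
  then show "bounded_operator p \<omega> q \<nu> T" unfolding bounded_operator_def by blast
qed

text \<open>
  The limit of a subsequence is taken in the source space: a locally uniform limit \<open>G\<close> given
  by Montel's theorem belongs to it by Fatou's lemma, and its image is the limit of the images.
\<close>

lemma compact_if:
  assumes testing_integral: "\<And>e. 0 < e \<Longrightarrow> \<exists>\<delta>>0. \<forall>a\<in>unit_disc. 1 - norm a < \<delta> \<longrightarrow> testing_integral a \<le> ennreal e"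
  shows "compact_operator p \<omega> q \<nu> T"
proof -
  have bd: "bounded_operator p \<omega> q \<nu> T"
  proof -
    obtain \<delta> where \<delta>: "0 < \<delta>" "\<And>a. a \<in> unit_disc \<Longrightarrow> 1 - norm a < \<delta> \<Longrightarrow> testing_integral a \<le> ennreal 1"
      using testing_integral[of 1] by auto
    obtain K where K: "0 \<le> K" "\<And>a. a \<in> unit_disc \<Longrightarrow> norm a \<le> 1 - \<delta> \<Longrightarrow> testing_integral a \<le> ennreal K"
      using testing_integral_bounded_inside[of "1 - \<delta>"] \<delta>(1) by auto
    have "testing_integral a \<le> ennreal (max 1 K)" if a: "a \<in> unit_disc" for a
    proof (cases "1 - norm a < \<delta>")
      case True
      have "testing_integral a \<le> ennreal 1" by (rule \<delta>(2)[OF a True])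
      also have "\<dots> \<le> ennreal (max 1 K)" by (intro ennreal_leI) simp
      finally show ?thesis .
    next
      case False
      then have "testing_integral a \<le> ennreal K" by (intro K a) simp
      also have "\<dots> \<le> ennreal (max 1 K)" by (intro ennreal_leI) simp
      finally show ?thesis .
    qed
    then show ?thesis unfolding bounded_iff by (intro exI[of _ "max 1 K"]) auto
  qed
  show ?thesis unfolding compact_operator_def
  proof (intro conjI allI impI)
    show mem: "\<forall>f\<in>bergman_space p \<omega>. T f \<in> bergman_space q \<nu>" using bd unfolding bounded_operator_def by blast
    fix F :: "nat \<Rightarrow> complex \<Rightarrow> complex" and C
    assume F: "\<forall>k. F k \<in> bergman_space p \<omega> \<and> bergman_norm p \<omega> (F k) \<le> C"
    define B where "B = C powr p"
    have B: "0 \<le> B" by (simp add: B_def)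
    have hol: "F k holomorphic_on unit_disc" and src: "source_size (F k) \<le> ennreal B" for k
      using F source_iff source_size_le_of_norm[of "F k" C] by (auto simp: B_def)
    define \<H> where "\<H> = {f. f holomorphic_on unit_disc \<and> source_size f \<le> ennreal B}"
    obtain G r where G: "G holomorphic_on unit_disc" and r: "strict_mono (r :: nat \<Rightarrow> nat)"
      and pw: "\<And>x. x \<in> unit_disc \<Longrightarrow> (\<lambda>k. F (r k) x) \<longlonglongrightarrow> G x"
      and ul: "\<And>K. compact K \<Longrightarrow> K \<subseteq> unit_disc \<Longrightarrow> uniform_limit K (F \<circ> r) G sequentially"
    proof (rule Montel[of unit_disc \<H> F])
      show "\<exists>b. \<forall>h\<in>\<H>. \<forall>z\<in>K. norm (h z) \<le> b" if K: "compact K" "K \<subseteq> unit_disc" for K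
      proof (cases "K = {}")
        case False
        obtain x where x: "x \<in> K" "\<And>y. y \<in> K \<Longrightarrow> norm y \<le> norm x"
          using continuous_attains_sup[OF K(1) False, of norm] by (auto intro: continuous_intros)
        have "norm x < 1" using x(1) K(2) by auto
        from locally_bounded[OF this B] obtain b where
          "\<And>f w. f holomorphic_on unit_disc \<Longrightarrow> source_size f \<le> ennreal B \<Longrightarrow> w \<in> unit_disc \<Longrightarrow> norm w \<le> norm x \<Longrightarrow> norm (f w) \<le> b"
          by blast
        then show ?thesis using x(2) K(2) unfolding \<H>_def by blast
      qed simp
      show "range F \<subseteq> \<H>" using hol src by (auto simp: \<H>_def)
    qed (auto simp: \<H>_def)
    have srcG: "source_size G \<le> ennreal B"
    proof -
      have "source_size G = (\<integral>\<^sup>+z. liminf (\<lambda>k. ennreal (norm (F (r k) z) powr p)) \<partial>weighted_area \<omega>)"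
        unfolding source_size_def
      proof (rule nn_integral_cong)
        fix z assume "z \<in> space (weighted_area \<omega>)"
        then have "(\<lambda>k. F (r k) z) \<longlonglongrightarrow> G z" by (intro pw) simp
        then have "(\<lambda>k. norm (F (r k) z) powr p) \<longlonglongrightarrow> norm (G z) powr p"
          using p by (intro tendsto_powr' tendsto_norm tendsto_const) auto
        then have "(\<lambda>k. ennreal (norm (F (r k) z) powr p)) \<longlonglongrightarrow> ennreal (norm (G z) powr p)" by (rule tendsto_ennrealI)
        from lim_imp_Liminf[OF sequentially_bot this]
        show "ennreal (norm (G z) powr p) = liminf (\<lambda>k. ennreal (norm (F (r k) z) powr p))" by (rule sym)
      qed
      also have "\<dots> \<le> liminf (\<lambda>k. \<integral>\<^sup>+z. ennreal (norm (F (r k) z) powr p) \<partial>weighted_area \<omega>)"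
        using holomorphic_measurable_M[OF hol] by (intro nn_integral_liminf) measurable
      also have "\<dots> \<le> liminf (\<lambda>k. ennreal B)"
        using src unfolding source_size_def by (intro Liminf_mono always_eventually) auto
      also have "\<dots> = ennreal B" by (simp add: Liminf_const)
      finally show ?thesis .
    qed
    define H where "H k = (\<lambda>z. F (r k) z - G z)" for k
    (* The differences H k tend to 0 locally uniformly and stay bounded. *)
    define B' where "B' = 2 powr p * (B + B)"
    have B': "0 \<le> B'" using B by (simp add: B'_def)
    have holH: "H k holomorphic_on unit_disc" for k unfolding H_def using hol G by (intro holomorphic_intros)
    have srcH: "source_size (H k) \<le> ennreal B'" for k
    proof -
      have "source_size (H k) \<le> ennreal (2 powr p) * (source_size (F (r k)) + source_size G)"
        unfolding source_size_def H_def
        by (intro nn_integral_norm_diff_powr_le p holomorphic_measurable_M hol G)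
      also have "\<dots> \<le> ennreal (2 powr p) * (ennreal B + ennreal B)"
        using src srcG by (intro mult_left_mono add_mono) auto
      also have "\<dots> = ennreal B'"
        unfolding B'_def ennreal_plus[OF B B, symmetric] using B by (intro ennreal_mult[symmetric]) auto
      finally show ?thesis .
    qed
    have small: "\<forall>\<^sub>F k in sequentially. target_size (H k) \<le> ennreal e" if e: "0 < e" for e
    proof (rule compact_sufficient[OF testing_integral holH srcH B' _ e])
      show "uniform_limit K H (\<lambda>_. 0) sequentially" if "compact K" "K \<subseteq> unit_disc" for K
        using ul[OF that] by (simp add: uniform_limit_iff H_def dist_norm)
    qed
    have norm_eq: "bergman_norm q \<nu> (\<lambda>z. T (F (r k)) z - T G z) = enn2real (target_size (H k)) powr (1 / q)" for k
    proof -
      have "(\<lambda>z. T (F (r k)) z - T G z) holomorphic_on unit_disc"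
        using T_holomorphic[OF hol] T_holomorphic[OF G] by (intro holomorphic_intros)
      then have "bergman_norm q \<nu> (\<lambda>z. T (F (r k)) z - T G z) = enn2real (\<integral>\<^sup>+z. ennreal (norm (T (F (r k)) z - T G z) powr q) \<partial>weighted_area \<nu>) powr (1 / q)"
        by (rule bergman_norm_eq[OF \<nu>])
      also have "(\<integral>\<^sup>+z. ennreal (norm (T (F (r k)) z - T G z) powr q) \<partial>weighted_area \<nu>) = (\<integral>\<^sup>+z. ennreal (norm (T (H k) z) powr q) \<partial>weighted_area \<nu>)"
      proof (rule nn_integral_cong)
        fix z assume "z \<in> space (weighted_area \<nu>)"
        then have "\<phi> z \<in> unit_disc" by (intro \<phi>_disc) (simp add: weighted_area_def)
        then have "(deriv ^^ n) (H k) (\<phi> z) = (deriv ^^ n) (F (r k)) (\<phi> z) - (deriv ^^ n) G (\<phi> z)"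
          unfolding H_def by (intro higher_deriv_diff[OF hol G]) auto
        then show "ennreal (norm (T (F (r k)) z - T G z) powr q) = ennreal (norm (T (H k) z) powr q)"
          by (simp add: D_op_def right_diff_distrib)
      qed
      finally show ?thesis by (simp add: T_size[OF holH])
    qed
    have "G \<in> bergman_space p \<omega>"
      using G srcG unfolding source_iff by (meson ennreal_less_top order_le_less_trans)
    then have "T G \<in> bergman_space q \<nu>" using mem by blast
    moreover have "(\<lambda>k. bergman_norm q \<nu> (\<lambda>z. T (F (r k)) z - T G z)) \<longlonglongrightarrow> 0"
      unfolding norm_eq by (rule enn2real_powr_tendsto_0[OF q small])
    ultimately show "\<exists>h\<in>bergman_space q \<nu>. \<exists>r. strict_mono r \<and> (\<lambda>k. bergman_norm q \<nu> (\<lambda>z. T (F (r k)) z - h z)) \<longlonglongrightarrow> 0"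
      using r by blast
  qed
qed

lemma source_size_cmult:
  "source_size (\<lambda>z. c * f z) = ennreal (norm c powr p) * source_size f" if "f holomorphic_on unit_disc"
proof -
  have "(\<lambda>z. ennreal (norm (f z) powr p)) \<in> borel_measurable (weighted_area \<omega>)"
    using holomorphic_measurable_M[OF that] by measurable
  then show ?thesis
    unfolding source_size_def by (simp add: norm_mult powr_mult ennreal_mult nn_integral_cmult)
qed

lemma target_size_cmult:
  "target_size (\<lambda>z. c * f z) = ennreal (norm c powr q) * target_size f" if "f holomorphic_on unit_disc"
proof -
  have "(\<lambda>z. ennreal (norm ((deriv ^^ n) f (\<phi> z)) powr q)) \<in> borel_measurable dA"
    using higher_deriv_phi_measurable[OF that] by measurable
  then have "ennreal (norm c powr q) * target_size f = (\<integral>\<^sup>+z. ennreal (norm c powr q) * (ennreal (norm (u z) powr q * \<nu> z) * ennreal (norm ((deriv ^^ n) f (\<phi> z)) powr q)) \<partial>dA)"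
    unfolding target_size_def using m by (intro nn_integral_cmult[symmetric] borel_measurable_times_ennreal)
  also have "\<dots> = target_size (\<lambda>z. c * f z)"
    unfolding target_size_def
  proof (rule nn_integral_cong)
    fix z assume "z \<in> space dA"
    then have "\<phi> z \<in> unit_disc" by (intro \<phi>_disc) simp
    then have "(deriv ^^ n) (\<lambda>z. c * f z) (\<phi> z) = c * (deriv ^^ n) f (\<phi> z)"
      by (intro higher_deriv_cmult[OF that]) auto
    then show "ennreal (norm c powr q) * (ennreal (norm (u z) powr q * \<nu> z) * ennreal (norm ((deriv ^^ n) f (\<phi> z)) powr q))
       = ennreal (norm (u z) powr q * \<nu> z) * ennreal (norm ((deriv ^^ n) (\<lambda>z. c * f z) (\<phi> z)) powr q)"
      by (simp add: norm_mult powr_mult ennreal_mult mult_ac)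
  qed
  finally show ?thesis by simp
qed

text \<open>
  If the testing integrals stayed above \<open>e\<close> along a sequence \<open>a_k\<close>, the normalised test functions
  would have a subsequence whose images converge to some \<open>h\<close> in norm. They also tend to \<open>0\<close>
  pointwise, so \<open>h\<close> vanishes almost everywhere by Fatou's lemma, and the norms of the images tend
  to \<open>0\<close>, contrary to the lower bound \<open>e\<close>.
\<close>

lemma compact_only_if:
  assumes comp: "compact_operator p \<omega> q \<nu> T" and e: "0 < e"
  shows "\<exists>\<delta>>0. \<forall>a\<in>unit_disc. 1 - norm a < \<delta> \<longrightarrow> testing_integral a \<le> ennreal e"
proof (rule ccontr)
  assume neg: "\<not> (\<exists>\<delta>>0. \<forall>a\<in>unit_disc. 1 - norm a < \<delta> \<longrightarrow> testing_integral a \<le> ennreal e)"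
  have "\<exists>a. a \<in> unit_disc \<and> 1 - norm a < 1 / (2 * real (Suc k)) \<and> \<not> testing_integral a \<le> ennreal e" for k :: nat
  proof -
    have "0 < 1 / (2 * real (Suc k))" by simp
    then show ?thesis using neg by blast
  qed
  then obtain a where a: "\<And>k. a k \<in> unit_disc" "\<And>k. 1 - norm (a k) < 1 / (2 * real (Suc k))"
    and bad: "\<And>k. \<not> testing_integral (a k) \<le> ennreal e" by metis
  have half: "1 / 2 \<le> norm (a k)" for k
  proof -
    have "1 / (2 * real (Suc k)) \<le> 1 / 2" by (simp add: field_simps)
    then show ?thesis using a(2)[of k] by linarith
  qed
  have na: "(\<lambda>k. norm (a k)) \<longlonglongrightarrow> 1"
  proof (rule tendsto_sandwich)
    have "1 - inverse (real (Suc k)) \<le> norm (a k)" for k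
    proof -
      have "1 / (2 * real (Suc k)) \<le> inverse (real (Suc k))" by (simp add: field_simps)
      then show ?thesis using a(2)[of k] by linarith
    qed
    then show "\<forall>\<^sub>F k in sequentially. 1 - inverse (real (Suc k)) \<le> norm (a k)" by simp
    show "\<forall>\<^sub>F k in sequentially. norm (a k) \<le> 1" using a(1) by (auto simp: less_imp_le)
    have "(\<lambda>k. 1 - inverse (real (Suc k))) \<longlonglongrightarrow> 1 - 0" by (intro tendsto_diff tendsto_const LIMSEQ_inverse_real_of_nat)
    then show "(\<lambda>k. 1 - inverse (real (Suc k))) \<longlonglongrightarrow> 1" by simp
  qed (rule tendsto_const)
  define c where "c k = complex_of_real (1 / carleson_mass (a k) powr (1 / p))" for k
  have s: "0 < carleson_mass (a k)" for k by (rule carleson_mass_pos[OF a(1)])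
  have nc: "norm (c k) = 1 / carleson_mass (a k) powr (1 / p)" for k
    unfolding c_def norm_of_real by simp
  define G where "G k = (\<lambda>z. c k * test_fun g (a k) z)" for k
  have holt: "test_fun g (a k) holomorphic_on unit_disc" for k by (rule test_fun_holomorphic[OF a(1)])
  have holG: "G k holomorphic_on unit_disc" for k unfolding G_def using holt by (intro holomorphic_intros)
  have srcG: "source_size (G k) \<le> ennreal (448 * doubling_const)" for k
  proof -
    have "source_size (G k) = ennreal (1 / carleson_mass (a k)) * source_size (test_fun g (a k))"
      unfolding G_def source_size_cmult[OF holt] using nc[of k] p s[of k] by (simp add: powr_divide powr_powr)
    also have "\<dots> \<le> ennreal (1 / carleson_mass (a k)) * ennreal (448 * doubling_const * carleson_mass (a k))"
      unfolding source_size_def by (intro mult_left_mono test_fun_norm_le[OF g' a(1)]) auto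
    also have "\<dots> = ennreal (448 * doubling_const)"
      using s[of k] doubling_const(1) by (subst ennreal_mult[symmetric]) auto
    finally show ?thesis .
  qed
  have GA: "G k \<in> bergman_space p \<omega>" for k
    using holG srcG unfolding source_iff by (meson ennreal_less_top order_le_less_trans)
  have "bergman_norm p \<omega> (G k) \<le> (448 * doubling_const) powr (1 / p)" for k
    unfolding source_norm[OF holG] using srcG[of k] doubling_const(1) p by (intro powr_mono2 enn2real_leI) auto
  then obtain h r where h: "h \<in> bergman_space q \<nu>" and r: "strict_mono (r :: nat \<Rightarrow> nat)"
    and lim: "(\<lambda>k. bergman_norm q \<nu> (\<lambda>z. T (G (r k)) z - h z)) \<longlonglongrightarrow> 0"
    using comp GA unfolding compact_operator_def by blast
  have TG: "T (G k) \<in> bergman_space q \<nu>" for k using comp GA unfolding compact_operator_def by blast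
  have holh: "h holomorphic_on unit_disc" and hfin: "(\<integral>\<^sup>+z. ennreal (norm (h z) powr q) \<partial>weighted_area \<nu>) < top"
    using h unfolding bergman_space_iff[OF \<nu>] by auto
  have spN: "space (weighted_area \<nu>) = unit_disc" by (simp add: weighted_area_def)
  have meas: "f \<in> borel_measurable (weighted_area \<nu>)" if "f holomorphic_on unit_disc" for f
    using radial_measure.holomorphic_measurable_M[OF radial_measure_dA that] by (simp add: weighted_area_def)
  define t where "t k = (\<integral>\<^sup>+z. ennreal (norm (T (G (r k)) z - h z) powr q) \<partial>weighted_area \<nu>)" for k
  have holD: "(\<lambda>z. T (G (r k)) z - h z) holomorphic_on unit_disc" for k
    using T_holomorphic[OF holG] holh by (intro holomorphic_intros)
  have t_fin: "t k < top" for k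
  proof -
    have "t k \<le> ennreal (2 powr q) * ((\<integral>\<^sup>+z. ennreal (norm (T (G (r k)) z) powr q) \<partial>weighted_area \<nu>) + (\<integral>\<^sup>+z. ennreal (norm (h z) powr q) \<partial>weighted_area \<nu>))"
      unfolding t_def by (intro nn_integral_norm_diff_powr_le q meas T_holomorphic holG holh)
    also have "\<dots> < top"
      using TG[of "r k"] hfin unfolding bergman_space_iff[OF \<nu>] by (simp add: ennreal_mult_less_top)
    finally show ?thesis .
  qed
  have t_lim: "t \<longlonglongrightarrow> 0"
  proof -
    have "(\<lambda>k. enn2real (t k) powr (1 / q)) \<longlonglongrightarrow> 0"
      using lim unfolding bergman_norm_eq[OF \<nu> holD] t_def .
    then have "(\<lambda>k. (enn2real (t k) powr (1 / q)) powr q) \<longlonglongrightarrow> 0 powr q"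
      using q by (intro tendsto_powr' tendsto_const) auto
    moreover have "(enn2real (t k) powr (1 / q)) powr q = enn2real (t k)" for k
      using q by (simp add: powr_powr)
    ultimately have "(\<lambda>k. enn2real (t k)) \<longlonglongrightarrow> 0" by simp
    then have "(\<lambda>k. ennreal (enn2real (t k))) \<longlonglongrightarrow> ennreal 0" by (rule tendsto_ennrealI)
    then show ?thesis using t_fin by (simp add: less_top)
  qed
  have pointwise: "(\<lambda>k. T (G (r k)) z) \<longlonglongrightarrow> 0" if z: "z \<in> unit_disc" for z
  proof -
    have "(\<lambda>k. norm ((deriv ^^ n) (test_fun g (a k)) (\<phi> z)) / carleson_mass (a k) powr (1 / p)) \<longlonglongrightarrow> 0"
      by (rule normalised_test_fun_deriv_tendsto_0[OF a(1) na \<phi>_disc[OF z]])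
    then have "(\<lambda>k. norm (u z) * (norm ((deriv ^^ n) (test_fun g (a k)) (\<phi> z)) / carleson_mass (a k) powr (1 / p))) \<longlonglongrightarrow> norm (u z) * 0"
      by (intro tendsto_mult tendsto_const)
    moreover have "norm (T (G k) z) = norm (u z) * (norm ((deriv ^^ n) (test_fun g (a k)) (\<phi> z)) / carleson_mass (a k) powr (1 / p))" for k
    proof -
      have "(deriv ^^ n) (G k) (\<phi> z) = c k * (deriv ^^ n) (test_fun g (a k)) (\<phi> z)"
        unfolding G_def by (rule higher_deriv_cmult[OF holt]) (use \<phi>_disc[OF z] in auto)
      then show ?thesis by (simp add: D_op_def norm_mult nc)
    qed
    ultimately have "(\<lambda>k. norm (T (G k) z)) \<longlonglongrightarrow> 0" by simp
    then have "(\<lambda>k. T (G k) z) \<longlonglongrightarrow> 0" by (rule tendsto_norm_zero_cancel)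
    then show ?thesis using LIMSEQ_subseq_LIMSEQ[OF _ r] by (simp add: o_def)
  qed
  have "(\<integral>\<^sup>+z. ennreal (norm (h z) powr q) \<partial>weighted_area \<nu>) = 0"
  proof -
    have "(\<integral>\<^sup>+z. ennreal (norm (h z) powr q) \<partial>weighted_area \<nu>) = (\<integral>\<^sup>+z. liminf (\<lambda>k. ennreal (norm (T (G (r k)) z - h z) powr q)) \<partial>weighted_area \<nu>)"
    proof (rule nn_integral_cong)
      fix z assume "z \<in> space (weighted_area \<nu>)"
      then have "(\<lambda>k. T (G (r k)) z) \<longlonglongrightarrow> 0" by (intro pointwise) (simp add: spN)
      then have "(\<lambda>k. norm (T (G (r k)) z - h z) powr q) \<longlonglongrightarrow> norm (0 - h z) powr q"
        using q by (intro tendsto_powr' tendsto_norm tendsto_diff tendsto_const) auto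
      then have "(\<lambda>k. ennreal (norm (T (G (r k)) z - h z) powr q)) \<longlonglongrightarrow> ennreal (norm (0 - h z) powr q)" by (rule tendsto_ennrealI)
      from lim_imp_Liminf[OF sequentially_bot this]
      show "ennreal (norm (h z) powr q) = liminf (\<lambda>k. ennreal (norm (T (G (r k)) z - h z) powr q))" by simp
    qed
    also have "\<dots> \<le> liminf t"
    proof -
      have "(\<lambda>z. ennreal (norm (T (G (r k)) z - h z) powr q)) \<in> borel_measurable (weighted_area \<nu>)" for k
        using meas[OF T_holomorphic[OF holG[of "r k"]]] meas[OF holh] by measurable
      then show ?thesis unfolding t_def by (rule nn_integral_liminf)
    qed
    also have "\<dots> = 0" by (rule lim_imp_Liminf[OF sequentially_bot t_lim])
    finally show ?thesis by simp
  qed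
  then have "AE z in weighted_area \<nu>. ennreal (norm (h z) powr q) = 0"
    using meas[OF holh] by (subst (asm) nn_integral_0_iff_AE) measurable
  then have h0: "AE z in weighted_area \<nu>. h z = 0"
    by eventually_elim (simp add: ennreal_eq_0_iff)
  have t_target: "t k = target_size (G (r k))" for k
    unfolding t_def T_size[OF holG, symmetric]
    by (rule nn_integral_cong_AE) (use h0 in eventually_elim, simp)
  define P where "P = (pochhammer (real g) n * (1 / 2) ^ n) powr q"
  have P: "0 < P" using pochhammer_pos[of "real g" n] g_pos by (simp add: P_def)
  have "\<forall>\<^sub>F k in sequentially. t k < ennreal (e * P)"
    using t_lim e P by (intro order_tendstoD(2)[OF t_lim]) simp
  then obtain k where k: "t k < ennreal (e * P)"
    using eventually_happens'[OF sequentially_bot] by blast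
  define b where "b = a (r k)"
  have bD: "b \<in> unit_disc" and sb: "0 < carleson_mass b" using a(1) s by (auto simp: b_def)
  have "target_size (test_fun g b) \<le> ennreal (e * P * carleson_mass b powr (q / p))"
  proof -
    have "ennreal (1 / carleson_mass b powr (q / p)) * target_size (test_fun g b) = t k"
      unfolding t_target G_def target_size_cmult[OF holt] using nc[of "r k"] sb q
      by (simp add: b_def powr_divide powr_powr)
    then have "ennreal (carleson_mass b powr (q / p)) * (ennreal (1 / carleson_mass b powr (q / p)) * target_size (test_fun g b)) \<le> ennreal (carleson_mass b powr (q / p)) * ennreal (e * P)"
      using k by (intro mult_left_mono) auto
    moreover have "ennreal (carleson_mass b powr (q / p)) * ennreal (1 / carleson_mass b powr (q / p)) = 1"
      using sb by (subst ennreal_mult[symmetric]) auto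
    ultimately show ?thesis using e P by (simp add: mult.assoc[symmetric] ennreal_mult mult.commute)
  qed
  then have "testing_integral b \<le> ennreal (e * P / (pochhammer (real g) n * (1 / 2) ^ n) powr q)"
    using half[of "r k"] e P by (intro testing_integral_le_of_target_size bD) (auto simp: b_def)
  also have "e * P / (pochhammer (real g) n * (1 / 2) ^ n) powr q = e" using P by (simp add: P_def)
  finally show False using bad[of "r k"] by (simp add: b_def)
qed

lemma compact_iff:
  "compact_operator p \<omega> q \<nu> T \<longleftrightarrow> (\<forall>e>0. \<exists>\<delta>>0. \<forall>a\<in>unit_disc. 1 - norm a < \<delta> \<longrightarrow> testing_integral a \<le> ennreal e)"
  using compact_if compact_only_if by blast

end

theorem theorem3:
  fixes p :: real and \<omega> :: "complex \<Rightarrow> real"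
  assumes "0 < p" and "\<omega> \<in> doubling_weights"
  shows "\<exists>\<gamma>::real. \<gamma> > 0 \<and> ( \<forall>(q::real) \<nu> \<phi> u (n::nat).
    p \<le> q \<longrightarrow> \<nu> \<in> doubling_weights \<longrightarrow> analytic_self_map \<phi> \<longrightarrow> u \<in> bergman_space q \<nu> \<longrightarrow>
    (bounded_operator p \<omega> q \<nu> (D_op n \<phi> u) \<longleftrightarrow>
      (SUP a\<in>unit_disc. \<integral>\<^sup>+z. ennreal (norm (u z) powr q *
         ((1 - norm a) powr (\<gamma> * q) / norm (1 - cnj a * \<phi> z) powr ((\<gamma> + real n) * q)) *
         (\<nu> z / weight_measure \<omega> (carleson_square a) powr (q / p))) \<partial>dA) < \<infinity>)
    \<and> (compact_operator p \<omega> q \<nu> (D_op n \<phi> u) \<longleftrightarrow>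
      ((\<lambda>a. \<integral>\<^sup>+z. ennreal (norm (u z) powr q *
         ((1 - norm a) powr (\<gamma> * q) / norm (1 - cnj a * \<phi> z) powr ((\<gamma> + real n) * q)) *
         (\<nu> z / weight_measure \<omega> (carleson_square a) powr (q / p))) \<partial>dA)
       \<longlongrightarrow> 0) (filtercomap norm (at_left 1))))"
proof -
  interpret W: doubling_measure "weighted_area \<omega>" by (rule doubling_measure_weighted_area[OF assms(2)])
  have \<omega>: "weight \<omega>" using assms(2) unfolding doubling_weights_def radial_weight_def by blast
  (* The exponent depends on p and on the doubling constant of \<omega> alone. *)
  obtain g :: nat where g0: "(log 2 (4 * W.doubling_const) + 1) / p < real g" using reals_Archimedean2 by blast
  have g: "4 * W.doubling_const \<le> 2 powr (real g * p - 1)"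
  proof -
    have "log 2 (4 * W.doubling_const) \<le> real g * p - 1" using g0 assms(1) by (simp add: pos_divide_less_eq)
    then have "2 powr (log 2 (4 * W.doubling_const)) \<le> 2 powr (real g * p - 1)" by (intro powr_mono) auto
    then show ?thesis using W.doubling_const(1) by simp
  qed
  have "0 \<le> log 2 (4 * W.doubling_const)" using W.doubling_const(1) by simp
  then have "0 < (log 2 (4 * W.doubling_const) + 1) / p" using assms(1) by simp
  with g0 have gpos: "0 < real g" by linarith
  show ?thesis
  proof (rule exI[of _ "real g"], rule conjI[OF gpos], intro allI impI)
    fix q :: real and \<nu> \<phi> u and n :: nat
    assume pq: "p \<le> q" and \<nu>D: "\<nu> \<in> doubling_weights" and \<phi>: "analytic_self_map \<phi>" and u: "u \<in> bergman_space q \<nu>"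
    have \<nu>: "weight \<nu>" using \<nu>D unfolding doubling_weights_def radial_weight_def by blast
    have uh: "u holomorphic_on unit_disc" using u by (simp add: bergman_space_def)
    interpret B: bergman_operator \<omega> \<nu> u \<phi> p q g n
    proof unfold_locales
      show "(\<lambda>z. ennreal (norm (u z) powr q * \<nu> z)) \<in> borel_measurable dA"
        using bergman_integrand_measurable[OF \<nu> uh, of q] by measurable
      show "(\<integral>\<^sup>+z. ennreal (norm (u z) powr q * \<nu> z) \<partial>dA) < top"
        using u unfolding bergman_space_iff[OF \<nu>] nn_integral_weighted_area_norm_powr[OF \<nu> uh] by blast
    qed (fact assms(1) pq g \<phi> \<omega> \<nu> u)+
    let ?I = "\<lambda>a. \<integral>\<^sup>+z. ennreal (norm (u z) powr q *
         ((1 - norm a) powr (real g * q) / norm (1 - cnj a * \<phi> z) powr ((real g + real n) * q)) *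
         (\<nu> z / weight_measure \<omega> (carleson_square a) powr (q / p))) \<partial>dA"
    have testing_integral: "?I a = B.testing_integral a" if a: "a \<in> unit_disc" for a
    proof -
      have "carleson_square a \<in> sets dA"
        by (rule radial_measure.carleson_square_sets[OF radial_measure_dA a])
      then have carleson_mass: "weight_measure \<omega> (carleson_square a) = W.carleson_mass a"
        unfolding W.carleson_mass_def by (rule weight_measure_eq[OF \<omega>])
      show ?thesis
        unfolding B.testing_integral_def carleson_mass
      proof (rule nn_integral_cong)
        fix z assume "z \<in> space dA"
        then have "0 \<le> \<nu> z" using weightD(2)[OF \<nu>] by simp
        then have "ennreal (norm (u z) powr q * \<nu> z) * ennreal (W.test_kernel (real g) n q p a (\<phi> z))
          = ennreal (norm (u z) powr q * \<nu> z * W.test_kernel (real g) n q p a (\<phi> z))"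
          by (intro ennreal_mult[symmetric] W.test_kernel_nonneg) auto
        then show "ennreal (norm (u z) powr q *
             ((1 - norm a) powr (real g * q) / norm (1 - cnj a * \<phi> z) powr ((real g + real n) * q)) *
             (\<nu> z / W.carleson_mass a powr (q / p)))
           = ennreal (norm (u z) powr q * \<nu> z) * ennreal (W.test_kernel (real g) n q p a (\<phi> z))"
          by (simp add: W.test_kernel_def mult_ac)
      qed
    qed
    define S where "S = (SUP a\<in>unit_disc. B.testing_integral a)"
    have S_upper: "B.testing_integral a \<le> S" if "a \<in> unit_disc" for a
      unfolding S_def using that by (rule SUP_upper)
    have S_eq: "(SUP a\<in>unit_disc. ?I a) = S"
      unfolding S_def by (rule SUP_cong[OF refl testing_integral])
    have S_finite: "S < \<infinity> \<longleftrightarrow> (\<exists>A\<ge>0. \<forall>a\<in>unit_disc. B.testing_integral a \<le> ennreal A)"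
    proof
      assume "S < \<infinity>"
      then obtain A where "S = ennreal A" "0 \<le> A" by (cases S) auto
      then show "\<exists>A\<ge>0. \<forall>a\<in>unit_disc. B.testing_integral a \<le> ennreal A" using S_upper by blast
    next
      assume "\<exists>A\<ge>0. \<forall>a\<in>unit_disc. B.testing_integral a \<le> ennreal A"
      then obtain A where A: "\<And>a. a \<in> unit_disc \<Longrightarrow> B.testing_integral a \<le> ennreal A" by blast
      have "S \<le> ennreal A" unfolding S_def by (rule SUP_least) (rule A)
      then show "S < \<infinity>" by (rule le_less_trans) simp
    qed
    have 1: "bounded_operator p \<omega> q \<nu> (D_op n \<phi> u) \<longleftrightarrow> (SUP a\<in>unit_disc. ?I a) < \<infinity>"
      unfolding S_eq S_finite by (rule B.bounded_iff)
    have lim_iff: "(?I \<longlongrightarrow> 0) (filtercomap norm (at_left 1)) \<longleftrightarrow>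
        (\<forall>e>0. \<exists>\<delta>>0. \<forall>a\<in>unit_disc. 1 - norm a < \<delta> \<longrightarrow> B.testing_integral a \<le> ennreal e)"
    proof
      assume lim: "(?I \<longlongrightarrow> 0) (filtercomap norm (at_left 1))"
      show "\<forall>e>0. \<exists>\<delta>>0. \<forall>a\<in>unit_disc. 1 - norm a < \<delta> \<longrightarrow> B.testing_integral a \<le> ennreal e"
      proof (intro allI impI)
        fix e :: real assume "0 < e"
        then have "\<forall>\<^sub>F a in filtercomap norm (at_left 1). ?I a < ennreal e"
          by (intro order_tendstoD(2)[OF lim]) simp
        then obtain Q where Q: "\<forall>\<^sub>F x in at_left (1::real). Q x" "\<And>a. Q (norm a) \<Longrightarrow> ?I a < ennreal e"
          unfolding eventually_filtercomap by blast
        obtain b where b: "b < 1" "\<And>y. b < y \<Longrightarrow> y < 1 \<Longrightarrow> Q y"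
          using Q(1) unfolding eventually_at_left[of 0 "1::real", OF zero_less_one] by blast
        show "\<exists>\<delta>>0. \<forall>a\<in>unit_disc. 1 - norm a < \<delta> \<longrightarrow> B.testing_integral a \<le> ennreal e"
        proof (intro exI[of _ "1 - b"] conjI ballI impI)
          fix a :: complex assume a: "a \<in> unit_disc" "1 - norm a < 1 - b"
          then have "?I a < ennreal e" by (intro Q b) auto
          then show "B.testing_integral a \<le> ennreal e" unfolding testing_integral[OF a(1), symmetric] by (rule less_imp_le)
        qed (use b in simp)
      qed
    next
      assume small: "\<forall>e>0. \<exists>\<delta>>0. \<forall>a\<in>unit_disc. 1 - norm a < \<delta> \<longrightarrow> B.testing_integral a \<le> ennreal e"
      show "(?I \<longlongrightarrow> 0) (filtercomap norm (at_left 1))"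
      proof (rule order_tendstoI)
        fix x :: ennreal assume "0 < x"
        then obtain e where e: "0 < e" "ennreal e < x"
        proof -
          obtain y where y: "0 < y" "y < x" using dense[OF \<open>0 < x\<close>] by blast
          then have "y < top" by (meson less_le_trans top_greatest)
          then obtain e where "y = ennreal e" "0 \<le> e" by (cases y) auto
          with y show ?thesis using that[of e] by simp
        qed
        obtain \<delta> where \<delta>: "0 < \<delta>" "\<And>a. a \<in> unit_disc \<Longrightarrow> 1 - norm a < \<delta> \<Longrightarrow> B.testing_integral a \<le> ennreal e"
          using small e(1) by blast
        have "\<forall>\<^sub>F y in at_left (1::real). 1 - \<delta> < y \<and> y < 1"
          unfolding eventually_at_left[of 0 "1::real", OF zero_less_one] using \<delta>(1) by (intro exI[of _ "1 - \<delta>"]) auto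
        moreover have "?I a < x" if "1 - \<delta> < norm a \<and> norm a < 1" for a
        proof -
          have a: "a \<in> unit_disc" using that by simp
          have "?I a = B.testing_integral a" by (rule testing_integral[OF a])
          also have "\<dots> \<le> ennreal e" using that by (intro \<delta> a) linarith
          finally show ?thesis using e(2) by simp
        qed
        ultimately show "\<forall>\<^sub>F a in filtercomap norm (at_left 1). ?I a < x"
          unfolding eventually_filtercomap by blast
      qed simp
    qed
    have 2: "compact_operator p \<omega> q \<nu> (D_op n \<phi> u) \<longleftrightarrow> (?I \<longlongrightarrow> 0) (filtercomap norm (at_left 1))"
      unfolding lim_iff by (rule B.compact_iff)
    show "(bounded_operator p \<omega> q \<nu> (D_op n \<phi> u) \<longleftrightarrow> (SUP a\<in>unit_disc. ?I a) < \<infinity>)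
      \<and> (compact_operator p \<omega> q \<nu> (D_op n \<phi> u) \<longleftrightarrow> (?I \<longlongrightarrow> 0) (filtercomap norm (at_left 1)))"
      by (rule conjI[OF 1 2])
  qed
qed

end
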